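(* Let $X$ be a projective variety of dimension $d$ over an algebraically closed field, $Y_\bullet$ a flag on $X$ with associated valuation $\nu=\nu_{Y_\bullet}$, $\mathcal{L}$ a line bundle on $X$, $V\subseteq H^0(X,\mathcal{L})$ a linear system, and $1\le r\le d$. Suppose condition $\mathcal{D}_r(V,V^m)$ (defined in the context) holds for all $m\geq1$. Then $\Gamma_\nu|_r(V)$ is generated by $\{1\}\times\nu|_r(V)$. In particular, if $r=d$, then the Okounkov body $\Delta_{Y_\bullet}(V)$ is equal to the lattice polytope $\operatorname{Conv}(\nu(V))$.
   Context: All divisors are Cartier. A flag $Y_\bullet$ is a chain $X=Y_0\supset Y_1\supset\cdots\supset Y_d$ of (irreducible) subvarieties, where $Y_r$ has codimension $r$ in $X$ and is nonsingular at the point $Y_d$. For linear systems $V\subseteq H^0(X,\mathcal{L})$, $W\subseteq H^0(X,\mathcal{M})$, $V\cdot W\subseteq H^0(X,\mathcal{L}\otimes\mathcal{M})$ is the span of products, and $V^m\subseteq H^0(X,\mathcal{L}^{\otimes m})$ is the span of $m$-fold products. Valuation: for a nonzero section $f$ of a line bundle, $\nu_1=\operatorname{ord}_{Y_1}(f)$; with $y_1$ a local equation of $Y_1$, $f_1=(f y_1^{-\nu_1})|_{Y_1}$; $\nu_2=\operatorname{ord}_{Y_2}(f_1)$; and so on. $\nu(f)=(\nu_1,\dots,\nu_d)$, $\nu|_r=(\nu_1,\dots,\nu_r)$, and $\nu(V)$, $\nu|_r(V)$ denote the images of $V\setminus\{0\}$. $\Gamma_\nu|_r(V)=\{(m,\nu|_r(f))\mid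 f\in V^m\setminus\{0\}\}\subset\mathbb{Z}\times\mathbb{Z}^r$, and $\Gamma_\nu(V)=\Gamma_\nu|_d(V)$. $\Delta_{Y_\bullet}(V)$ is the intersection of $\{1\}\times\mathbb{R}^d$ with the closure of the convex hull of $\Gamma_\nu(V)$ in $\mathbb{R}\times\mathbb{R}^d$. Restricted systems: for an effective divisor $E$, $V-E\subseteq H^0(X,\mathcal{L}\otimes\mathcal{O}(-E))$ is the inverse image of $V$ under the map $H^0(X,\mathcal{L}\otimes\mathcal{O}(-E))\to H^0(X,\mathcal{L})$ given by the section of $\mathcal{O}(E)$ defining $E$. For $\mathbf{a}=(a_1,\dots,a_r)$, define $V(\mathbf{a})\subseteq H^0(Y_r,\mathcal{L}\otimes\mathcal{O}(-a_1Y_1-\cdots-a_rY_r)|_{Y_r})$ inductively as the image of $V(a_1,\dots,a_{r-1})-a_rY_r$ under restriction from $Y_{r-1}$ to $Y_r$ (with $V(\emptyset)=V$). Saturation: a linear system $V$ is saturated with respect to a divisor $Y$ if $\{\operatorname{ord}_Y(f)\mid f\in V\setminus\{0\}\}$ is a full integer interval $[a_{\min},a_{\max}]\subset\mathbb{Z}$. Maximal divisors: let $V\subseteq H^0(X,\mathcal{L})$ be a linear system and $Y\subseteq X$ a prime divisor. An effective divisor $aY+b_1B_1+\cdots+b_kB_k+e_1E_1+\cdots+e_\ell E_\ell$ in $V$ (a sum of irreducible components with multiplicities) is maximal in $V$ with respect to $Y$ if each $b_iB_i$ is contained in the base scheme of $V$, and the classes of the $E_i$ lie in a facet of the pseudoeffective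 cone $\overline{\mathrm{Eff}}(X)\subset N^1(X)_{\mathbb{R}}$ not containing the class of $Y$. Here a facet of a convex cone means the intersection of the cone with a supporting hyperplane. Conditions, for linear systems $V,W$ and $1\le r\le d$ (maximality of divisors on $Y_{r-1}$ being with respect to $Y_r$): (i) for each $\mathbf{a}\in\nu|_{r-1}(V)$, $V(\mathbf{a})$ contains a maximal divisor, as well as a section not vanishing at the point $Y_d$; and similarly for $W(\mathbf{b})$ for each $\mathbf{b}\in\nu|_{r-1}(W)$; (ii) for each $\mathbf{c}\in\nu|_{r-1}(V)+\nu|_{r-1}(W)$, there is a divisor in $V(\mathbf{a})\cdot W(\mathbf{b})$ which is maximal in $(V\cdot W)(\mathbf{c})$, for some $\mathbf{a}\in\nu|_{r-1}(V)$, $\mathbf{b}\in\nu|_{r-1}(W)$ with $\mathbf{a}+\mathbf{b}=\mathbf{c}$; (iii) for each $\mathbf{a}\in\nu|_{r-1}(V)$ and $\mathbf{b}\in\nu|_{r-1}(W)$, the linear systems $V(\mathbf{a})$ and $W(\mathbf{b})$ are saturated with respect to $Y_r$. Condition $\mathcal{D}_r(V,W)$ holds if (i), (ii), (iii) hold (for $r$) and $\mathcal{D}_{r-1}(V,W)$ holds ($\mathcal{D}_0$ being vacuous).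
   Formalization: In (ii) the maximal divisor in V(a)·W(b) must be the divisor of a single product s·t with s in V(a), t in W(b), not of any element of the span; with the span the claim fails, e.g. for V=H^0(O(1)) on P(O(1,0)⊕O(0,1)) over P^1×P^1, Y_2 the diagonal, r=2. *)

theory Defs
  imports
    "HOL-Analysis.Analysis"
    "HOL-Computational_Algebra.Polynomial"
    "HOL-Library.Function_Algebras"
begin

section \<open>Projective varieties\<close>

text \<open>
  \<open>('k, 'n) pspace\<close> is projective space over \<open>'k\<close> with homogeneous coordinates indexed by
  \<open>'n\<close>, so of dimension \<open>CARD('n) - 1\<close>.
\<close>

definition proj_rel :: "('n \<Rightarrow> 'k::field) \<Rightarrow> ('n \<Rightarrow> 'k) \<Rightarrow> bool" where
  "proj_rel v w \<longleftrightarrow> v \<noteq> (\<lambda>_. 0) \<and> w \<noteq> (\<lambda>_. 0) \<and> (\<exists>c. c \<noteq> 0 \<and> w = (\<lambda>i. c * v i))"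

lemma part_equivp_proj_rel: "part_equivp (proj_rel :: ('n \<Rightarrow> 'k::field) \<Rightarrow> _)"
proof (rule part_equivpI)
  have "proj_rel (\<lambda>_::'n. 1::'k) (\<lambda>_. 1)"
    unfolding proj_rel_def by (metis mult_1 zero_neq_one)
  then show "\<exists>v::'n \<Rightarrow> 'k. proj_rel v v" by blast
  show "symp (proj_rel :: ('n \<Rightarrow> 'k) \<Rightarrow> _)"
  proof (rule sympI)
    fix v w :: "'n \<Rightarrow> 'k"
    assume "proj_rel v w"
    then obtain c where c: "v \<noteq> (\<lambda>_. 0)" "w \<noteq> (\<lambda>_. 0)" "c \<noteq> 0" "w = (\<lambda>i. c * v i)"
      unfolding proj_rel_def by blast
    then have "v = (\<lambda>i. inverse c * w i)" by (simp add: fun_eq_iff)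
    then show "proj_rel w v"
      unfolding proj_rel_def using c by (metis nonzero_imp_inverse_nonzero)
  qed
  show "transp (proj_rel :: ('n \<Rightarrow> 'k) \<Rightarrow> _)"
  proof (rule transpI)
    fix u v w :: "'n \<Rightarrow> 'k"
    assume "proj_rel u v" "proj_rel v w"
    then obtain c e where c: "u \<noteq> (\<lambda>_. 0)" "w \<noteq> (\<lambda>_. 0)" "c \<noteq> 0" "e \<noteq> 0"
        "v = (\<lambda>i. c * u i)" "w = (\<lambda>i. e * v i)"
      unfolding proj_rel_def by blast
    then have "w = (\<lambda>i. (e * c) * u i)" by (simp add: mult.assoc)
    then show "proj_rel u w"
      unfolding proj_rel_def using c by (metis mult_eq_0_iff)
  qed
qed

quotient_type (overloaded) ('k, 'n) pspace = "'n \<Rightarrow> 'k::field" / partial: proj_rel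
  by (rule part_equivp_proj_rel)

text \<open>
  Forms are treated as polynomial functions.  The value of a form at \<open>rep_pspace p\<close> depends on
  the representative, but its vanishing and the quotients of two forms of equal degree do not.
\<close>

definition forms :: "nat \<Rightarrow> (('n::finite \<Rightarrow> 'k::field) \<Rightarrow> 'k) set" where
  "forms m = {(\<lambda>x. \<Sum>\<alpha> | (\<Sum>i\<in>UNIV. \<alpha> i) = m. c \<alpha> * (\<Prod>i\<in>UNIV. x i ^ \<alpha> i)) | c :: ('n \<Rightarrow> nat) \<Rightarrow> 'k. True}"

definition zariski :: "('k::field, 'n::finite) pspace topology" where
  "zariski = topology_generated_by {{p. F (rep_pspace p) \<noteq> 0} | F m. F \<in> forms m}"

definition zopen :: "('k::field, 'n::finite) pspace set \<Rightarrow> ('k, 'n) pspace set \<Rightarrow> bool" where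
  "zopen Z W \<longleftrightarrow> openin (subtopology zariski Z) W"

definition projective_variety :: "('k::field, 'n::finite) pspace set \<Rightarrow> bool" where
  "projective_variety Z \<longleftrightarrow> closedin zariski Z \<and> Z \<noteq> {} \<and>
     (\<forall>A B. closedin zariski A \<and> closedin zariski B \<and> Z \<subseteq> A \<union> B \<longrightarrow> Z \<subseteq> A \<or> Z \<subseteq> B)"

text \<open>Regular functions on an open subset \<open>W\<close> of a variety.\<close>

definition regular :: "('k::field, 'n::finite) pspace set \<Rightarrow> (('k, 'n) pspace \<Rightarrow> 'k) \<Rightarrow> bool" where
  "regular W f \<longleftrightarrow> (\<forall>p\<in>W. \<exists>m. \<exists>F\<in>forms m. \<exists>G\<in>forms m. G (rep_pspace p) \<noteq> 0 \<and>
     (\<forall>q\<in>W. G (rep_pspace q) \<noteq> 0 \<longrightarrow> f q = F (rep_pspace q) / G (rep_pspace q)))"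

text \<open>
  A rational function on \<open>Z\<close> is represented by any function on points that is regular on some
  nonempty open subset of \<open>Z\<close>; two of them represent the same element of the function field iff
  they are related by \<open>gen_eq Z\<close>.  The predicate \<open>in_stalk Z p f\<close> says that the rational
  function \<open>f\<close> lies in the local ring of \<open>Z\<close> at \<open>p\<close>, whatever the value \<open>f p\<close> may be.
\<close>

definition gen_eq :: "('k::field, 'n::finite) pspace set \<Rightarrow> (('k, 'n) pspace \<Rightarrow> 'k) \<Rightarrow>
    (('k, 'n) pspace \<Rightarrow> 'k) \<Rightarrow> bool" where
  "gen_eq Z f g \<longleftrightarrow> (\<exists>W. zopen Z W \<and> W \<noteq> {} \<and> (\<forall>q\<in>W. f q = g q))"

definition nonzero_ratfun :: "('k::field, 'n::finite) pspace set \<Rightarrow> (('k, 'n) pspace \<Rightarrow> 'k) \<Rightarrow> bool" where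
  "nonzero_ratfun Z f \<longleftrightarrow> (\<exists>W. zopen Z W \<and> W \<noteq> {} \<and> regular W f) \<and> \<not> gen_eq Z f (\<lambda>_. 0)"

definition in_stalk :: "('k::field, 'n::finite) pspace set \<Rightarrow> ('k, 'n) pspace \<Rightarrow>
    (('k, 'n) pspace \<Rightarrow> 'k) \<Rightarrow> bool" where
  "in_stalk Z p f \<longleftrightarrow> (\<exists>W u. zopen Z W \<and> p \<in> W \<and> regular W u \<and> gen_eq Z f u)"

definition unit_in_stalk :: "('k::field, 'n::finite) pspace set \<Rightarrow> ('k, 'n) pspace \<Rightarrow>
    (('k, 'n) pspace \<Rightarrow> 'k) \<Rightarrow> bool" where
  "unit_in_stalk Z p f \<longleftrightarrow>
     (\<exists>W u. zopen Z W \<and> p \<in> W \<and> regular W u \<and> (\<forall>q\<in>W. u q \<noteq> 0) \<and> gen_eq Z f u)"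

text \<open>The dimension of a variety is the transcendence degree of its function field.\<close>

definition multi_exponents :: "nat \<Rightarrow> nat \<Rightarrow> (nat \<Rightarrow> nat) set" where
  "multi_exponents n e = {\<alpha>. (\<forall>j<n. \<alpha> j \<le> e) \<and> (\<forall>j\<ge>n. \<alpha> j = 0)}"

definition alg_independent :: "('k::field, 'n::finite) pspace set \<Rightarrow> nat \<Rightarrow>
    (nat \<Rightarrow> ('k, 'n) pspace \<Rightarrow> 'k) \<Rightarrow> bool" where
  "alg_independent W n f \<longleftrightarrow> (\<forall>e c.
     (\<forall>x\<in>W. (\<Sum>\<alpha>\<in>multi_exponents n e. c \<alpha> * (\<Prod>j<n. f j x ^ \<alpha> j)) = 0) \<longrightarrow>
     (\<forall>\<alpha>\<in>multi_exponents n e. c \<alpha> = 0))"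

definition has_independent_ratfuns :: "('k::field, 'n::finite) pspace set \<Rightarrow> nat \<Rightarrow> bool" where
  "has_independent_ratfuns Z n \<longleftrightarrow>
     (\<exists>W f. zopen Z W \<and> W \<noteq> {} \<and> (\<forall>j<n. regular W (f j)) \<and> alg_independent W n f)"

definition has_dim :: "('k::field, 'n::finite) pspace set \<Rightarrow> nat \<Rightarrow> bool" where
  "has_dim Z d \<longleftrightarrow> has_independent_ratfuns Z d \<and> \<not> has_independent_ratfuns Z (Suc d)"

text \<open>
  Regularity of the local ring at \<open>p\<close>: its maximal ideal is generated by \<open>dim Z\<close> elements
  (for a closed point \<open>p\<close>, \<open>dim Z\<close> is the Krull dimension of the local ring).
\<close>

definition vanishing_near :: "('k::field, 'n::finite) pspace set \<Rightarrow> ('k, 'n) pspace \<Rightarrow>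
    (('k, 'n) pspace \<Rightarrow> 'k) \<Rightarrow> bool" where
  "vanishing_near Z p f \<longleftrightarrow> (\<exists>W. zopen Z W \<and> p \<in> W \<and> regular W f) \<and> f p = 0"

definition nonsingular_at :: "('k::field, 'n::finite) pspace set \<Rightarrow> ('k, 'n) pspace \<Rightarrow> bool" where
  "nonsingular_at Z p \<longleftrightarrow> (\<exists>e t. has_dim Z e \<and> (\<forall>j<e. vanishing_near Z p (t j)) \<and>
     (\<forall>f. vanishing_near Z p f \<longrightarrow> (\<exists>W c. zopen Z W \<and> p \<in> W \<and> (\<forall>j<e. regular W (c j)) \<and>
        (\<forall>q\<in>W. f q = (\<Sum>j<e. c j q * t j q)))))"


section \<open>Cartier divisors\<close>

text \<open>
  A family assigns to every point \<open>p\<close> of a variety a function to be used near \<open>p\<close>.  Families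
  serve as local equations of Cartier divisors, and (below) as sections of line bundles expressed
  in local trivialisations.  Accordingly the divisor of a section is given by the same family.
\<close>

type_synonym ('k, 'n) family = "('k, 'n) pspace \<Rightarrow> ('k, 'n) pspace \<Rightarrow> 'k"

definition cartier :: "('k::field, 'n::finite) pspace set \<Rightarrow> ('k, 'n) family \<Rightarrow> bool" where
  "cartier Z D \<longleftrightarrow> (\<forall>p\<in>Z. nonzero_ratfun Z (D p)) \<and>
     (\<forall>p\<in>Z. \<exists>W. zopen Z W \<and> p \<in> W \<and> (\<forall>q\<in>W. unit_in_stalk Z q (\<lambda>x. D p x / D q x)))"

definition effective :: "('k::field, 'n::finite) pspace set \<Rightarrow> ('k, 'n) family \<Rightarrow> bool" where
  "effective Z D \<longleftrightarrow> cartier Z D \<and> (\<forall>p\<in>Z. in_stalk Z p (D p))"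

text \<open>\<open>f\<close> generates the ideal sheaf of the reduced closed subset \<open>P\<close> on the open subset \<open>W\<close> of \<open>Z\<close>.\<close>

definition local_equation :: "('k::field, 'n::finite) pspace set \<Rightarrow> ('k, 'n) pspace set \<Rightarrow>
    ('k, 'n) pspace set \<Rightarrow> (('k, 'n) pspace \<Rightarrow> 'k) \<Rightarrow> bool" where
  "local_equation Z P W f \<longleftrightarrow> zopen Z W \<and> regular W f \<and> (\<forall>q\<in>W \<inter> P. f q = 0) \<and>
     (\<forall>q\<in>W. \<forall>W' g. zopen Z W' \<and> q \<in> W' \<and> W' \<subseteq> W \<and> regular W' g \<and> (\<forall>x\<in>W' \<inter> P. g x = 0) \<longrightarrow>
        (\<exists>W'' u. zopen Z W'' \<and> q \<in> W'' \<and> W'' \<subseteq> W' \<and> regular W'' u \<and> (\<forall>x\<in>W''. g x = u x * f x)))"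

definition prime_divisor :: "('k::field, 'n::finite) pspace set \<Rightarrow> ('k, 'n) pspace set \<Rightarrow>
    ('k, 'n) family \<Rightarrow> bool" where
  "prime_divisor Z P \<eta> \<longleftrightarrow> projective_variety P \<and> P \<subseteq> Z \<and>
     (\<exists>e. has_dim P e \<and> has_dim Z (Suc e)) \<and>
     (\<forall>p\<in>Z. \<exists>W. p \<in> W \<and> local_equation Z P W (\<eta> p))"


section \<open>Intersection numbers with curves\<close>

text \<open>
  \<open>local_length C p a\<close> is the length of the quotient of the local ring of the curve \<open>C\<close> at \<open>p\<close>
  by the ideal generated by \<open>a\<close>; over an algebraically closed field this is its dimension over
  \<open>'k\<close>.  On a possibly singular curve the order at \<open>p\<close> of a quotient \<open>a / b\<close> is the difference
  of the lengths of \<open>a\<close> and \<open>b\<close>.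
\<close>

definition local_length :: "('k::field, 'n::finite) pspace set \<Rightarrow> ('k, 'n) pspace \<Rightarrow>
    (('k, 'n) pspace \<Rightarrow> 'k) \<Rightarrow> nat" where
  "local_length C p a = (GREATEST n. \<exists>f. (\<forall>j<n. in_stalk C p (f j)) \<and>
     (\<forall>c. in_stalk C p (\<lambda>q. (\<Sum>j<n. c j * f j q) / a q) \<longrightarrow> (\<forall>j<n. c j = 0)))"

definition ord_at :: "('k::field, 'n::finite) pspace set \<Rightarrow> ('k, 'n) pspace \<Rightarrow>
    (('k, 'n) pspace \<Rightarrow> 'k) \<Rightarrow> int" where
  "ord_at C p g = (THE z. \<exists>a b. in_stalk C p a \<and> in_stalk C p b \<and>
     \<not> gen_eq C a (\<lambda>_. 0) \<and> \<not> gen_eq C b (\<lambda>_. 0) \<and> gen_eq C g (\<lambda>q. a q / b q) \<and>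
     z = int (local_length C p a) - int (local_length C p b))"

text \<open>
  \<open>f\<close>, a rational function on \<open>Z\<close>, is a unit in the local ring of \<open>Z\<close> along the subvariety \<open>C\<close>,
  and \<open>u\<close> is a representative of \<open>f\<close> which can be restricted to \<open>C\<close>.
\<close>

definition restricts_to :: "('k::field, 'n::finite) pspace set \<Rightarrow> ('k, 'n) pspace set \<Rightarrow>
    (('k, 'n) pspace \<Rightarrow> 'k) \<Rightarrow> (('k, 'n) pspace \<Rightarrow> 'k) \<Rightarrow> bool" where
  "restricts_to Z C f u \<longleftrightarrow>
     (\<exists>W. zopen Z W \<and> regular W u \<and> gen_eq Z f u \<and> (\<exists>q\<in>W \<inter> C. u q \<noteq> 0))"

text \<open>
  The intersection number of \<open>D\<close> with the curve \<open>C\<close>, that is the degree of the restriction to \<open>C\<close>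
  of the line bundle of \<open>D\<close>: subtract from \<open>D\<close> a principal divisor \<open>div h\<close> so that \<open>C\<close> is not
  contained in the support of the difference, and take the degree of the restriction \<open>E\<close> of
  \<open>D - div h\<close> to \<open>C\<close>.  It does not depend on \<open>h\<close>, since principal divisors on the projective
  curve \<open>C\<close> have degree zero.
\<close>

definition intersection_number :: "('k::field, 'n::finite) pspace set \<Rightarrow> ('k, 'n) family \<Rightarrow>
    ('k, 'n) pspace set \<Rightarrow> int" where
  "intersection_number Z D C = (THE z. \<exists>h E. nonzero_ratfun Z h \<and>
     (\<forall>p\<in>C. restricts_to Z C (\<lambda>q. D p q / h q) (E p)) \<and>
     z = (\<Sum>p | p \<in> C \<and> ord_at C p (E p) \<noteq> 0. ord_at C p (E p)))"

definition num_equiv :: "('k::field, 'n::finite) pspace set \<Rightarrow> ('k, 'n) family \<Rightarrow>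
    ('k, 'n) family \<Rightarrow> bool" where
  "num_equiv Z D D' \<longleftrightarrow> (\<forall>C. projective_variety C \<and> has_dim C 1 \<and> C \<subseteq> Z \<longrightarrow>
     intersection_number Z D C = intersection_number Z D' C)"


section \<open>The pseudoeffective cone\<close>

instantiation "fun" :: (type, real_vector) real_vector
begin

definition scaleR_fun :: "real \<Rightarrow> ('a \<Rightarrow> 'b) \<Rightarrow> 'a \<Rightarrow> 'b" where
  "scaleR_fun r f = (\<lambda>x. r *\<^sub>R f x)"

instance
  by standard (simp_all add: scaleR_fun_def fun_eq_iff scaleR_add_right scaleR_add_left)

end

text \<open>
  \<open>num_functionals Z\<close> is the set of homomorphisms to the reals of the group
  \<open>N\<^sup>1(Z)\<close> of Cartier divisors modulo numerical equivalence.  That group is free of finite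
  rank, so \<open>N\<^sup>1(Z) \<otimes> \<real>\<close> embeds into its bidual by evaluation: the class of \<open>D\<close> is represented
  by the evaluation \<open>\<psi> \<mapsto> \<psi> D\<close>, and \<open>N\<^sup>1(Z) \<otimes> \<real>\<close> by the span of these
  (coordinates outside \<open>num_functionals Z\<close> being set to zero).  As the span is
  finite-dimensional, it is closed, and the topology of pointwise convergence induces on it the
  Euclidean topology.
\<close>

definition num_functionals :: "('k::field, 'n::finite) pspace set \<Rightarrow> (('k, 'n) family \<Rightarrow> real) set" where
  "num_functionals Z = {\<psi>.
     (\<forall>D D'. cartier Z D \<and> cartier Z D' \<longrightarrow> \<psi> (\<lambda>p q. D p q * D' p q) = \<psi> D + \<psi> D') \<and>
     (\<forall>D D'. cartier Z D \<and> cartier Z D' \<and> num_equiv Z D D' \<longrightarrow> \<psi> D = \<psi> D')}"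

definition num_class :: "('k::field, 'n::finite) pspace set \<Rightarrow> ('k, 'n) family \<Rightarrow>
    (('k, 'n) family \<Rightarrow> real) \<Rightarrow> real" where
  "num_class Z D = (\<lambda>\<psi>. if \<psi> \<in> num_functionals Z then \<psi> D else 0)"

definition N1 :: "('k::field, 'n::finite) pspace set \<Rightarrow> ((('k, 'n) family \<Rightarrow> real) \<Rightarrow> real) set" where
  "N1 Z = span (num_class Z ` {D. cartier Z D})"

definition pseudoeffective_cone ::
    "('k::field, 'n::finite) pspace set \<Rightarrow> ((('k, 'n) family \<Rightarrow> real) \<Rightarrow> real) set" where
  "pseudoeffective_cone Z = closure (convex_cone hull (num_class Z ` {D. effective Z D}))"

text \<open>
  A facet is cut out by any supporting hyperplane, so it may be a face of any dimension.  Linear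
  functionals on \<open>N1 Z\<close> are given by linear functionals on the ambient space; all of them extend.
\<close>

definition facet_of_pseff :: "('k::field, 'n::finite) pspace set \<Rightarrow>
    ((('k, 'n) family \<Rightarrow> real) \<Rightarrow> real) set \<Rightarrow> bool" where
  "facet_of_pseff Z F \<longleftrightarrow> (\<exists>\<phi>. linear \<phi> \<and> (\<exists>x\<in>N1 Z. \<phi> x \<noteq> (0::real)) \<and>
     (\<forall>x\<in>pseudoeffective_cone Z. 0 \<le> \<phi> x) \<and> F = {x\<in>pseudoeffective_cone Z. \<phi> x = 0})"


section \<open>Line bundles and linear systems\<close>

text \<open>
  Throughout, \<open>U p\<close> is an open neighbourhood of \<open>p\<close> in \<open>X\<close> on which all line bundles under
  consideration are trivialised.  Finitely many line bundles on \<open>X\<close> and on subvarieties of \<open>X\<close>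
  always admit such a common choice of neighbourhoods.  The line bundle itself is given by
  transition functions \<open>g p q\<close> on \<open>U p \<inter> U q\<close>; a section is a family whose member \<open>s p\<close> is
  regular on \<open>U p\<close>, with \<open>s p = g p q * s q\<close> on overlaps, and is set to zero off \<open>U p\<close>.
\<close>

definition open_neighbourhoods :: "('k::field, 'n::finite) pspace set \<Rightarrow>
    (('k, 'n) pspace \<Rightarrow> ('k, 'n) pspace set) \<Rightarrow> bool" where
  "open_neighbourhoods X U \<longleftrightarrow> (\<forall>p\<in>X. zopen X (U p) \<and> p \<in> U p)"

definition line_bundle :: "('k::field, 'n::finite) pspace set \<Rightarrow>
    (('k, 'n) pspace \<Rightarrow> ('k, 'n) pspace set) \<Rightarrow>
    (('k, 'n) pspace \<Rightarrow> ('k, 'n) pspace \<Rightarrow> ('k, 'n) pspace \<Rightarrow> 'k) \<Rightarrow> bool" where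
  "line_bundle X U g \<longleftrightarrow> open_neighbourhoods X U \<and>
     (\<forall>p\<in>X. \<forall>q\<in>X. regular (U p \<inter> U q) (g p q) \<and> (\<forall>x\<in>U p \<inter> U q. g p q x \<noteq> 0)) \<and>
     (\<forall>p\<in>X. \<forall>q\<in>X. \<forall>r\<in>X. \<forall>x\<in>U p \<inter> U q \<inter> U r. g p q x * g q r x = g p r x)"

text \<open>Regular families on a subvariety \<open>Z\<close> of \<open>X\<close>, without any compatibility on overlaps.\<close>

definition regular_families :: "('k::field, 'n::finite) pspace set \<Rightarrow>
    (('k, 'n) pspace \<Rightarrow> ('k, 'n) pspace set) \<Rightarrow> ('k, 'n) family set" where
  "regular_families Z U = {s. (\<forall>p\<in>Z. regular (U p \<inter> Z) (s p)) \<and>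
     (\<forall>p q. \<not> (p \<in> Z \<and> q \<in> U p \<inter> Z) \<longrightarrow> s p q = 0)}"

definition sections :: "('k::field, 'n::finite) pspace set \<Rightarrow>
    (('k, 'n) pspace \<Rightarrow> ('k, 'n) pspace set) \<Rightarrow>
    (('k, 'n) pspace \<Rightarrow> ('k, 'n) pspace \<Rightarrow> ('k, 'n) pspace \<Rightarrow> 'k) \<Rightarrow> ('k, 'n) family set" where
  "sections X U g = {s \<in> regular_families X U.
     \<forall>p\<in>X. \<forall>q\<in>X. \<forall>x\<in>U p \<inter> U q. s p x = g p q x * s q x}"

definition scale_family :: "'k::field \<Rightarrow> ('k, 'n) family \<Rightarrow> ('k, 'n) family" where
  "scale_family c s = (\<lambda>p q. c * s p q)"

lemma module_scale_family: "module (scale_family :: 'k::field \<Rightarrow> ('k, 'n) family \<Rightarrow> _)"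
  by unfold_locales (auto simp: scale_family_def algebra_simps fun_eq_iff)

definition linear_system :: "('k::field, 'n::finite) pspace set \<Rightarrow>
    (('k, 'n) pspace \<Rightarrow> ('k, 'n) pspace set) \<Rightarrow>
    (('k, 'n) pspace \<Rightarrow> ('k, 'n) pspace \<Rightarrow> ('k, 'n) pspace \<Rightarrow> 'k) \<Rightarrow> ('k, 'n) family set \<Rightarrow> bool" where
  "linear_system X U g V \<longleftrightarrow> V \<subseteq> sections X U g \<and> module.subspace scale_family V"

definition family_mult :: "('k::field, 'n) family \<Rightarrow> ('k, 'n) family \<Rightarrow> ('k, 'n) family" where
  "family_mult s t = (\<lambda>p q. s p q * t p q)"

definition system_mult :: "('k::field, 'n) family set \<Rightarrow> ('k, 'n) family set \<Rightarrow> ('k, 'n) family set" where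
  "system_mult V W = module.span scale_family {family_mult s t | s t. s \<in> V \<and> t \<in> W}"

text \<open>The power with exponent \<open>0\<close> consists of the constant functions.\<close>

definition system_power :: "('k::field, 'n::finite) pspace set \<Rightarrow>
    (('k, 'n) pspace \<Rightarrow> ('k, 'n) pspace set) \<Rightarrow> ('k, 'n) family set \<Rightarrow> nat \<Rightarrow> ('k, 'n) family set" where
  "system_power X U V m = module.span scale_family
     {(\<lambda>p q. if p \<in> X \<and> q \<in> U p \<inter> X then \<Prod>j<m. s j p q else 0) | s. \<forall>j<m. s j \<in> V}"

text \<open>\<open>V - E\<close>, for an effective divisor \<open>E\<close> with local equations \<open>e p\<close> on \<open>U p\<close>.\<close>

definition system_minus :: "('k::field, 'n::finite) pspace set \<Rightarrow>
    (('k, 'n) pspace \<Rightarrow> ('k, 'n) pspace set) \<Rightarrow> ('k, 'n) family set \<Rightarrow> ('k, 'n) family \<Rightarrow>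
    ('k, 'n) family set" where
  "system_minus Z U V e = {t \<in> regular_families Z U. family_mult t e \<in> V}"

definition restrict_family :: "('k::field, 'n) pspace set \<Rightarrow> ('k, 'n) family \<Rightarrow> ('k, 'n) family" where
  "restrict_family P s = (\<lambda>p q. if p \<in> P \<and> q \<in> P then s p q else 0)"

definition family_power :: "('k::field, 'n) family \<Rightarrow> nat \<Rightarrow> ('k, 'n) family" where
  "family_power y n = (\<lambda>p q. y p q ^ n)"


section \<open>Flags, valuations and Okounkov bodies\<close>

text \<open>
  \<open>y r p\<close> is a local equation of the divisor \<open>Y r\<close> of \<open>Y (r - 1)\<close> on \<open>U p \<inter> Y (r - 1)\<close>.
\<close>

definition flag :: "('k::field, 'n::finite) pspace set \<Rightarrow> nat \<Rightarrow>
    (('k, 'n) pspace \<Rightarrow> ('k, 'n) pspace set) \<Rightarrow>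
    (nat \<Rightarrow> ('k, 'n) pspace set) \<Rightarrow> (nat \<Rightarrow> ('k, 'n) family) \<Rightarrow> bool" where
  "flag X d U Y y \<longleftrightarrow> Y 0 = X \<and>
     (\<forall>r\<le>d. projective_variety (Y r) \<and> has_dim (Y r) (d - r) \<and> (\<forall>p\<in>Y d. nonsingular_at (Y r) p)) \<and>
     (\<forall>r<d. Y (Suc r) \<subseteq> Y r \<and>
        (\<forall>p\<in>Y r. local_equation (Y r) (Y (Suc r)) (U p \<inter> Y r) (y (Suc r) p)))"

text \<open>
  The order along the prime divisor \<open>P\<close> of \<open>Z\<close>, with local equations \<open>y\<close>: a rational function lies
  in the local ring of \<open>Z\<close> along \<open>P\<close> iff it lies in the local ring at some point of \<open>P\<close>.
\<close>

definition ord_along :: "('k::field, 'n::finite) pspace set \<Rightarrow> ('k, 'n) pspace set \<Rightarrow>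
    ('k, 'n) family \<Rightarrow> ('k, 'n) family \<Rightarrow> nat" where
  "ord_along Z P y s = (GREATEST n. \<exists>p\<in>P. in_stalk Z p (\<lambda>q. s p q / y p q ^ n))"

definition divide_out :: "('k::field, 'n::finite) pspace set \<Rightarrow>
    (('k, 'n) pspace \<Rightarrow> ('k, 'n) pspace set) \<Rightarrow> ('k, 'n) family \<Rightarrow> nat \<Rightarrow> ('k, 'n) family \<Rightarrow>
    ('k, 'n) family" where
  "divide_out Z U y n s = (THE t. t \<in> regular_families Z U \<and>
     (\<forall>p\<in>Z. \<forall>q\<in>U p \<inter> Z. t p q * y p q ^ n = s p q))"

text \<open>\<open>residual r f\<close> is the section \<open>f\<^sub>r\<close> on \<open>Y r\<close> in the definition of the valuation.\<close>

primrec residual :: "(('k::field, 'n::finite) pspace \<Rightarrow> ('k, 'n) pspace set) \<Rightarrow>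
    (nat \<Rightarrow> ('k, 'n) pspace set) \<Rightarrow> (nat \<Rightarrow> ('k, 'n) family) \<Rightarrow> ('k, 'n) family \<Rightarrow> nat \<Rightarrow>
    ('k, 'n) family" where
  "residual U Y y f 0 = f"
| "residual U Y y f (Suc r) = restrict_family (Y (Suc r))
     (divide_out (Y r) U (y (Suc r))
        (ord_along (Y r) (Y (Suc r)) (y (Suc r)) (residual U Y y f r)) (residual U Y y f r))"

text \<open>
  The truncated valuation, as a function supported on \<open>{1..r}\<close>.  Orders of vanishing of sections
  are nonnegative, so natural numbers suffice.
\<close>

definition nu :: "(('k::field, 'n::finite) pspace \<Rightarrow> ('k, 'n) pspace set) \<Rightarrow>
    (nat \<Rightarrow> ('k, 'n) pspace set) \<Rightarrow> (nat \<Rightarrow> ('k, 'n) family) \<Rightarrow> nat \<Rightarrow> ('k, 'n) family \<Rightarrow> nat \<Rightarrow> nat" where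
  "nu U Y y r f = (\<lambda>j. if 1 \<le> j \<and> j \<le> r
     then ord_along (Y (j - 1)) (Y j) (y j) (residual U Y y f (j - 1)) else 0)"

definition nu_set :: "(('k::field, 'n::finite) pspace \<Rightarrow> ('k, 'n) pspace set) \<Rightarrow>
    (nat \<Rightarrow> ('k, 'n) pspace set) \<Rightarrow> (nat \<Rightarrow> ('k, 'n) family) \<Rightarrow> nat \<Rightarrow> ('k, 'n) family set \<Rightarrow>
    (nat \<Rightarrow> nat) set" where
  "nu_set U Y y r V = nu U Y y r ` (V - {0})"

definition Gamma_nu :: "(('k::field, 'n::finite) pspace \<Rightarrow> ('k, 'n) pspace set) \<Rightarrow>
    (nat \<Rightarrow> ('k, 'n) pspace set) \<Rightarrow> (nat \<Rightarrow> ('k, 'n) family) \<Rightarrow> nat \<Rightarrow> ('k, 'n) family set \<Rightarrow>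
    (nat \<times> (nat \<Rightarrow> nat)) set" where
  "Gamma_nu U Y y r V = {(m, nu U Y y r f) | m f. f \<in> system_power (Y 0) U V m - {0}}"

inductive_set generated_semigroup :: "'a::monoid_add set \<Rightarrow> 'a set" for S where
  zero: "0 \<in> generated_semigroup S"
| add: "x \<in> S \<Longrightarrow> z \<in> generated_semigroup S \<Longrightarrow> x + z \<in> generated_semigroup S"

text \<open>
  \<open>\<real>\<^sup>d\<close> is realised as the closed subspace of \<open>nat \<Rightarrow> real\<close> of functions supported on \<open>{1..d}\<close>;
  the topology of pointwise convergence induces the Euclidean topology on it.
\<close>

definition coord_space :: "nat \<Rightarrow> (nat \<Rightarrow> real) set" where
  "coord_space d = {x. \<forall>j. j \<notin> {1..d} \<longrightarrow> x j = 0}"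

definition real_point :: "(nat \<Rightarrow> nat) \<Rightarrow> nat \<Rightarrow> real" where
  "real_point a = (\<lambda>j. real (a j))"

definition okounkov_body :: "(('k::field, 'n::finite) pspace \<Rightarrow> ('k, 'n) pspace set) \<Rightarrow>
    (nat \<Rightarrow> ('k, 'n) pspace set) \<Rightarrow> (nat \<Rightarrow> ('k, 'n) family) \<Rightarrow> nat \<Rightarrow> ('k, 'n) family set \<Rightarrow>
    (real \<times> (nat \<Rightarrow> real)) set" where
  "okounkov_body U Y y d V = ({1} \<times> coord_space d) \<inter>
     closure (convex hull ((\<lambda>(m, a). (real m, real_point a)) ` Gamma_nu U Y y d V))"


section \<open>Restricted systems, maximal divisors and the conditions \<open>\<D>\<^sub>r\<close>\<close>

text \<open>\<open>restricted_system U Y y V a r\<close> is \<open>V(a\<^sub>1, \<dots>, a\<^sub>r)\<close>, a linear system on \<open>Y r\<close>.\<close>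

primrec restricted_system :: "(('k::field, 'n::finite) pspace \<Rightarrow> ('k, 'n) pspace set) \<Rightarrow>
    (nat \<Rightarrow> ('k, 'n) pspace set) \<Rightarrow> (nat \<Rightarrow> ('k, 'n) family) \<Rightarrow> ('k, 'n) family set \<Rightarrow>
    (nat \<Rightarrow> nat) \<Rightarrow> nat \<Rightarrow> ('k, 'n) family set" where
  "restricted_system U Y y V a 0 = V"
| "restricted_system U Y y V a (Suc r) = restrict_family (Y (Suc r)) `
     system_minus (Y r) U (restricted_system U Y y V a r) (family_power (y (Suc r)) (a (Suc r)))"

definition saturated :: "('k::field, 'n::finite) pspace set \<Rightarrow> ('k, 'n) pspace set \<Rightarrow>
    ('k, 'n) family \<Rightarrow> ('k, 'n) family set \<Rightarrow> bool" where
  "saturated Z P y V \<longleftrightarrow> (\<exists>lo hi. ord_along Z P y ` (V - {0}) = {lo..hi})"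

text \<open>
  The divisor of the section \<open>s\<close> of \<open>V\<close> on \<open>Z\<close> is maximal in \<open>V\<close> with respect to \<open>P\<close>: it is the sum,
  with multiplicities \<open>m\<close>, of \<open>P\<close> (where \<open>m P = 0\<close> is allowed) and of the distinct prime divisors
  in \<open>\<B>\<close> and \<open>\<E>\<close>.  A prime divisor \<open>Q\<close> has the local equations \<open>\<eta> Q\<close>.  That \<open>m Q\<close> times
  \<open>Q\<close> is contained in the base scheme of \<open>V\<close> means that all sections in \<open>V\<close> lie in its ideal.
\<close>

definition maximal_in :: "('k::field, 'n::finite) pspace set \<Rightarrow> ('k, 'n) pspace set \<Rightarrow>
    ('k, 'n) family set \<Rightarrow> ('k, 'n) family \<Rightarrow> bool" where
  "maximal_in Z P V s \<longleftrightarrow> s \<in> V \<and> (\<exists>\<eta> m \<B> \<E>. finite \<B> \<and> finite \<E> \<and> \<B> \<inter> \<E> = {} \<and> P \<notin> \<B> \<union> \<E> \<and>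
     (\<forall>Q\<in>insert P (\<B> \<union> \<E>). prime_divisor Z Q (\<eta> Q)) \<and>
     (\<forall>Q\<in>\<B> \<union> \<E>. 0 < (m Q :: nat)) \<and>
     (\<forall>p\<in>Z. unit_in_stalk Z p (\<lambda>x. s p x / (\<Prod>Q\<in>insert P (\<B> \<union> \<E>). \<eta> Q p x ^ m Q))) \<and>
     (\<forall>Q\<in>\<B>. \<forall>t\<in>V. \<forall>p\<in>Z. in_stalk Z p (\<lambda>x. t p x / \<eta> Q p x ^ m Q)) \<and>
     (\<exists>F. facet_of_pseff Z F \<and> num_class Z (\<eta> P) \<notin> F \<and> (\<forall>Q\<in>\<E>. num_class Z (\<eta> Q) \<in> F)))"

text \<open>
  Conditions (i)--(iii) for the step from \<open>Y r\<close> to \<open>Y (Suc r)\<close>.  In (ii), a divisor in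
  \<open>V(a) \<cdot> W(b)\<close> is the sum of a divisor in \<open>V(a)\<close> and a divisor in \<open>W(b)\<close>, that is the divisor
  of a product of two sections and not of a linear combination of such products.  With linear
  combinations, additivity of the values fails: on the product of two projective lines, let \<open>V\<close>
  and \<open>W\<close> be the complete systems of bidegrees \<open>(1,0)\<close> and \<open>(0,1)\<close>, and let the divisor be the
  diagonal, which lies in the span of the products but has order one along itself.
\<close>

definition D_step :: "nat \<Rightarrow> (('k::field, 'n::finite) pspace \<Rightarrow> ('k, 'n) pspace set) \<Rightarrow>
    (nat \<Rightarrow> ('k, 'n) pspace set) \<Rightarrow> (nat \<Rightarrow> ('k, 'n) family) \<Rightarrow> ('k, 'n) family set \<Rightarrow>
    ('k, 'n) family set \<Rightarrow> nat \<Rightarrow> bool" where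
  "D_step d U Y y V W r \<longleftrightarrow>
     (let Z = Y r; P = Y (Suc r);
          res = (\<lambda>S a. restricted_system U Y y S a r);
          good = (\<lambda>S. \<forall>a\<in>nu_set U Y y r S.
            (\<exists>s. maximal_in Z P (res S a) s) \<and> (\<exists>s\<in>res S a. \<forall>p\<in>Y d. s p p \<noteq> 0))
      in good V \<and> good W \<and>
         (\<forall>c. (\<exists>a\<in>nu_set U Y y r V. \<exists>b\<in>nu_set U Y y r W. c = a + b) \<longrightarrow>
            (\<exists>a\<in>nu_set U Y y r V. \<exists>b\<in>nu_set U Y y r W. a + b = c \<and>
               (\<exists>s\<in>res V a. \<exists>t\<in>res W b.
                  maximal_in Z P (res (system_mult V W) c) (family_mult s t)))) \<and>
         (\<forall>a\<in>nu_set U Y y r V. saturated Z P (y (Suc r)) (res V a)) \<and>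
         (\<forall>b\<in>nu_set U Y y r W. saturated Z P (y (Suc r)) (res W b)))"

primrec D_condition :: "nat \<Rightarrow> (('k::field, 'n::finite) pspace \<Rightarrow> ('k, 'n) pspace set) \<Rightarrow>
    (nat \<Rightarrow> ('k, 'n) pspace set) \<Rightarrow> (nat \<Rightarrow> ('k, 'n) family) \<Rightarrow> ('k, 'n) family set \<Rightarrow>
    ('k, 'n) family set \<Rightarrow> nat \<Rightarrow> bool" where
  "D_condition d U Y y V W 0 = True"
| "D_condition d U Y y V W (Suc r) = (D_step d U Y y V W r \<and> D_condition d U Y y V W r)"

end

theory Submission
  imports Defs
begin

text \<open>
  Write \<open>V(a)\<close> for the restricted systems. The nonzero elements of \<open>V(a)\<close>, for a value \<open>a\<close> of
  length \<open>r\<close>, are exactly the residual sections of the sections of \<open>V\<close> with the value \<open>a\<close>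
  (\<open>residual_in_restricted_system\<close>, \<open>restricted_system_lift_exact\<close>). So the values of length \<open>r + 1\<close>
  that extend \<open>a\<close> correspond to the orders along \<open>Y (r + 1)\<close> of the nonzero elements of \<open>V(a)\<close>.

  The main point is that \<open>\<D>\<^sub>r(V, W)\<close> implies that the values of \<open>V \<cdot> W\<close> are the sums of values
  of \<open>V\<close> and of \<open>W\<close> (\<open>nu_set_system_mult\<close>). Sums are values since values are additive (\<open>nu_mult\<close>),
  the divisors of the flag being irreducible. For the converse, induct on \<open>r\<close>. The orders in
  \<open>(V \<cdot> W)(c)\<close> are bounded by the order of a maximal divisor (\<open>maximal_bound\<close>), since the
  linear functional of the facet that comes with it is positive on \<open>Y (r + 1)\<close> and zero on the
  components of the maximal divisor that are neither \<open>Y (r + 1)\<close> nor fixed. By condition (ii) there is a maximal divisor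
  that is the sum of a divisor in \<open>V(a)\<close> of order \<open>i\<close> and one in \<open>W(b)\<close> of order \<open>j\<close>, with
  \<open>a + b = c\<close>. By saturation and the sections that do not vanish at \<open>Y d\<close>, all orders up to
  \<open>i\<close> and all orders up to \<open>j\<close> occur in \<open>V(a)\<close> and \<open>W(b)\<close>. Hence all orders in \<open>(V \<cdot> W)(c)\<close>
  are sums of orders in \<open>V(a)\<close> and in \<open>W(b)\<close>.

  Applied to \<open>W = V\<^sup>m\<close>, this yields by induction on \<open>m\<close> that the semigroup is generated in degree
  one.  There are finitely many values in degree one, again because orders are bounded. The slice
  at height one of the cone over a finite set is its convex hull, and it is closed
  (\<open>slice_of_lattice_cone\<close>).

  The bound on orders also ensures that nonzero elements of the restricted systems vanish only to
  finite order along the next divisor of the flag.  In its proof, the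
  linear functional \<open>\<Phi>\<close> of the facet is evaluated on divisors.  Linearly equivalent divisors are
  numerically equivalent directly by the definition of intersection numbers
  (\<open>linear_equiv_imp_num_equiv\<close>), and \<open>\<Phi>\<close> does not see units because a unit and its inverse are
  both effective.
\<close>

section \<open>Forms and the Zariski topology\<close>

lemma finite_exponents: "finite {\<alpha> :: 'n::finite \<Rightarrow> nat. (\<Sum>i\<in>UNIV. \<alpha> i) = m}"
proof -
  have "{\<alpha> :: 'n \<Rightarrow> nat. (\<Sum>i\<in>UNIV. \<alpha> i) = m} \<subseteq> PiE UNIV (\<lambda>_. {..m})"
    by (auto simp: member_le_sum)
  then show ?thesis
    by (rule finite_subset) (simp add: finite_PiE)
qed

lemma formsI:
  "F = (\<lambda>x. \<Sum>\<alpha> | (\<Sum>i\<in>UNIV. \<alpha> i) = m. c \<alpha> * (\<Prod>i\<in>UNIV. x i ^ \<alpha> i)) \<Longrightarrow> F \<in> forms m"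
  unfolding forms_def by (rule CollectI, rule exI[of _ c]) simp

lemma forms_add:
  assumes "F \<in> forms m" "G \<in> forms m"
  shows "(\<lambda>x. F x + G x) \<in> forms m"
proof -
  obtain a b where F: "F = (\<lambda>x. \<Sum>\<alpha> | (\<Sum>i\<in>UNIV. \<alpha> i) = m. a \<alpha> * (\<Prod>i\<in>UNIV. x i ^ \<alpha> i))"
    and G: "G = (\<lambda>x. \<Sum>\<alpha> | (\<Sum>i\<in>UNIV. \<alpha> i) = m. b \<alpha> * (\<Prod>i\<in>UNIV. x i ^ \<alpha> i))"
    using assms unfolding forms_def by blast
  have "(\<lambda>x. F x + G x) =
      (\<lambda>x. \<Sum>\<alpha> | (\<Sum>i\<in>UNIV. \<alpha> i) = m. (a \<alpha> + b \<alpha>) * (\<Prod>i\<in>UNIV. x i ^ \<alpha> i))"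
    unfolding F G by (simp add: sum.distrib distrib_right)
  then show ?thesis by (rule formsI)
qed

lemma forms_mult:
  fixes F G :: "('n::finite \<Rightarrow> 'k::field) \<Rightarrow> 'k"
  assumes "F \<in> forms m" "G \<in> forms n"
  shows "(\<lambda>x. F x * G x) \<in> forms (m + n)"
proof -
  define A where "A = (\<lambda>m. {\<alpha> :: 'n \<Rightarrow> nat. (\<Sum>i\<in>UNIV. \<alpha> i) = m})"
  define M where "M = (\<lambda>(\<alpha> :: 'n \<Rightarrow> nat) (x :: 'n \<Rightarrow> 'k). \<Prod>i\<in>UNIV. x i ^ \<alpha> i)"
  obtain a b where F: "F = (\<lambda>x. \<Sum>\<alpha>\<in>A m. a \<alpha> * M \<alpha> x)"
    and G: "G = (\<lambda>x. \<Sum>\<beta>\<in>A n. b \<beta> * M \<beta> x)"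
    using assms unfolding forms_def A_def M_def by blast
  define s where "s = (\<lambda>(\<alpha> :: 'n \<Rightarrow> nat, \<beta>) i. \<alpha> i + \<beta> i)"
  define c where "c = (\<lambda>\<gamma>. \<Sum>z\<in>{z \<in> A m \<times> A n. s z = \<gamma>}. a (fst z) * b (snd z))"
  have fin: "finite (A k)" for k
    unfolding A_def by (rule finite_exponents)
  have M: "M (s z) x = M (fst z) x * M (snd z) x" for z x
    by (cases z) (simp add: M_def s_def power_add prod.distrib)
  have "F x * G x = (\<Sum>\<gamma>\<in>A (m + n). c \<gamma> * M \<gamma> x)" for x
  proof -
    have "F x * G x = (\<Sum>z\<in>A m \<times> A n. (a (fst z) * b (snd z)) * M (s z) x)"
      unfolding F G sum_product sum.cartesian_product
      by (rule sum.cong) (auto simp: M)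
    also have "\<dots> = (\<Sum>\<gamma>\<in>A (m + n). \<Sum>z\<in>{z \<in> A m \<times> A n. s z = \<gamma>}. (a (fst z) * b (snd z)) * M (s z) x)"
      by (rule sum.group[symmetric])
        (auto simp: fin, auto simp: A_def s_def sum.distrib)
    also have "\<dots> = (\<Sum>\<gamma>\<in>A (m + n). c \<gamma> * M \<gamma> x)"
      unfolding c_def sum_distrib_right by (intro sum.cong) auto
    finally show ?thesis .
  qed
  then show ?thesis
    by (intro formsI[where c = c]) (auto simp: A_def M_def)
qed

lemma const_forms: "(\<lambda>x. c) \<in> (forms 0 :: (('n::finite \<Rightarrow> 'k::field) \<Rightarrow> 'k) set)"
proof -
  have "{\<alpha> :: 'n \<Rightarrow> nat. (\<Sum>i\<in>UNIV. \<alpha> i) = 0} = {\<lambda>_. 0}"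
    by auto
  then have "(\<lambda>x. c) = (\<lambda>x :: 'n \<Rightarrow> 'k. \<Sum>\<alpha> | (\<Sum>i\<in>UNIV. \<alpha> i) = 0. c * (\<Prod>i\<in>UNIV. x i ^ \<alpha> i))"
    by simp
  then show ?thesis by (rule formsI)
qed

text \<open>Forms are closed under products, so the sets where a form does not vanish are a basis.\<close>

definition basic_nbhd :: "('k::field, 'n::finite) pspace \<Rightarrow> ('k, 'n) pspace set \<Rightarrow> bool" where
  "basic_nbhd p T \<longleftrightarrow> (\<exists>m. \<exists>H\<in>forms m. H (rep_pspace p) \<noteq> 0 \<and> (\<forall>q. H (rep_pspace q) \<noteq> 0 \<longrightarrow> q \<in> T))"

lemma basic_nbhdI:
  "H \<in> forms m \<Longrightarrow> H (rep_pspace p) \<noteq> 0 \<Longrightarrow> (\<And>q. H (rep_pspace q) \<noteq> 0 \<Longrightarrow> q \<in> T) \<Longrightarrow> basic_nbhd p T"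
  unfolding basic_nbhd_def by (intro exI[of _ m] bexI[of _ H]) auto

lemma basic_nbhdE:
  assumes "basic_nbhd p T"
  obtains H m where "H \<in> forms m" "H (rep_pspace p) \<noteq> 0" "\<And>q. H (rep_pspace q) \<noteq> 0 \<Longrightarrow> q \<in> T"
  using assms unfolding basic_nbhd_def by blast

lemma basic_nbhd_mono: "basic_nbhd p S \<Longrightarrow> S \<subseteq> T \<Longrightarrow> basic_nbhd p T"
  by (erule basic_nbhdE) (auto intro: basic_nbhdI)

lemma basic_nbhd_Int:
  assumes "basic_nbhd p S" "basic_nbhd p T"
  shows "basic_nbhd p (S \<inter> T)"
proof -
  obtain H m where H: "H \<in> forms m" "H (rep_pspace p) \<noteq> 0" "\<And>q. H (rep_pspace q) \<noteq> 0 \<Longrightarrow> q \<in> S"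
    using assms(1) by (rule basic_nbhdE) blast
  obtain K n where K: "K \<in> forms n" "K (rep_pspace p) \<noteq> 0" "\<And>q. K (rep_pspace q) \<noteq> 0 \<Longrightarrow> q \<in> T"
    using assms(2) by (rule basic_nbhdE) blast
  show ?thesis
    by (rule basic_nbhdI[OF forms_mult[OF H(1) K(1)]]) (use H K in auto)
qed

lemma openin_nonvanishing: "H \<in> forms m \<Longrightarrow> openin zariski {q. H (rep_pspace q) \<noteq> 0}"
  unfolding zariski_def by (rule topology_generated_by_Basis) auto

lemma openin_zariski_iff: "openin zariski T \<longleftrightarrow> (\<forall>p\<in>T. basic_nbhd p T)"
proof
  assume "openin zariski T"
  then have "generate_topology_on {{p. F (rep_pspace p) \<noteq> 0} | F m. F \<in> forms m} T"
    unfolding zariski_def openin_topology_generated_by_iff .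
  then show "\<forall>p\<in>T. basic_nbhd p T"
  proof induction
    case (Int a b)
    then show ?case by (auto intro: basic_nbhd_Int)
  next
    case (UN K)
    then show ?case by (meson Sup_upper UnionE basic_nbhd_mono)
  next
    case (Basis s)
    then show ?case by (auto intro: basic_nbhdI)
  qed simp
next
  assume *: "\<forall>p\<in>T. basic_nbhd p T"
  show "openin zariski T"
  proof (subst openin_subopen, intro ballI)
    fix p assume "p \<in> T"
    then obtain m H where H: "H \<in> forms m" "H (rep_pspace p) \<noteq> 0" "\<And>q. H (rep_pspace q) \<noteq> 0 \<Longrightarrow> q \<in> T"
      using * by (meson basic_nbhdE)
    then show "\<exists>S. openin zariski S \<and> p \<in> S \<and> S \<subseteq> T"
      by (intro exI[of _ "{q. H (rep_pspace q) \<noteq> 0}"]) (auto intro: openin_nonvanishing)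
  qed
qed

lemma topspace_zariski: "topspace zariski = UNIV"
proof -
  have "openin zariski UNIV"
    unfolding openin_zariski_iff by (auto intro: basic_nbhdI[OF const_forms[of 1]])
  then show ?thesis
    using openin_subset by blast
qed

lemma zopen_iff: "zopen Z W \<longleftrightarrow> W \<subseteq> Z \<and> (\<forall>p\<in>W. basic_nbhd p (W \<union> - Z))"
proof
  assume "zopen Z W"
  then obtain T where T: "openin zariski T" "W = T \<inter> Z"
    unfolding zopen_def openin_subtopology by blast
  then show "W \<subseteq> Z \<and> (\<forall>p\<in>W. basic_nbhd p (W \<union> - Z))"
    unfolding openin_zariski_iff by (auto elim!: basic_nbhd_mono)
next
  assume R: "W \<subseteq> Z \<and> (\<forall>p\<in>W. basic_nbhd p (W \<union> - Z))"
  define T where "T = \<Union>{T. openin zariski T \<and> T \<inter> Z \<subseteq> W}"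
  have "openin zariski T"
    unfolding T_def by (rule openin_Union) blast
  moreover have "W \<subseteq> T \<inter> Z"
  proof
    fix p assume p: "p \<in> W"
    then obtain H m where H: "H \<in> forms m" "H (rep_pspace p) \<noteq> 0"
        "\<And>q. H (rep_pspace q) \<noteq> 0 \<Longrightarrow> q \<in> W \<union> - Z"
      using R by (meson basic_nbhdE)
    have "{q. H (rep_pspace q) \<noteq> 0} \<inter> Z \<subseteq> W"
      using H(3) by blast
    with openin_nonvanishing[OF H(1)] H(2) show "p \<in> T \<inter> Z"
      unfolding T_def using R p by blast
  qed
  ultimately show "zopen Z W"
    unfolding zopen_def openin_subtopology T_def by blast
qed

lemma zopenE:
  assumes "zopen Z W" "p \<in> W"
  obtains H m where "H \<in> forms m" "H (rep_pspace p) \<noteq> 0"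
    "\<forall>q\<in>Z. H (rep_pspace q) \<noteq> 0 \<longrightarrow> q \<in> W"
proof -
  have "basic_nbhd p (W \<union> - Z)"
    using assms unfolding zopen_iff by blast
  then show ?thesis
    by (rule basic_nbhdE) (use that in blast)
qed

lemma zopen_subset: "zopen Z W \<Longrightarrow> W \<subseteq> Z"
  unfolding zopen_iff by blast

lemma zopen_Int: "zopen Z A \<Longrightarrow> zopen Z B \<Longrightarrow> zopen Z (A \<inter> B)"
  unfolding zopen_def by (rule openin_Int)

lemma zopen_self: "zopen Z Z"
  unfolding zopen_def openin_subtopology by (intro exI[of _ UNIV]) (use topspace_zariski openin_topspace in \<open>metis Int_UNIV_left\<close>)

lemma zopen_restrict: "zopen Z W \<Longrightarrow> P \<subseteq> Z \<Longrightarrow> zopen P (W \<inter> P)"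
  unfolding zopen_iff by (auto elim!: basic_nbhd_mono)

lemma zopen_diff_closed: "closedin zariski P \<Longrightarrow> zopen Z (Z - P)"
  unfolding zopen_def openin_subtopology closedin_def
  by (metis Diff_Diff_Int Diff_Int_distrib2 Int_commute Int_UNIV_right topspace_zariski Diff_Int2)

lemma zopen_Int_nonempty:
  assumes "projective_variety Z" "zopen Z A" "zopen Z B" "A \<noteq> {}" "B \<noteq> {}"
  shows "A \<inter> B \<noteq> {}"
proof
  assume e: "A \<inter> B = {}"
  obtain S T where S: "openin zariski S" "A = S \<inter> Z" "openin zariski T" "B = T \<inter> Z"
    using assms unfolding zopen_def openin_subtopology by metis
  have "closedin zariski (- S)" "closedin zariski (- T)" "Z \<subseteq> - S \<union> - T"
    using S e by (auto simp: closedin_def topspace_zariski)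
  then have "Z \<subseteq> - S \<or> Z \<subseteq> - T"
    using assms(1) unfolding projective_variety_def by blast
  then show False using S assms(4,5) by blast
qed


section \<open>Germs of regular functions\<close>

text \<open>
  Two functions have the same germ at \<open>p\<close> iff they are equal eventually along \<open>nb Z p\<close>, and they
  are the same rational function on \<open>Z\<close> iff they are equal eventually along \<open>gen Z\<close>.  With
  these filters, identities between germs need no bookkeeping of neighbourhoods.
\<close>

definition nb :: "('k::field, 'n::finite) pspace set \<Rightarrow> ('k, 'n) pspace \<Rightarrow> ('k, 'n) pspace filter" where
  "nb Z p = (INF W\<in>{W. zopen Z W \<and> p \<in> W}. principal W)"

definition gen :: "('k::field, 'n::finite) pspace set \<Rightarrow> ('k, 'n) pspace filter" where
  "gen Z = (INF W\<in>{W. zopen Z W \<and> W \<noteq> {}}. principal W)"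

definition reg_at :: "('k::field, 'n::finite) pspace set \<Rightarrow> ('k, 'n) pspace \<Rightarrow>
    (('k, 'n) pspace \<Rightarrow> 'k) \<Rightarrow> bool" where
  "reg_at Z p f \<longleftrightarrow> (\<exists>W. zopen Z W \<and> p \<in> W \<and> regular W f)"

lemma eventually_nb:
  assumes "p \<in> Z"
  shows "eventually P (nb Z p) \<longleftrightarrow> (\<exists>W. zopen Z W \<and> p \<in> W \<and> (\<forall>x\<in>W. P x))"
  unfolding nb_def
proof (subst eventually_INF_base)
  show "{W. zopen Z W \<and> p \<in> W} \<noteq> {}"
    using assms zopen_self by blast
  fix A B assume "A \<in> {W. zopen Z W \<and> p \<in> W}" "B \<in> {W. zopen Z W \<and> p \<in> W}"
  then show "\<exists>C\<in>{W. zopen Z W \<and> p \<in> W}. principal C \<le> inf (principal A) (principal B)"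
    by (intro bexI[of _ "A \<inter> B"]) (auto simp: zopen_Int)
qed (auto simp: eventually_principal)

lemma eventually_nb_point: "eventually P (nb Z p) \<Longrightarrow> p \<in> Z \<Longrightarrow> P p"
  by (auto simp: eventually_nb)

lemma eventually_nb_open: "zopen Z W \<Longrightarrow> p \<in> W \<Longrightarrow> \<forall>\<^sub>F x in nb Z p. x \<in> W"
  using zopen_subset by (subst eventually_nb) blast+

lemma eventually_nb_nb:
  assumes "eventually P (nb Z p)" "p \<in> Z"
  shows "\<forall>\<^sub>F x in nb Z p. x \<in> Z \<and> eventually P (nb Z x)"
proof -
  obtain W where W: "zopen Z W" "p \<in> W" "\<forall>x\<in>W. P x"
    using assms by (auto simp: eventually_nb)
  then have "x \<in> Z \<and> eventually P (nb Z x)" if "x \<in> W" for x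
    using that zopen_subset[OF W(1)] W by (subst eventually_nb) auto
  with W show ?thesis
    using assms(2) by (subst eventually_nb) auto
qed

lemma regularE:
  assumes "regular W f" "p \<in> W"
  obtains F m G where "F \<in> forms m" "G \<in> forms m" "G (rep_pspace p) \<noteq> 0"
    "\<forall>q\<in>W. G (rep_pspace q) \<noteq> 0 \<longrightarrow> f q = F (rep_pspace q) / G (rep_pspace q)"
proof -
  have "\<exists>m. \<exists>F\<in>forms m. \<exists>G\<in>forms m. G (rep_pspace p) \<noteq> 0 \<and>
     (\<forall>q\<in>W. G (rep_pspace q) \<noteq> 0 \<longrightarrow> f q = F (rep_pspace q) / G (rep_pspace q))"
    by (rule bspec[OF assms(1)[unfolded regular_def] assms(2)])
  then show ?thesis
    by (elim exE bexE conjE) (rule that)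
qed

lemma regularI:
  assumes "\<And>p. p \<in> W \<Longrightarrow> \<exists>m F G. F \<in> forms m \<and> G \<in> forms m \<and> G (rep_pspace p) \<noteq> 0 \<and>
    (\<forall>q\<in>W. G (rep_pspace q) \<noteq> 0 \<longrightarrow> f q = F (rep_pspace q) / G (rep_pspace q))"
  shows "regular W f"
  unfolding regular_def
proof
  fix p assume "p \<in> W"
  from assms[OF this]
  show "\<exists>m. \<exists>F\<in>forms m. \<exists>G\<in>forms m. G (rep_pspace p) \<noteq> 0 \<and>
     (\<forall>q\<in>W. G (rep_pspace q) \<noteq> 0 \<longrightarrow> f q = F (rep_pspace q) / G (rep_pspace q))"
    by (elim exE conjE) (rule exI, rule bexI, rule bexI, rule conjI, assumption+)
qed

lemma regular_subset_cong:
  assumes "regular W f" "W' \<subseteq> W" "\<And>x. x \<in> W' \<Longrightarrow> f x = g x"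
  shows "regular W' g"
proof (rule regularI)
  fix p assume "p \<in> W'"
  then have p: "p \<in> W" using assms(2) by blast
  obtain F m G where F: "F \<in> forms m" "G \<in> forms m" "G (rep_pspace p) \<noteq> 0"
     "\<forall>q\<in>W. G (rep_pspace q) \<noteq> 0 \<longrightarrow> f q = F (rep_pspace q) / G (rep_pspace q)"
    using regularE[OF assms(1) p] .
  show "\<exists>m F G. F \<in> forms m \<and> G \<in> forms m \<and> G (rep_pspace p) \<noteq> 0 \<and>
    (\<forall>q\<in>W'. G (rep_pspace q) \<noteq> 0 \<longrightarrow> g q = F (rep_pspace q) / G (rep_pspace q))"
    by (rule exI[of _ m], rule exI[of _ F], rule exI[of _ G])
      (use F assms(2,3) in \<open>auto simp flip: assms(3)\<close>)
qed

lemma regular_subset: "regular W f \<Longrightarrow> W' \<subseteq> W \<Longrightarrow> regular W' f"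
  by (rule regular_subset_cong) auto

lemma regular_cong: "regular W f \<Longrightarrow> (\<And>x. x \<in> W \<Longrightarrow> f x = g x) \<Longrightarrow> regular W g"
  by (rule regular_subset_cong[OF _ order_refl])

lemma regular_const: "regular W (\<lambda>_. c)"
proof (rule regularI)
  fix p
  show "\<exists>m F G. F \<in> forms m \<and> G \<in> forms m \<and> G (rep_pspace p) \<noteq> 0 \<and>
    (\<forall>q\<in>W. G (rep_pspace q) \<noteq> 0 \<longrightarrow> c = F (rep_pspace q) / G (rep_pspace q))"
    by (rule exI[of _ 0], rule exI[of _ "\<lambda>_. c"], rule exI[of _ "\<lambda>_. 1"]) (simp add: const_forms)
qed

lemma regular_add:
  assumes "regular W f" "regular W g"
  shows "regular W (\<lambda>x. f x + g x)"
proof (rule regularI)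
  fix p assume p: "p \<in> W"
  obtain F m G where F: "F \<in> forms m" "G \<in> forms m" "G (rep_pspace p) \<noteq> 0"
     "\<forall>q\<in>W. G (rep_pspace q) \<noteq> 0 \<longrightarrow> f q = F (rep_pspace q) / G (rep_pspace q)"
    using regularE[OF assms(1) p] .
  obtain F' n G' where F': "F' \<in> forms n" "G' \<in> forms n" "G' (rep_pspace p) \<noteq> 0"
     "\<forall>q\<in>W. G' (rep_pspace q) \<noteq> 0 \<longrightarrow> g q = F' (rep_pspace q) / G' (rep_pspace q)"
    using regularE[OF assms(2) p] .
  have N: "(\<lambda>x. F x * G' x + G x * F' x) \<in> forms (m + n)"
    by (intro forms_add forms_mult F F')
  show "\<exists>m Fa G. Fa \<in> forms m \<and> G \<in> forms m \<and> G (rep_pspace p) \<noteq> 0 \<and>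
     (\<forall>q\<in>W. G (rep_pspace q) \<noteq> 0 \<longrightarrow> f q + g q = Fa (rep_pspace q) / G (rep_pspace q))"
    by (rule exI[of _ "m + n"], rule exI[of _ "\<lambda>x. F x * G' x + G x * F' x"],
        rule exI[of _ "\<lambda>x. G x * G' x"])
      (use F F' N forms_mult[OF F(2) F'(2)] in \<open>auto simp: add_frac_eq mult.commute\<close>)
qed

lemma regular_mult:
  assumes "regular W f" "regular W g"
  shows "regular W (\<lambda>x. f x * g x)"
proof (rule regularI)
  fix p assume p: "p \<in> W"
  obtain F m G where F: "F \<in> forms m" "G \<in> forms m" "G (rep_pspace p) \<noteq> 0"
     "\<forall>q\<in>W. G (rep_pspace q) \<noteq> 0 \<longrightarrow> f q = F (rep_pspace q) / G (rep_pspace q)"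
    using regularE[OF assms(1) p] .
  obtain F' n G' where F': "F' \<in> forms n" "G' \<in> forms n" "G' (rep_pspace p) \<noteq> 0"
     "\<forall>q\<in>W. G' (rep_pspace q) \<noteq> 0 \<longrightarrow> g q = F' (rep_pspace q) / G' (rep_pspace q)"
    using regularE[OF assms(2) p] .
  show "\<exists>m Fa G. Fa \<in> forms m \<and> G \<in> forms m \<and> G (rep_pspace p) \<noteq> 0 \<and>
     (\<forall>q\<in>W. G (rep_pspace q) \<noteq> 0 \<longrightarrow> f q * g q = Fa (rep_pspace q) / G (rep_pspace q))"
    by (rule exI[of _ "m + n"], rule exI[of _ "\<lambda>x. F x * F' x"], rule exI[of _ "\<lambda>x. G x * G' x"])
      (use F F' forms_mult[OF F(1) F'(1)] forms_mult[OF F(2) F'(2)] in auto)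
qed

lemma regular_inverse:
  assumes "regular W f" "\<And>x. x \<in> W \<Longrightarrow> f x \<noteq> 0"
  shows "regular W (\<lambda>x. inverse (f x))"
proof (rule regularI)
  fix p assume p: "p \<in> W"
  obtain F m G where F: "F \<in> forms m" "G \<in> forms m" "G (rep_pspace p) \<noteq> 0"
     "\<forall>q\<in>W. G (rep_pspace q) \<noteq> 0 \<longrightarrow> f q = F (rep_pspace q) / G (rep_pspace q)"
    using regularE[OF assms(1) p] .
  have "F (rep_pspace p) \<noteq> 0"
    using F(3,4) p assms(2)[OF p] by force
  \<comment> \<open>Both are multiplied by \<open>G\<close>, so that \<open>F G \<noteq> 0\<close> ensures that \<open>f = F / G\<close>.\<close>
  then show "\<exists>m Fa G. Fa \<in> forms m \<and> G \<in> forms m \<and> G (rep_pspace p) \<noteq> 0 \<and>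
     (\<forall>q\<in>W. G (rep_pspace q) \<noteq> 0 \<longrightarrow> inverse (f q) = Fa (rep_pspace q) / G (rep_pspace q))"
    by (intro exI[of _ "m + m"] exI[of _ "\<lambda>x. G x * G x"] exI[of _ "\<lambda>x. F x * G x"])
      (use F forms_mult[OF F(2,2)] forms_mult[OF F(1,2)] in \<open>auto simp: inverse_eq_divide\<close>)
qed

lemma zopen_nonzero:
  assumes "zopen Z W" "regular W f"
  shows "zopen Z {x \<in> W. f x \<noteq> 0}"
  unfolding zopen_iff
proof (intro conjI ballI)
  show "{x \<in> W. f x \<noteq> 0} \<subseteq> Z" using zopen_subset[OF assms(1)] by blast
  fix p assume p: "p \<in> {x \<in> W. f x \<noteq> 0}"
  then have "p \<in> W" by simp
  obtain F m G where F: "F \<in> forms m" "G \<in> forms m" "G (rep_pspace p) \<noteq> 0"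
     "\<forall>q\<in>W. G (rep_pspace q) \<noteq> 0 \<longrightarrow> f q = F (rep_pspace q) / G (rep_pspace q)"
    using regularE[OF assms(2) \<open>p \<in> W\<close>] .
  obtain H n where H: "H \<in> forms n" "H (rep_pspace p) \<noteq> 0"
    "\<forall>q\<in>Z. H (rep_pspace q) \<noteq> 0 \<longrightarrow> q \<in> W"
    using zopenE[OF assms(1) \<open>p \<in> W\<close>] .
  have "F (rep_pspace p) \<noteq> 0"
    using F(3,4) p by force
  then show "basic_nbhd p ({x \<in> W. f x \<noteq> 0} \<union> - Z)"
    by (intro basic_nbhdI[OF forms_mult[OF forms_mult[OF F(1,2)] H(1)]]) (use F H in auto)
qed

text \<open>Multiplying numerator and denominator by a form that vanishes outside a small
  neighbourhood extends the range of validity of a local quotient.\<close>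

lemma regular_local:
  assumes "zopen Z W" "\<And>p. p \<in> W \<Longrightarrow> reg_at Z p f"
  shows "regular W f"
proof (rule regularI)
  fix p assume p: "p \<in> W"
  obtain W' where W': "zopen Z W'" "p \<in> W'" "regular W' f"
    using assms(2)[OF p] unfolding reg_at_def by blast
  obtain F m G where F: "F \<in> forms m" "G \<in> forms m" "G (rep_pspace p) \<noteq> 0"
     "\<forall>q\<in>W'. G (rep_pspace q) \<noteq> 0 \<longrightarrow> f q = F (rep_pspace q) / G (rep_pspace q)"
    using regularE[OF W'(3,2)] .
  obtain H n where H: "H \<in> forms n" "H (rep_pspace p) \<noteq> 0"
    "\<forall>q\<in>Z. H (rep_pspace q) \<noteq> 0 \<longrightarrow> q \<in> W'"
    using zopenE[OF W'(1,2)] .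
  show "\<exists>m F G. F \<in> forms m \<and> G \<in> forms m \<and> G (rep_pspace p) \<noteq> 0 \<and>
     (\<forall>q\<in>W. G (rep_pspace q) \<noteq> 0 \<longrightarrow> f q = F (rep_pspace q) / G (rep_pspace q))"
    by (rule exI[of _ "m + n"], rule exI[of _ "\<lambda>x. F x * H x"], rule exI[of _ "\<lambda>x. G x * H x"])
      (use F H zopen_subset[OF assms(1)] forms_mult[OF F(1) H(1)] forms_mult[OF F(2) H(1)] in auto)
qed

lemma reg_at_regular: "zopen Z W \<Longrightarrow> regular W f \<Longrightarrow> p \<in> W \<Longrightarrow> reg_at Z p f"
  unfolding reg_at_def by blast

lemma reg_at_in: "reg_at Z p f \<Longrightarrow> p \<in> Z"
  unfolding reg_at_def using zopen_subset by blast

lemma reg_at_const: "p \<in> Z \<Longrightarrow> reg_at Z p (\<lambda>_. c)"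
  unfolding reg_at_def using regular_const zopen_self by blast

lemma reg_at2:
  assumes "reg_at Z p f" "reg_at Z p g"
  obtains W where "zopen Z W" "p \<in> W" "regular W f" "regular W g"
  using assms unfolding reg_at_def by (metis IntI Int_lower1 Int_lower2 regular_subset zopen_Int)

lemma reg_at_mult: "reg_at Z p f \<Longrightarrow> reg_at Z p g \<Longrightarrow> reg_at Z p (\<lambda>x. f x * g x)"
  by (erule (1) reg_at2) (auto simp: reg_at_def intro: regular_mult)

lemma reg_at_power: "reg_at Z p f \<Longrightarrow> reg_at Z p (\<lambda>x. f x ^ n)"
  by (induction n) (auto intro: reg_at_const reg_at_mult reg_at_in)

lemma reg_at_prod:
  "finite A \<Longrightarrow> p \<in> Z \<Longrightarrow> (\<And>i. i \<in> A \<Longrightarrow> reg_at Z p (f i)) \<Longrightarrow> reg_at Z p (\<lambda>x. \<Prod>i\<in>A. f i x)"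
  by (induction A rule: finite_induct) (auto intro: reg_at_const reg_at_mult)

lemma reg_at_nonzero:
  assumes "reg_at Z p f" "f p \<noteq> 0"
  shows "\<forall>\<^sub>F x in nb Z p. f x \<noteq> 0"
proof -
  obtain W where W: "zopen Z W" "p \<in> W" "regular W f"
    using assms(1) unfolding reg_at_def by blast
  show ?thesis
    by (rule eventually_mono[OF eventually_nb_open[OF zopen_nonzero[OF W(1,3)]]])
      (use W assms in auto)
qed

lemma reg_at_cong:
  assumes "reg_at Z p f" "\<forall>\<^sub>F x in nb Z p. f x = g x"
  shows "reg_at Z p g"
proof -
  obtain W where W: "zopen Z W" "p \<in> W" "regular W f"
    using assms(1) unfolding reg_at_def by blast
  obtain W' where W': "zopen Z W'" "p \<in> W'" "\<forall>x\<in>W'. f x = g x"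
    using assms(2) reg_at_in[OF assms(1)] by (auto simp: eventually_nb)
  have "regular (W \<inter> W') g"
    by (rule regular_cong[OF regular_subset[OF W(3)]]) (use W' in auto)
  then show ?thesis
    unfolding reg_at_def using W W' zopen_Int by blast
qed

lemma reg_at_inverse:
  assumes "reg_at Z p f" "f p \<noteq> 0"
  shows "reg_at Z p (\<lambda>x. inverse (f x))"
proof -
  obtain W where W: "zopen Z W" "p \<in> W" "regular W f"
    using assms(1) unfolding reg_at_def by blast
  have "regular {x \<in> W. f x \<noteq> 0} (\<lambda>x. inverse (f x))"
    by (rule regular_inverse[OF regular_subset[OF W(3)]]) auto
  then show ?thesis
    unfolding reg_at_def using zopen_nonzero[OF W(1,3)] W assms(2) by blast
qed

lemma reg_at_subvariety: "reg_at Z p f \<Longrightarrow> P \<subseteq> Z \<Longrightarrow> p \<in> P \<Longrightarrow> reg_at P p f"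
  unfolding reg_at_def by (metis IntI Int_lower1 regular_subset zopen_restrict)

lemma eventually_nb_subvariety:
  assumes "\<forall>\<^sub>F x in nb Z p. x \<in> P \<longrightarrow> Q x" "P \<subseteq> Z" "p \<in> P"
  shows "eventually Q (nb P p)"
proof -
  have "p \<in> Z" using assms by blast
  then obtain W where W: "zopen Z W" "p \<in> W" "\<forall>x\<in>W. x \<in> P \<longrightarrow> Q x"
    using assms by (auto simp: eventually_nb)
  show ?thesis
    by (rule eventually_mono[OF eventually_nb_open[OF zopen_restrict[OF W(1) assms(2)]]])
      (use W assms in auto)
qed

lemma eventually_nb_superset:
  assumes "eventually Q (nb P p)" "P \<subseteq> Z" "p \<in> P"
  shows "\<forall>\<^sub>F x in nb Z p. x \<in> P \<longrightarrow> Q x"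
proof -
  obtain W where W: "zopen P W" "p \<in> W" "\<forall>x\<in>W. Q x"
    using assms by (auto simp: eventually_nb)
  obtain T where T: "openin zariski T" "W = T \<inter> P"
    using W unfolding zopen_def openin_subtopology by blast
  have "zopen Z (T \<inter> Z)"
    unfolding zopen_def openin_subtopology using T by blast
  then have "\<forall>\<^sub>F x in nb Z p. x \<in> T \<inter> Z"
    by (rule eventually_nb_open) (use W T assms in auto)
  then show ?thesis
    by (rule eventually_mono) (use W T assms in auto)
qed

text \<open>On an irreducible variety nonempty open sets are dense.  So they form a proper filter, modulo
  which rational functions behave like elements of a field, and a germ of a regular function is
  determined by the rational function that it represents.\<close>

locale variety =
  fixes Z :: "('k::field, 'n::finite) pspace set"
  assumes variety: "projective_variety Z"
begin

lemma nonempty: "Z \<noteq> {}"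
  using variety unfolding projective_variety_def by blast

lemma eventually_gen:
  "eventually P (gen Z) \<longleftrightarrow> (\<exists>W. zopen Z W \<and> W \<noteq> {} \<and> (\<forall>x\<in>W. P x))"
  unfolding gen_def
proof (subst eventually_INF_base)
  show "{W. zopen Z W \<and> W \<noteq> {}} \<noteq> {}"
    using zopen_self nonempty by blast
  fix A B assume "A \<in> {W. zopen Z W \<and> W \<noteq> {}}" "B \<in> {W. zopen Z W \<and> W \<noteq> {}}"
  then show "\<exists>C\<in>{W. zopen Z W \<and> W \<noteq> {}}. principal C \<le> inf (principal A) (principal B)"
    using zopen_Int_nonempty[OF variety] by (intro bexI[of _ "A \<inter> B"]) (auto simp: zopen_Int)
qed (auto simp: eventually_principal)

lemma gen_eq_iff: "gen_eq Z f g \<longleftrightarrow> (\<forall>\<^sub>F x in gen Z. f x = g x)"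
  unfolding gen_eq_def eventually_gen ..

lemma eventually_gen_open: "zopen Z W \<Longrightarrow> W \<noteq> {} \<Longrightarrow> \<forall>\<^sub>F x in gen Z. x \<in> W"
  unfolding eventually_gen by blast

lemma gen_nontrivial: "gen Z \<noteq> bot"
  using eventually_gen[of "\<lambda>_. False"] by (auto simp: trivial_limit_def)

lemma gen_if_nb: "eventually P (nb Z p) \<Longrightarrow> p \<in> Z \<Longrightarrow> eventually P (gen Z)"
  unfolding eventually_nb eventually_gen by blast

lemma nonzero_gen:
  assumes "zopen Z W" "regular W f" "p \<in> W" "f p \<noteq> 0"
  shows "\<forall>\<^sub>F x in gen Z. f x \<noteq> 0"
proof -
  have "\<forall>\<^sub>F x in gen Z. x \<in> {x \<in> W. f x \<noteq> 0}"
    by (rule eventually_gen_open[OF zopen_nonzero[OF assms(1,2)]]) (use assms in auto)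
  then show ?thesis by (rule eventually_mono) auto
qed

lemma not_gen_zero:
  assumes "reg_at Z p f" "\<not> (\<forall>\<^sub>F x in gen Z. f x = 0)"
  shows "\<forall>\<^sub>F x in gen Z. f x \<noteq> 0"
proof -
  obtain W where W: "zopen Z W" "p \<in> W" "regular W f"
    using assms(1) unfolding reg_at_def by blast
  then have "\<not> (\<forall>x\<in>W. f x = 0)"
    using assms(2) eventually_gen by blast
  then show ?thesis
    using nonzero_gen[OF W(1,3)] by blast
qed

lemma regular_gen_eq:
  assumes "zopen Z W" "regular W f" "regular W g" "\<forall>\<^sub>F x in gen Z. f x = g x" "p \<in> W"
  shows "f p = g p"
proof (rule ccontr)
  assume "f p \<noteq> g p"
  moreover have "regular W (\<lambda>x. f x + (- 1) * g x)"
    by (intro regular_add regular_mult regular_const assms)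
  ultimately have "\<forall>\<^sub>F x in gen Z. f x + (- 1) * g x \<noteq> 0"
    by (intro nonzero_gen[OF assms(1) _ assms(5)]) auto
  with assms(4) have "\<forall>\<^sub>F x in gen Z. False"
    by eventually_elim auto
  then show False using gen_nontrivial by (simp add: trivial_limit_def)
qed

lemma reg_at_gen_eq:
  assumes "reg_at Z p f" "reg_at Z p g" "\<forall>\<^sub>F x in gen Z. f x = g x"
  shows "\<forall>\<^sub>F x in nb Z p. f x = g x"
proof -
  obtain W where "zopen Z W" "p \<in> W" "regular W f" "regular W g"
    using reg_at2[OF assms(1,2)] .
  then show ?thesis
    using regular_gen_eq[OF _ _ _ assms(3)] reg_at_in[OF assms(1)] by (auto simp: eventually_nb)
qed

lemma reg_at_cancel:
  assumes "reg_at Z p f" "reg_at Z p g" "\<forall>\<^sub>F x in gen Z. c x \<noteq> 0"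
    and "\<forall>\<^sub>F x in gen Z. f x * c x = g x * c x"
  shows "\<forall>\<^sub>F x in nb Z p. f x = g x"
proof (rule reg_at_gen_eq[OF assms(1,2)])
  show "\<forall>\<^sub>F x in gen Z. f x = g x"
    using assms(3,4) by eventually_elim auto
qed

lemma in_stalk_iff: "in_stalk Z p f \<longleftrightarrow> (\<exists>u. reg_at Z p u \<and> (\<forall>\<^sub>F x in gen Z. f x = u x))"
  unfolding in_stalk_def reg_at_def gen_eq_iff by blast

lemma unit_in_stalk_iff:
  "unit_in_stalk Z p f \<longleftrightarrow> (\<exists>u. reg_at Z p u \<and> u p \<noteq> 0 \<and> (\<forall>\<^sub>F x in gen Z. f x = u x))"
proof
  assume "unit_in_stalk Z p f"
  then show "\<exists>u. reg_at Z p u \<and> u p \<noteq> 0 \<and> (\<forall>\<^sub>F x in gen Z. f x = u x)"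
    unfolding unit_in_stalk_def reg_at_def gen_eq_iff by blast
next
  assume "\<exists>u. reg_at Z p u \<and> u p \<noteq> 0 \<and> (\<forall>\<^sub>F x in gen Z. f x = u x)"
  then obtain u W where u: "zopen Z W" "p \<in> W" "regular W u" "u p \<noteq> 0" "\<forall>\<^sub>F x in gen Z. f x = u x"
    unfolding reg_at_def by blast
  have "zopen Z {x \<in> W. u x \<noteq> 0}" "regular {x \<in> W. u x \<noteq> 0} u"
    using zopen_nonzero[OF u(1,3)] regular_subset[OF u(3), of "{x \<in> W. u x \<noteq> 0}"] by auto
  then show "unit_in_stalk Z p f"
    unfolding unit_in_stalk_def gen_eq_iff using u by blast
qed

lemma not_gen_zero_nonzero: "\<forall>\<^sub>F x in gen Z. f x \<noteq> 0 \<Longrightarrow> \<not> (\<forall>\<^sub>F x in gen Z. f x = (0::'k))"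
proof
  assume "\<forall>\<^sub>F x in gen Z. f x \<noteq> 0" "\<forall>\<^sub>F x in gen Z. f x = 0"
  then have "\<forall>\<^sub>F x in gen Z. False" by eventually_elim auto
  then show False using gen_nontrivial by (simp add: trivial_limit_def)
qed

lemma nonzero_ratfun_iff:
  "nonzero_ratfun Z f \<longleftrightarrow> (\<exists>p. reg_at Z p f) \<and> (\<forall>\<^sub>F x in gen Z. f x \<noteq> 0)"
proof
  assume f: "nonzero_ratfun Z f"
  then have "\<exists>p. reg_at Z p f"
    unfolding nonzero_ratfun_def reg_at_def by auto
  with f show "(\<exists>p. reg_at Z p f) \<and> (\<forall>\<^sub>F x in gen Z. f x \<noteq> 0)"
    unfolding nonzero_ratfun_def gen_eq_iff using not_gen_zero by auto
next
  assume f: "(\<exists>p. reg_at Z p f) \<and> (\<forall>\<^sub>F x in gen Z. f x \<noteq> 0)"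
  then show "nonzero_ratfun Z f"
    unfolding nonzero_ratfun_def gen_eq_iff reg_at_def using not_gen_zero_nonzero by blast
qed

end


section \<open>Local equations of prime divisors\<close>

definition dvd_at :: "('k::field, 'n::finite) pspace set \<Rightarrow> ('k, 'n) pspace \<Rightarrow>
    (('k, 'n) pspace \<Rightarrow> 'k) \<Rightarrow> (('k, 'n) pspace \<Rightarrow> 'k) \<Rightarrow> bool" where
  "dvd_at Z p f g \<longleftrightarrow> (\<exists>u. reg_at Z p u \<and> (\<forall>\<^sub>F x in nb Z p. g x = u x * f x))"

text \<open>The notion of a local equation for the germ at \<open>p\<close>.  That \<open>P\<close> is the zero set of \<open>f\<close> near
  \<open>p\<close> follows from \<open>local_equation\<close>, which makes \<open>f\<close> a unit at the points outside \<open>P\<close>.\<close>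

definition equation_at :: "('k::field, 'n::finite) pspace set \<Rightarrow> ('k, 'n) pspace set \<Rightarrow>
    ('k, 'n) pspace \<Rightarrow> (('k, 'n) pspace \<Rightarrow> 'k) \<Rightarrow> bool" where
  "equation_at Z P p f \<longleftrightarrow> reg_at Z p f \<and> (\<forall>\<^sub>F x in nb Z p. f x = 0 \<longleftrightarrow> x \<in> P) \<and>
     (\<forall>g. reg_at Z p g \<and> (\<forall>\<^sub>F x in nb Z p. x \<in> P \<longrightarrow> g x = 0) \<longrightarrow> dvd_at Z p f g)"

lemma dvd_at_germI: "reg_at Z p u \<Longrightarrow> \<forall>\<^sub>F x in nb Z p. g x = u x * f x \<Longrightarrow> dvd_at Z p f g"
  unfolding dvd_at_def by blast

lemma dvd_atE:
  assumes "dvd_at Z p f g"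
  obtains u where "reg_at Z p u" "\<forall>\<^sub>F x in nb Z p. g x = u x * f x"
  using assms unfolding dvd_at_def by blast

lemma dvd_atI: "reg_at Z p u \<Longrightarrow> (\<And>x. g x = u x * f x) \<Longrightarrow> dvd_at Z p f g"
  by (rule dvd_at_germI, assumption, rule always_eventually) simp

lemma dvd_at_trans:
  assumes "dvd_at Z p f g" "dvd_at Z p g h"
  shows "dvd_at Z p f h"
proof -
  obtain u where u: "reg_at Z p u" "\<forall>\<^sub>F x in nb Z p. g x = u x * f x"
    using assms(1) by (rule dvd_atE)
  obtain v where v: "reg_at Z p v" "\<forall>\<^sub>F x in nb Z p. h x = v x * g x"
    using assms(2) by (rule dvd_atE)
  have "\<forall>\<^sub>F x in nb Z p. h x = (v x * u x) * f x"
    using u(2) v(2) by eventually_elim (simp add: mult.assoc)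
  then show ?thesis
    by (rule dvd_at_germI[OF reg_at_mult[OF v(1) u(1)]])
qed

lemma dvd_at_mult:
  assumes "dvd_at Z p f g" "dvd_at Z p f' g'"
  shows "dvd_at Z p (\<lambda>x. f x * f' x) (\<lambda>x. g x * g' x)"
proof -
  obtain u where u: "reg_at Z p u" "\<forall>\<^sub>F x in nb Z p. g x = u x * f x"
    using assms(1) by (rule dvd_atE)
  obtain v where v: "reg_at Z p v" "\<forall>\<^sub>F x in nb Z p. g' x = v x * f' x"
    using assms(2) by (rule dvd_atE)
  have "\<forall>\<^sub>F x in nb Z p. g x * g' x = (u x * v x) * (f x * f' x)"
    using u(2) v(2) by eventually_elim simp
  then show ?thesis
    by (rule dvd_at_germI[OF reg_at_mult[OF u(1) v(1)]])
qed

lemma dvd_at_power: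
  assumes "dvd_at Z p f g"
  shows "dvd_at Z p (\<lambda>x. f x ^ n) (\<lambda>x. g x ^ n)"
proof -
  obtain u where u: "reg_at Z p u" "\<forall>\<^sub>F x in nb Z p. g x = u x * f x"
    using assms by (rule dvd_atE)
  have "\<forall>\<^sub>F x in nb Z p. g x ^ n = u x ^ n * f x ^ n"
    using u(2) by eventually_elim (simp add: power_mult_distrib)
  then show ?thesis
    by (rule dvd_at_germI[OF reg_at_power[OF u(1)]])
qed

lemma reg_at_nearby:
  assumes "reg_at Z p f"
  shows "\<forall>\<^sub>F x in nb Z p. reg_at Z x f"
proof -
  obtain W where W: "zopen Z W" "p \<in> W" "regular W f"
    using assms unfolding reg_at_def by blast
  show ?thesis
    by (rule eventually_mono[OF eventually_nb_open[OF W(1,2)]]) (rule reg_at_regular[OF W(1,3)])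
qed

lemma dvd_at_unit:
  assumes "reg_at Z p f" "f p \<noteq> 0" "reg_at Z p g"
  shows "dvd_at Z p f g"
proof -
  have "\<forall>\<^sub>F x in nb Z p. g x = (g x * inverse (f x)) * f x"
    using reg_at_nonzero[OF assms(1,2)] by eventually_elim simp
  then show ?thesis
    by (rule dvd_at_germI[OF reg_at_mult[OF assms(3) reg_at_inverse[OF assms(1,2)]]])
qed

lemma local_equation_at:
  assumes P: "closedin zariski P" and f: "local_equation Z P W f" and p: "p \<in> W"
  shows "equation_at Z P p f"
proof -
  have W: "zopen Z W" "regular W f" "\<forall>x\<in>W \<inter> P. f x = 0"
    using f unfolding local_equation_def by simp_all
  have dvd: "dvd_at Z q f g"
    if q: "q \<in> W" and V: "zopen Z V" "q \<in> V" "V \<subseteq> W" "regular V g" "\<forall>x\<in>V \<inter> P. g x = 0" for q V g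
  proof -
    have "\<exists>W'' u. zopen Z W'' \<and> q \<in> W'' \<and> W'' \<subseteq> V \<and> regular W'' u \<and> (\<forall>x\<in>W''. g x = u x * f x)"
      using f[unfolded local_equation_def, THEN conjunct2, THEN conjunct2, THEN conjunct2,
          rule_format, OF q, of V g] V by simp
    then obtain W'' u where u: "zopen Z W''" "q \<in> W''" "regular W'' u" "\<forall>x\<in>W''. g x = u x * f x"
      by (elim exE conjE) (rule that)
    show ?thesis
      by (rule dvd_at_germI[OF reg_at_regular[OF u(1,3,2)]],
          rule eventually_mono[OF eventually_nb_open[OF u(1,2)]]) (use u(4) in simp)
  qed
  have pZ: "p \<in> Z" using zopen_subset[OF W(1)] p by blast
  have nz: "f x \<noteq> 0" if x: "x \<in> W" "x \<notin> P" for x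
  proof
    assume z: "f x = 0"
    have xZ: "x \<in> Z" using zopen_subset[OF W(1)] x by blast
    have "zopen Z (W \<inter> (Z - P))"
      using zopen_Int[OF W(1) zopen_diff_closed[OF P]] .
    then have "dvd_at Z x f (\<lambda>_. 1)"
      by (rule dvd[OF x(1)]) (use x xZ regular_const in auto)
    then obtain u where "\<forall>\<^sub>F y in nb Z x. 1 = u y * f y"
      by (rule dvd_atE)
    then have "1 = u x * f x"
      by (rule eventually_nb_point[OF _ xZ])
    with z show False by simp
  qed
  have "dvd_at Z p f g" if g: "reg_at Z p g" "\<forall>\<^sub>F x in nb Z p. x \<in> P \<longrightarrow> g x = 0" for g
  proof -
    obtain A where A: "zopen Z A" "p \<in> A" "regular A g"
      using g(1) unfolding reg_at_def by blast
    obtain B where B: "zopen Z B" "p \<in> B" "\<forall>x\<in>B. x \<in> P \<longrightarrow> g x = 0"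
      using g(2) unfolding eventually_nb[OF pZ] by auto
    show ?thesis
      by (rule dvd[OF p zopen_Int[OF zopen_Int[OF A(1) B(1)] W(1)]])
        (use A B p regular_subset[OF A(3), of "A \<inter> B \<inter> W"] in auto)
  qed
  moreover have "\<forall>\<^sub>F x in nb Z p. f x = 0 \<longleftrightarrow> x \<in> P"
    by (rule eventually_mono[OF eventually_nb_open[OF W(1) p]]) (use W(3) nz in auto)
  ultimately show ?thesis
    unfolding equation_at_def using reg_at_regular[OF W(1,2) p] by simp
qed

lemma equation_dvd:
  assumes "equation_at Z P p f" "equation_at Z P p g"
  shows "dvd_at Z p f g"
proof -
  have "\<forall>\<^sub>F x in nb Z p. g x = 0 \<longleftrightarrow> x \<in> P"
    using assms(2) unfolding equation_at_def by blast
  then have "\<forall>\<^sub>F x in nb Z p. x \<in> P \<longrightarrow> g x = 0"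
    by (rule eventually_mono) simp
  then show ?thesis
    using assms unfolding equation_at_def by blast
qed

context variety
begin

lemma in_stalk_quotient:
  assumes "reg_at Z p t" "reg_at Z p f" "\<forall>\<^sub>F x in gen Z. f x \<noteq> 0"
  shows "in_stalk Z p (\<lambda>x. t x / f x) \<longleftrightarrow> dvd_at Z p f t"
proof
  assume "in_stalk Z p (\<lambda>x. t x / f x)"
  then obtain u where u: "reg_at Z p u" "\<forall>\<^sub>F x in gen Z. t x / f x = u x"
    unfolding in_stalk_iff by blast
  have "\<forall>\<^sub>F x in gen Z. t x = u x * f x"
    using u(2) assms(3) by eventually_elim (auto simp: field_simps)
  then have "\<forall>\<^sub>F x in nb Z p. t x = u x * f x"
    by (rule reg_at_gen_eq[OF assms(1) reg_at_mult[OF u(1) assms(2)]])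
  then show "dvd_at Z p f t"
    by (rule dvd_at_germI[OF u(1)])
next
  assume "dvd_at Z p f t"
  then obtain u where u: "reg_at Z p u" "\<forall>\<^sub>F x in nb Z p. t x = u x * f x"
    by (rule dvd_atE)
  have "\<forall>\<^sub>F x in gen Z. t x / f x = u x"
    using gen_if_nb[OF u(2) reg_at_in[OF u(1)]] assms(3) by eventually_elim simp
  then show "in_stalk Z p (\<lambda>x. t x / f x)"
    unfolding in_stalk_iff using u by blast
qed

text \<open>Local quotients by a function that is not identically zero are unique, and so they glue.\<close>

lemma regular_quotient:
  assumes W: "zopen Z W" and f: "\<forall>\<^sub>F x in gen Z. f x \<noteq> 0"
    and dvd: "\<And>p. p \<in> W \<Longrightarrow> dvd_at Z p f g"
  obtains u where "regular W u" "\<forall>x\<in>W. g x = u x * f x"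
proof -
  have "\<forall>p\<in>W. \<exists>u. reg_at Z p u \<and> (\<forall>\<^sub>F x in nb Z p. g x = u x * f x)"
    using dvd unfolding dvd_at_def by blast
  from bchoice[OF this]
  obtain v where "\<forall>p\<in>W. reg_at Z p (v p) \<and> (\<forall>\<^sub>F x in nb Z p. g x = v p x * f x)" ..
  then have v: "\<And>p. p \<in> W \<Longrightarrow> reg_at Z p (v p)"
    "\<And>p. p \<in> W \<Longrightarrow> \<forall>\<^sub>F x in nb Z p. g x = v p x * f x"
    by auto
  have "reg_at Z p (\<lambda>x. v x x)" if p: "p \<in> W" for p
  proof (rule reg_at_cong[OF v(1)[OF p]])
    have "p \<in> Z" using p zopen_subset[OF W] by blast
    note reg_at_nearby[OF v(1)[OF p]] eventually_nb_nb[OF v(2)[OF p] \<open>p \<in> Z\<close>]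
      eventually_nb_open[OF W p]
    then show "\<forall>\<^sub>F x in nb Z p. v p x = v x x"
    proof eventually_elim
      case (elim x)
      have "\<forall>\<^sub>F x' in nb Z x. v p x' * f x' = v x x' * f x'"
        using elim(2)[THEN conjunct2] v(2)[OF elim(3)] by eventually_elim (rule trans, erule sym)
      then have "\<forall>\<^sub>F x' in gen Z. v p x' * f x' = v x x' * f x'"
        by (rule gen_if_nb[OF _ elim(2)[THEN conjunct1]])
      then have "\<forall>\<^sub>F x' in nb Z x. v p x' = v x x'"
        by (rule reg_at_cancel[OF elim(1) v(1)[OF elim(3)] f])
      then show ?case
        by (rule eventually_nb_point[OF _ elim(2)[THEN conjunct1]])
    qed
  qed
  then have "regular W (\<lambda>x. v x x)"
    by (rule regular_local[OF W])
  moreover have "\<forall>x\<in>W. g x = v x x * f x"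
    using eventually_nb_point[OF v(2)] zopen_subset[OF W] by auto
  ultimately show ?thesis by (rule that)
qed

end

locale hypersurface = variety Z for Z :: "('k::field, 'n::finite) pspace set" +
  fixes P :: "('k, 'n) pspace set"
  assumes variety_P: "projective_variety P" and subset: "P \<subseteq> Z" and proper: "P \<noteq> Z"
begin

sublocale P: variety P
  by unfold_locales (rule variety_P)

lemma closed: "closedin zariski P"
  using variety_P unfolding projective_variety_def by blast

lemma outside: "zopen Z (Z - P)" "Z - P \<noteq> {}"
  using zopen_diff_closed[OF closed] subset proper by auto

lemma equation_reg_at: "equation_at Z P p f \<Longrightarrow> reg_at Z p f"
  unfolding equation_at_def by blast

lemma equation_nonzero_outside:
  assumes "equation_at Z P p f" "p \<notin> P"
  shows "f p \<noteq> 0"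
proof -
  have "\<forall>\<^sub>F x in nb Z p. f x = 0 \<longleftrightarrow> x \<in> P" "p \<in> Z"
    using assms reg_at_in unfolding equation_at_def by auto
  then have "f p = 0 \<longleftrightarrow> p \<in> P"
    by (rule eventually_nb_point)
  then show ?thesis
    using assms(2) by simp
qed

lemma equation_zero_on:
  assumes "equation_at Z P p f" "p \<in> P"
  shows "f p = 0"
proof -
  have "\<forall>\<^sub>F x in nb Z p. f x = 0 \<longleftrightarrow> x \<in> P" "p \<in> Z"
    using assms reg_at_in unfolding equation_at_def by auto
  then have "f p = 0 \<longleftrightarrow> p \<in> P"
    by (rule eventually_nb_point)
  then show ?thesis
    using assms(2) by simp
qed

lemma equation_nonzero:
  assumes "equation_at Z P p f"
  shows "\<forall>\<^sub>F x in gen Z. f x \<noteq> 0"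
proof -
  have "\<forall>\<^sub>F x in nb Z p. f x = 0 \<longleftrightarrow> x \<in> P" "p \<in> Z"
    using assms reg_at_in unfolding equation_at_def by auto
  then have "\<forall>\<^sub>F x in gen Z. f x = 0 \<longleftrightarrow> x \<in> P"
    by (rule gen_if_nb)
  then show ?thesis
    using eventually_gen_open[OF outside] by eventually_elim simp
qed

lemma equation_nonzero_power:
  "equation_at Z P p f \<Longrightarrow> \<forall>\<^sub>F x in gen Z. f x ^ n \<noteq> 0"
  using equation_nonzero by (rule eventually_mono) auto

text \<open>As \<open>P\<close> is irreducible, a product vanishes on \<open>P\<close> only if a factor does.  So this criterion
  says that a local equation is a prime element of the local ring.\<close>

lemma equation_dvd_iff:
  assumes f: "equation_at Z P p f" and p: "p \<in> P" and g: "reg_at Z p g"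
  shows "dvd_at Z p f g \<longleftrightarrow> (\<forall>\<^sub>F x in gen P. g x = 0)"
proof
  assume "dvd_at Z p f g"
  then obtain u where "\<forall>\<^sub>F x in nb Z p. g x = u x * f x"
    by (rule dvd_atE)
  moreover have "\<forall>\<^sub>F x in nb Z p. f x = 0 \<longleftrightarrow> x \<in> P"
    using f unfolding equation_at_def by blast
  ultimately have "\<forall>\<^sub>F x in nb Z p. x \<in> P \<longrightarrow> g x = 0"
    by eventually_elim simp
  then have "\<forall>\<^sub>F x in nb P p. g x = 0"
    by (rule eventually_nb_subvariety[OF _ subset p])
  then show "\<forall>\<^sub>F x in gen P. g x = 0"
    by (rule P.gen_if_nb[OF _ p])
next
  assume "\<forall>\<^sub>F x in gen P. g x = 0"
  then have "\<forall>\<^sub>F x in nb P p. g x = 0"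
    by (rule P.reg_at_gen_eq[OF reg_at_subvariety[OF g subset p] reg_at_const[OF p]])
  then have "\<forall>\<^sub>F x in nb Z p. x \<in> P \<longrightarrow> g x = 0"
    by (rule eventually_nb_superset[OF _ subset p])
  then show "dvd_at Z p f g"
    using f g unfolding equation_at_def by blast
qed

text \<open>A prime element that does not divide \<open>h\<close> can be removed from both sides, one at a time.\<close>

lemma equation_power_dvd_cancel:
  assumes f: "equation_at Z P p f" and h: "reg_at Z p h" "p \<in> P \<Longrightarrow> \<forall>\<^sub>F x in gen P. h x \<noteq> 0"
    and z: "reg_at Z p z" and dvd: "dvd_at Z p (\<lambda>x. f x ^ m) (\<lambda>x. h x * z x)"
  shows "dvd_at Z p (\<lambda>x. f x ^ m) z"
proof (cases "p \<in> P")
  case False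
  then show ?thesis
    using equation_nonzero_outside[OF f] equation_reg_at[OF f] z
    by (intro dvd_at_unit reg_at_power) auto
next
  case True
  note fr = equation_reg_at[OF f]
  note pZ = reg_at_in[OF fr]
  show ?thesis
    using z dvd
  proof (induction m arbitrary: z)
    case 0
    then show ?case by (intro dvd_atI[of _ _ z]) auto
  next
    case (Suc m)
    have "dvd_at Z p f (\<lambda>x. f x ^ Suc m)"
      by (rule dvd_atI[OF reg_at_power[OF fr, of m]]) simp
    then have "dvd_at Z p f (\<lambda>x. h x * z x)"
      using dvd_at_trans Suc.prems(2) by blast
    then have "\<forall>\<^sub>F x in gen P. h x * z x = 0"
      using equation_dvd_iff[OF f True reg_at_mult[OF h(1) Suc.prems(1)]] by blast
    then have "\<forall>\<^sub>F x in gen P. z x = 0"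
      using h(2)[OF True] by eventually_elim simp
    then have "dvd_at Z p f z"
      using equation_dvd_iff[OF f True Suc.prems(1)] by blast
    then obtain w where w: "reg_at Z p w" "\<forall>\<^sub>F x in nb Z p. z x = w x * f x"
      by (rule dvd_atE)
    obtain u where u: "reg_at Z p u" "\<forall>\<^sub>F x in nb Z p. h x * z x = u x * f x ^ Suc m"
      using Suc.prems(2) by (rule dvd_atE)
    have "\<forall>\<^sub>F x in nb Z p. (h x * w x) * f x = (u x * f x ^ m) * f x"
      using u(2) w(2) by eventually_elim (simp add: mult_ac)
    then have "\<forall>\<^sub>F x in gen Z. (h x * w x) * f x = (u x * f x ^ m) * f x"
      by (rule gen_if_nb[OF _ pZ])
    then have "\<forall>\<^sub>F x in nb Z p. h x * w x = u x * f x ^ m"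
      by (rule reg_at_cancel[OF reg_at_mult[OF h(1) w(1)] reg_at_mult[OF u(1) reg_at_power[OF fr]] equation_nonzero[OF f]])
    then have "dvd_at Z p (\<lambda>x. f x ^ m) (\<lambda>x. h x * w x)"
      by (rule dvd_at_germI[OF u(1)])
    then have "dvd_at Z p (\<lambda>x. f x ^ m) w"
      by (rule Suc.IH[OF w(1)])
    then have "dvd_at Z p (\<lambda>x. f x ^ m * f x) (\<lambda>x. w x * f x)"
      by (rule dvd_at_mult) (rule dvd_atI[of _ _ "\<lambda>_. 1"], auto intro: reg_at_const pZ)
    then obtain v where v: "reg_at Z p v" "\<forall>\<^sub>F x in nb Z p. w x * f x = v x * (f x ^ m * f x)"
      by (rule dvd_atE)
    have "\<forall>\<^sub>F x in nb Z p. z x = v x * f x ^ Suc m"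
      using v(2) w(2) by eventually_elim (simp add: mult_ac)
    then show ?case
      by (rule dvd_at_germI[OF v(1)])
  qed
qed

end

text \<open>
  Distinct prime divisors \<open>P\<close> and \<open>Q\<close> have coprime equations \<open>f\<close> and \<open>g\<close>.  For if \<open>f\<close> vanishes on \<open>Q\<close>, then \<open>Q \<subseteq> P\<close> and \<open>f = u g\<close>.  On \<open>P\<close>,
  either \<open>g\<close> vanishes, and then \<open>P \<subseteq> Q\<close>, or \<open>u\<close> vanishes, and then \<open>u\<close> is a
  multiple of \<open>f\<close> and \<open>g\<close> is a unit.
\<close>

lemma hypersurface_subset:
  assumes P: "hypersurface Z P" and Q: "hypersurface Z Q"
    and f: "equation_at Z P p f" and p: "p \<in> Q" and z: "\<forall>\<^sub>F x in gen Q. f x = 0"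
  shows "Q \<subseteq> P"
proof -
  interpret P: hypersurface Z P by (rule P)
  interpret Q: hypersurface Z Q by (rule Q)
  have pZ: "p \<in> Z" using p Q.subset by blast
  have "\<forall>\<^sub>F x in nb Z p. f x = 0 \<longleftrightarrow> x \<in> P"
    using f unfolding equation_at_def by blast
  then have "\<forall>\<^sub>F x in nb Z p. x \<in> Q \<longrightarrow> (f x = 0 \<longleftrightarrow> x \<in> P)"
    by (rule eventually_mono) blast
  then have "\<forall>\<^sub>F x in nb Q p. f x = 0 \<longleftrightarrow> x \<in> P"
    by (rule eventually_nb_subvariety[OF _ Q.subset p])
  then have "\<forall>\<^sub>F x in gen Q. f x = 0 \<longleftrightarrow> x \<in> P"
    by (rule Q.P.gen_if_nb[OF _ p])
  with z have "\<forall>\<^sub>F x in gen Q. x \<in> P"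
    by eventually_elim simp
  then obtain W where W: "zopen Q W" "W \<noteq> {}" "W \<subseteq> P"
    unfolding Q.P.eventually_gen by blast
  have "Q - P = {}"
    using zopen_Int_nonempty[OF Q.variety_P W(1) zopen_diff_closed[OF P.closed] W(2)] W(3) by blast
  then show ?thesis by blast
qed

lemma equation_nonzero_other:
  assumes P: "hypersurface Z P" and Q: "hypersurface Z Q" and "P \<noteq> Q"
    and f: "equation_at Z P p f" and g: "equation_at Z Q p g" and p: "p \<in> Q"
  shows "\<forall>\<^sub>F x in gen Q. f x \<noteq> 0"
proof (rule ccontr)
  interpret P: hypersurface Z P by (rule P)
  interpret Q: hypersurface Z Q by (rule Q)
  note fr = P.equation_reg_at[OF f] and gr = Q.equation_reg_at[OF g]
  note pZ = reg_at_in[OF fr]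
  assume "\<not> (\<forall>\<^sub>F x in gen Q. f x \<noteq> 0)"
  then have z: "\<forall>\<^sub>F x in gen Q. f x = 0"
    using Q.P.not_gen_zero reg_at_subvariety[OF fr Q.subset p] by blast
  then have "Q \<subseteq> P"
    by (rule hypersurface_subset[OF P Q f p])
  then have pP: "p \<in> P" using p by blast
  have "dvd_at Z p g f"
    using Q.equation_dvd_iff[OF g p fr] z by blast
  then obtain u where u: "reg_at Z p u" "\<forall>\<^sub>F x in nb Z p. f x = u x * g x"
    by (rule dvd_atE)
  have "\<not> (\<forall>\<^sub>F x in gen P. g x = 0)"
    using hypersurface_subset[OF Q P g pP] \<open>Q \<subseteq> P\<close> \<open>P \<noteq> Q\<close> by blast
  then have gnz: "\<forall>\<^sub>F x in gen P. g x \<noteq> 0"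
    using P.P.not_gen_zero reg_at_subvariety[OF gr P.subset pP] by blast
  have "\<forall>\<^sub>F x in gen P. f x = 0"
    using P.equation_dvd_iff[OF f pP fr] dvd_atI[OF reg_at_const[OF pZ, of 1], of f f] by simp
  moreover have "\<forall>\<^sub>F x in gen P. f x = u x * g x"
  proof (rule P.P.gen_if_nb[OF eventually_nb_subvariety[OF _ P.subset pP] pP])
    show "\<forall>\<^sub>F x in nb Z p. x \<in> P \<longrightarrow> f x = u x * g x"
      using u(2) by (rule eventually_mono) simp
  qed
  ultimately have "\<forall>\<^sub>F x in gen P. u x = 0"
    using gnz by eventually_elim auto
  then have "dvd_at Z p f u"
    using P.equation_dvd_iff[OF f pP u(1)] by blast
  then obtain v where v: "reg_at Z p v" "\<forall>\<^sub>F x in nb Z p. u x = v x * f x"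
    by (rule dvd_atE)
  have "\<forall>\<^sub>F x in nb Z p. 1 * f x = (v x * g x) * f x"
    using u(2) v(2) by eventually_elim (simp add: mult_ac)
  then have "\<forall>\<^sub>F x in gen Z. 1 * f x = (v x * g x) * f x"
    by (rule P.gen_if_nb[OF _ pZ])
  then have "\<forall>\<^sub>F x in nb Z p. 1 = v x * g x"
    by (rule P.reg_at_cancel[OF reg_at_const[OF pZ] reg_at_mult[OF v(1) gr] P.equation_nonzero[OF f]])
  then have "1 = v p * g p"
    by (rule eventually_nb_point[OF _ pZ])
  then show False
    using Q.equation_zero_on[OF g p] by simp
qed

lemma eventually_prod_nonzero:
  fixes f :: "'a \<Rightarrow> 'b \<Rightarrow> 'c::field"
  assumes "finite A" "\<And>i. i \<in> A \<Longrightarrow> \<forall>\<^sub>F x in F. f i x \<noteq> 0"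
  shows "\<forall>\<^sub>F x in F. (\<Prod>i\<in>A. f i x) \<noteq> 0"
proof -
  have "\<forall>\<^sub>F x in F. \<forall>i\<in>A. f i x \<noteq> 0"
    using assms by (intro eventually_ball_finite) auto
  then show ?thesis
    by eventually_elim (use assms(1) in auto)
qed

text \<open>Effective divisors that contain multiples of distinct prime divisors contain the sum of these
  multiples; in the local rings, this is the coprimeness of the equations.\<close>

lemma dvd_at_prod_equations:
  assumes "variety Z" and t: "reg_at Z p t" and "finite A"
    and "\<And>Q. Q \<in> A \<Longrightarrow> hypersurface Z Q"
    and "\<And>Q. Q \<in> A \<Longrightarrow> equation_at Z Q p (e Q)"
    and "\<And>Q. Q \<in> A \<Longrightarrow> dvd_at Z p (\<lambda>x. e Q x ^ m Q) t"
  shows "dvd_at Z p (\<lambda>x. \<Prod>Q\<in>A. e Q x ^ m Q) t"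
  using assms(3-)
proof (induction A rule: finite_induct)
  case empty
  then show ?case using dvd_atI[OF t] by simp
next
  case (insert Q A)
  interpret Z: variety Z by (rule assms)
  interpret Q: hypersurface Z Q by (rule insert) simp
  note pZ = reg_at_in[OF t]
  have eq: "equation_at Z R p (e R)" "hypersurface Z R" if "R \<in> insert Q A" for R
    using insert.prems that by blast+
  have reg: "reg_at Z p (e R)" if "R \<in> insert Q A" for R
    using eq[OF that] unfolding equation_at_def by blast
  define w where "w = (\<lambda>x. \<Prod>R\<in>A. e R x ^ m R)"
  have w: "reg_at Z p w"
    unfolding w_def using insert.hyps pZ reg by (intro reg_at_prod reg_at_power) auto
  have "dvd_at Z p w t"
    unfolding w_def using insert by auto
  then obtain z where z: "reg_at Z p z" "\<forall>\<^sub>F x in nb Z p. t x = z x * w x"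
    by (rule dvd_atE)
  have "\<forall>\<^sub>F x in gen Q. w x \<noteq> 0" if "p \<in> Q"
    unfolding w_def
  proof (intro eventually_prod_nonzero insert.hyps)
    fix R assume R: "R \<in> A"
    then have "\<forall>\<^sub>F x in gen Q. e R x \<noteq> 0"
      using insert.hyps by (intro equation_nonzero_other[OF eq(2) eq(2) _ eq(1) eq(1) that]) auto
    then show "\<forall>\<^sub>F x in gen Q. e R x ^ m R \<noteq> 0"
      by eventually_elim simp
  qed
  moreover have "dvd_at Z p (\<lambda>x. e Q x ^ m Q) (\<lambda>x. w x * z x)"
  proof -
    obtain u where u: "reg_at Z p u" "\<forall>\<^sub>F x in nb Z p. t x = u x * e Q x ^ m Q"
      using insert.prems(3)[OF insertI1] by (rule dvd_atE)
    have "\<forall>\<^sub>F x in nb Z p. w x * z x = u x * e Q x ^ m Q"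
      using u(2) z(2) by eventually_elim (simp add: mult_ac)
    then show ?thesis by (rule dvd_at_germI[OF u(1)])
  qed
  ultimately have "dvd_at Z p (\<lambda>x. e Q x ^ m Q) z"
    by (intro Q.equation_power_dvd_cancel[OF eq(1) w _ z(1)]) auto
  then obtain v where v: "reg_at Z p v" "\<forall>\<^sub>F x in nb Z p. z x = v x * e Q x ^ m Q"
    by (rule dvd_atE)
  have "\<forall>\<^sub>F x in nb Z p. t x = v x * (\<Prod>R\<in>insert Q A. e R x ^ m R)"
    using z(2) v(2) by eventually_elim (use insert.hyps in \<open>simp add: w_def mult_ac\<close>)
  then show ?case by (rule dvd_at_germI[OF v(1)])
qed


section \<open>Sections on subvarieties and their orders of vanishing\<close>

text \<open>
  \<open>h\<close> plays the role of the transition functions of a line bundle on the subvariety \<open>Z\<close>: all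
  members of a system change by the same regular function on the overlap of two neighbourhoods.
  As soon as there is a nonzero section, \<open>h p q\<close> and \<open>h q p\<close> are inverse to each other.
\<close>

definition regular_transitions :: "('k::field, 'n::finite) pspace set \<Rightarrow>
    (('k, 'n) pspace \<Rightarrow> ('k, 'n) pspace set) \<Rightarrow>
    (('k, 'n) pspace \<Rightarrow> ('k, 'n) pspace \<Rightarrow> ('k, 'n) pspace \<Rightarrow> 'k) \<Rightarrow> bool" where
  "regular_transitions Z U h \<longleftrightarrow> (\<forall>p\<in>Z. \<forall>q\<in>Z. regular (U p \<inter> U q \<inter> Z) (h p q))"

definition sections_on :: "('k::field, 'n::finite) pspace set \<Rightarrow>
    (('k, 'n) pspace \<Rightarrow> ('k, 'n) pspace set) \<Rightarrow>
    (('k, 'n) pspace \<Rightarrow> ('k, 'n) pspace \<Rightarrow> ('k, 'n) pspace \<Rightarrow> 'k) \<Rightarrow> ('k, 'n) family set" where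
  "sections_on Z U h = {s \<in> regular_families Z U.
     \<forall>p\<in>Z. \<forall>q\<in>Z. \<forall>x\<in>U p \<inter> U q \<inter> Z. s p x = h p q x * s q x}"

lemma regular_familiesD:
  assumes "s \<in> regular_families Z U"
  shows "p \<in> Z \<Longrightarrow> regular (U p \<inter> Z) (s p)" "\<not> (p \<in> Z \<and> q \<in> U p \<inter> Z) \<Longrightarrow> s p q = 0"
  using assms unfolding regular_families_def by blast+

lemma regular_familiesI:
  "(\<And>p. p \<in> Z \<Longrightarrow> regular (U p \<inter> Z) (s p)) \<Longrightarrow>
   (\<And>p q. \<not> (p \<in> Z \<and> q \<in> U p \<inter> Z) \<Longrightarrow> s p q = 0) \<Longrightarrow> s \<in> regular_families Z U"
  unfolding regular_families_def by blast

lemma regular_families_eqI: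
  assumes "s \<in> regular_families Z U" "t \<in> regular_families Z U"
    and "\<And>p x. p \<in> Z \<Longrightarrow> x \<in> U p \<inter> Z \<Longrightarrow> s p x = t p x"
  shows "s = t"
proof (intro ext)
  fix p x
  show "s p x = t p x"
  proof (cases "p \<in> Z \<and> x \<in> U p \<inter> Z")
    case True
    then show ?thesis using assms(3) by blast
  next
    case False
    then show ?thesis using regular_familiesD(2)[OF assms(1) False] regular_familiesD(2)[OF assms(2) False] by simp
  qed
qed

lemma regular_families_mult:
  assumes "s \<in> regular_families Z U" "t \<in> regular_families Z U"
  shows "family_mult s t \<in> regular_families Z U"
  unfolding family_mult_def
  by (rule regular_familiesI)
    (auto intro!: regular_mult intro: regular_familiesD(1)[OF assms(1)] regular_familiesD(1)[OF assms(2)]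
      simp: regular_familiesD(2)[OF assms(1)] regular_familiesD(2)[OF assms(2)])

lemma sections_onD:
  assumes "s \<in> sections_on Z U h"
  shows "s \<in> regular_families Z U"
    and "p \<in> Z \<Longrightarrow> q \<in> Z \<Longrightarrow> x \<in> U p \<Longrightarrow> x \<in> U q \<Longrightarrow> x \<in> Z \<Longrightarrow> s p x = h p q x * s q x"
  using assms unfolding sections_on_def by blast+

lemma sections_onI:
  "s \<in> regular_families Z U \<Longrightarrow>
   (\<And>p q x. p \<in> Z \<Longrightarrow> q \<in> Z \<Longrightarrow> x \<in> U p \<inter> U q \<inter> Z \<Longrightarrow> s p x = h p q x * s q x) \<Longrightarrow> s \<in> sections_on Z U h"
  unfolding sections_on_def by blast

lemma sections_on_mult:
  assumes s: "s \<in> sections_on Z U h" and t: "t \<in> sections_on Z U h'"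
  shows "family_mult s t \<in> sections_on Z U (\<lambda>p q x. h p q x * h' p q x)"
proof (rule sections_onI[OF regular_families_mult[OF sections_onD(1)[OF s] sections_onD(1)[OF t]]])
  fix p q x assume "p \<in> Z" "q \<in> Z" "x \<in> U p \<inter> U q \<inter> Z"
  then show "family_mult s t p x = h p q x * h' p q x * family_mult s t q x"
    using sections_onD(2)[OF s, of p q x] sections_onD(2)[OF t, of p q x]
    unfolding family_mult_def by simp
qed

lemma regular_transitions_mult:
  "regular_transitions Z U h \<Longrightarrow> regular_transitions Z U h' \<Longrightarrow>
   regular_transitions Z U (\<lambda>p q x. h p q x * h' p q x)"
  unfolding regular_transitions_def by (auto intro: regular_mult)

locale covered_variety = variety Z for Z :: "('k::field, 'n::finite) pspace set" +
  fixes U :: "('k, 'n) pspace \<Rightarrow> ('k, 'n) pspace set"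
  assumes cover: "\<And>p. p \<in> Z \<Longrightarrow> zopen Z (U p \<inter> Z)" "\<And>p. p \<in> Z \<Longrightarrow> p \<in> U p"
begin

lemma overlap: "p \<in> Z \<Longrightarrow> q \<in> Z \<Longrightarrow> zopen Z (U p \<inter> U q \<inter> Z)"
  using zopen_Int[OF cover(1) cover(1), of p q] by (simp add: Int_ac)

lemma overlap_nonempty:
  assumes "p \<in> Z" "q \<in> Z"
  shows "U p \<inter> U q \<inter> Z \<noteq> {}"
  using zopen_Int_nonempty[OF variety cover(1)[OF assms(1)] cover(1)[OF assms(2)]] cover(2) assms
  by blast

lemma families_reg_at:
  "s \<in> regular_families Z U \<Longrightarrow> p \<in> Z \<Longrightarrow> x \<in> U p \<Longrightarrow> x \<in> Z \<Longrightarrow> reg_at Z x (s p)"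
  by (rule reg_at_regular[OF cover(1) regular_familiesD(1)]) auto

lemma families_nonzero:
  assumes s: "s \<in> regular_families Z U" "s p x \<noteq> 0"
  shows "\<forall>\<^sub>F x in gen Z. s p x \<noteq> 0"
proof -
  have px: "p \<in> Z \<and> x \<in> U p \<inter> Z"
    using regular_familiesD(2)[OF s(1), of p x] s(2) by blast
  show ?thesis
    by (rule nonzero_gen[OF cover(1) regular_familiesD(1)[OF s(1)], of p x]) (use px s(2) in auto)
qed

lemma section_nonzero:
  assumes s: "s \<in> sections_on Z U h" "s \<noteq> 0" and p: "p \<in> Z"
  shows "\<forall>\<^sub>F x in gen Z. s p x \<noteq> 0"
proof -
  obtain q y where q: "s q y \<noteq> 0"
    using s(2) by (auto simp: fun_eq_iff)
  have qZ: "q \<in> Z"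
    using regular_familiesD(2)[OF sections_onD(1)[OF s(1)], of q y] q by blast
  show ?thesis
    using families_nonzero[OF sections_onD(1)[OF s(1)] q]
      eventually_gen_open[OF overlap[OF qZ p] overlap_nonempty[OF qZ p]]
  proof eventually_elim
    case (elim x)
    then show ?case using sections_onD(2)[OF s(1) qZ p, of x] by auto
  qed
qed

lemma section_mult_nonzero:
  assumes s: "s \<in> sections_on Z U h" "s \<noteq> 0" and t: "t \<in> sections_on Z U h'" "t \<noteq> 0"
  shows "family_mult s t \<noteq> 0"
proof
  assume z: "family_mult s t = 0"
  obtain p where p: "p \<in> Z" using nonempty by blast
  have "\<forall>\<^sub>F x in gen Z. family_mult s t p x \<noteq> 0"
    using section_nonzero[OF s p] section_nonzero[OF t p]
    by eventually_elim (simp add: family_mult_def)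
  then show False
    using not_gen_zero_nonzero[of "family_mult s t p"] z by simp
qed

end

locale divisor_step = hypersurface Z P + covered_variety Z U
  for Z :: "('k::field, 'n::finite) pspace set" and P and U +
  fixes y :: "('k, 'n) family"
  assumes y: "\<And>p. p \<in> Z \<Longrightarrow> local_equation Z P (U p \<inter> Z) (y p)"
begin

sublocale P: covered_variety P U
proof
  fix p assume "p \<in> P"
  then have p: "p \<in> Z" using subset by blast
  have "U p \<inter> Z \<inter> P = U p \<inter> P" using subset by blast
  then show "zopen P (U p \<inter> P)"
    using zopen_restrict[OF cover(1)[OF p] subset] by simp
  show "p \<in> U p" by (rule cover(2)[OF p])
qed

lemma y_equation: "p \<in> Z \<Longrightarrow> x \<in> U p \<Longrightarrow> x \<in> Z \<Longrightarrow> equation_at Z P x (y p)"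
  by (rule local_equation_at[OF closed y]) auto

lemma y_regular: "p \<in> Z \<Longrightarrow> regular (U p \<inter> Z) (y p)"
  using y unfolding local_equation_def by blast

lemma y_nonzero: "p \<in> Z \<Longrightarrow> \<forall>\<^sub>F x in gen Z. y p x \<noteq> 0"
  by (rule equation_nonzero[OF y_equation[OF _ cover(2)]])

lemma y_power_nonzero: "p \<in> Z \<Longrightarrow> \<forall>\<^sub>F x in gen Z. y p x ^ n \<noteq> 0"
  by (rule equation_nonzero_power[OF y_equation[OF _ cover(2)]])

lemma y_reg_at: "p \<in> Z \<Longrightarrow> x \<in> U p \<Longrightarrow> x \<in> Z \<Longrightarrow> reg_at Z x (y p)"
  using y_equation unfolding equation_at_def by blast

lemma y_transitions:
  obtains v where "regular_transitions Z U v"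
    "\<forall>p\<in>Z. \<forall>q\<in>Z. \<forall>x\<in>U p \<inter> U q \<inter> Z. y p x = v p q x * y q x"
proof -
  have "\<exists>u. regular (U p \<inter> U q \<inter> Z) u \<and> (\<forall>x\<in>U p \<inter> U q \<inter> Z. y p x = u x * y q x)"
    if p: "p \<in> Z" and q: "q \<in> Z" for p q
  proof -
    have "dvd_at Z x (y q) (y p)" if "x \<in> U p \<inter> U q \<inter> Z" for x
      using that by (intro equation_dvd[of Z P] y_equation p q) auto
    then show ?thesis
      by (rule regular_quotient[OF overlap[OF p q] y_nonzero[OF q]]) blast+
  qed
  then have ex: "\<forall>z\<in>Z \<times> Z. \<exists>u. regular (U (fst z) \<inter> U (snd z) \<inter> Z) u \<and>
      (\<forall>x\<in>U (fst z) \<inter> U (snd z) \<inter> Z. y (fst z) x = u x * y (snd z) x)"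
    by auto
  from bchoice[OF ex] obtain v where
    v: "\<forall>z\<in>Z \<times> Z. regular (U (fst z) \<inter> U (snd z) \<inter> Z) (v z) \<and>
      (\<forall>x\<in>U (fst z) \<inter> U (snd z) \<inter> Z. y (fst z) x = v z x * y (snd z) x)" ..
  show ?thesis
  proof (rule that)
    show "regular_transitions Z U (\<lambda>p q. v (p, q))"
      unfolding regular_transitions_def using v[THEN bspec, of "(_, _)"] by auto
    show "\<forall>p\<in>Z. \<forall>q\<in>Z. \<forall>x\<in>U p \<inter> U q \<inter> Z. y p x = v (p, q) x * y q x"
    proof (intro ballI)
      fix p q x assume "p \<in> Z" "q \<in> Z" "x \<in> U p \<inter> U q \<inter> Z"
      then show "y p x = v (p, q) x * y q x"
        using v[THEN bspec, of "(p, q)"] by simp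
    qed
  qed
qed

text \<open>Twisting by \<open>- n P\<close>: on overlaps, \<open>y q = v q p y p\<close>, so dividing sections by the \<open>n\<close>-th
  powers of the equations multiplies the transition functions by \<open>(v q p)\<^sup>n\<close>.\<close>

lemma twisted_transitions:
  assumes h: "regular_transitions Z U h"
  obtains h' where "regular_transitions Z U h'"
    "\<forall>t\<in>regular_families Z U. family_mult t (family_power y n) \<in> sections_on Z U h \<longrightarrow>
      t \<in> sections_on Z U h'"
proof -
  obtain v where v: "regular_transitions Z U v"
    "\<forall>p\<in>Z. \<forall>q\<in>Z. \<forall>x\<in>U p \<inter> U q \<inter> Z. y p x = v p q x * y q x"
    using y_transitions .
  define h' where "h' = (\<lambda>p q x. h p q x * v q p x ^ n)"
  have reg: "regular (U p \<inter> U q \<inter> Z) (h' p q)" if "p \<in> Z" "q \<in> Z" for p q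
  proof -
    have "regular (U p \<inter> U q \<inter> Z) (v q p)"
      using v(1)[unfolded regular_transitions_def, THEN bspec, OF that(2), THEN bspec, OF that(1)]
      by (simp add: Int_commute)
    then have "regular (U p \<inter> U q \<inter> Z) (\<lambda>x. v q p x ^ n)"
      by (induction n) (simp_all add: regular_const regular_mult)
    moreover have "regular (U p \<inter> U q \<inter> Z) (h p q)"
      using h that unfolding regular_transitions_def by simp
    ultimately show ?thesis unfolding h'_def by (intro regular_mult)
  qed
  show ?thesis
  proof (rule that)
    show "regular_transitions Z U h'"
      using reg unfolding regular_transitions_def by simp
  next
    show "\<forall>t\<in>regular_families Z U. family_mult t (family_power y n) \<in> sections_on Z U h \<longrightarrow>
      t \<in> sections_on Z U h'"
    proof (intro ballI impI)
    fix t assume t: "t \<in> regular_families Z U"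
      and s: "family_mult t (family_power y n) \<in> sections_on Z U h"
    show "t \<in> sections_on Z U h'"
    proof (rule sections_onI[OF t])
      fix p q x assume p: "p \<in> Z" and q: "q \<in> Z" and x: "x \<in> U p \<inter> U q \<inter> Z"
      have gen: "\<forall>\<^sub>F x in gen Z. t p x = h' p q x * t q x"
        using eventually_gen_open[OF overlap[OF p q] overlap_nonempty[OF p q]] y_power_nonzero[OF p, of n]
      proof eventually_elim
        case (elim x)
        have "t p x * y p x ^ n = h p q x * (t q x * y q x ^ n)"
          using sections_onD(2)[OF s p q, of x] elim(1) by (simp add: family_mult_def family_power_def)
        also have "y q x = v q p x * y p x"
          using v(2) p q elim(1) by blast
        finally have "t p x * y p x ^ n = (h' p q x * t q x) * y p x ^ n"
          by (simp add: h'_def power_mult_distrib mult_ac)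
        then show ?case using elim(2) by auto
      qed
      have "regular (U p \<inter> U q \<inter> Z) (t p)" "regular (U p \<inter> U q \<inter> Z) (t q)"
        by (rule regular_subset[OF regular_familiesD(1)[OF t p]], blast,
            rule regular_subset[OF regular_familiesD(1)[OF t q]], blast)
      note tp = this
      show "t p x = h' p q x * t q x"
        by (rule regular_gen_eq[OF overlap[OF p q] tp(1) regular_mult[OF reg[OF p q] tp(2)] gen x])
    qed
    qed
  qed
qed

lemma restrict_regular_families:
  assumes "t \<in> regular_families Z U"
  shows "restrict_family P t \<in> regular_families P U"
proof (rule regular_familiesI)
  fix p assume p: "p \<in> P"
  then have pZ: "p \<in> Z" using subset by blast
  show "regular (U p \<inter> P) (restrict_family P t p)"
    by (rule regular_subset_cong[OF regular_familiesD(1)[OF assms pZ]])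
      (use p subset in \<open>auto simp: restrict_family_def\<close>)
next
  fix p q assume "\<not> (p \<in> P \<and> q \<in> U p \<inter> P)"
  then show "restrict_family P t p q = 0"
    using regular_familiesD(2)[OF assms, of p q] subset by (auto simp: restrict_family_def)
qed

lemma restrict_sections:
  assumes "t \<in> sections_on Z U h"
  shows "restrict_family P t \<in> sections_on P U h"
proof (rule sections_onI[OF restrict_regular_families[OF sections_onD(1)[OF assms]]])
  fix p q x assume *: "p \<in> P" "q \<in> P" "x \<in> U p \<inter> U q \<inter> P"
  then show "restrict_family P t p x = h p q x * restrict_family P t q x"
    using sections_onD(2)[OF assms, of p q x] subset by (auto simp: restrict_family_def)
qed

lemma restrict_transitions:
  assumes "regular_transitions Z U h"
  shows "regular_transitions P U h"
  unfolding regular_transitions_def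
proof (intro ballI)
  fix p q assume "p \<in> P" "q \<in> P"
  then have "regular (U p \<inter> U q \<inter> Z) (h p q)"
    using assms subset unfolding regular_transitions_def by blast
  then show "regular (U p \<inter> U q \<inter> P) (h p q)"
    by (rule regular_subset) (use subset in blast)
qed

lemma restrict_mult: "restrict_family P (family_mult s t) = family_mult (restrict_family P s) (restrict_family P t)"
  by (auto simp: restrict_family_def family_mult_def fun_eq_iff)

definition divisible :: "nat \<Rightarrow> ('k, 'n) family \<Rightarrow> bool" where
  "divisible n s \<longleftrightarrow> (\<exists>t\<in>regular_families Z U. family_mult t (family_power y n) = s)"

text \<open>A section that vanishes on \<open>P\<close> near one point of \<open>P\<close> vanishes on all of \<open>P\<close>, since \<open>P\<close>
  is irreducible; so divisibility by \<open>y\<close> at one point of \<open>P\<close> implies divisibility everywhere.\<close>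

lemma divisible_if_vanishing:
  assumes t: "t \<in> sections_on Z U h" and p: "p \<in> P" and z: "\<forall>\<^sub>F x in gen P. t p x = 0"
  shows "divisible 1 t"
proof -
  note tr = sections_onD(1)[OF t]
  have pZ: "p \<in> Z" using p subset by blast
  have zero: "\<forall>\<^sub>F x in gen P. t q x = 0" if q: "q \<in> Z" and ne: "U q \<inter> P \<noteq> {}" for q
  proof -
    have "U q \<inter> Z \<inter> P = U q \<inter> P" "U p \<inter> Z \<inter> P = U p \<inter> P" using subset by blast+
    then have o: "zopen P (U q \<inter> P)" "zopen P (U p \<inter> P)"
      using zopen_restrict[OF cover(1)[OF q] subset] zopen_restrict[OF cover(1)[OF pZ] subset] by auto
    have "U p \<inter> P \<noteq> {}" using p cover(2)[OF pZ] by blast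
    from P.eventually_gen_open[OF o(1) ne] P.eventually_gen_open[OF o(2) this] z show ?thesis
    proof eventually_elim
      case (elim x)
      then show ?case using sections_onD(2)[OF t q pZ, of x] subset by auto
    qed
  qed
  have "\<exists>u. regular (U q \<inter> Z) u \<and> (\<forall>x\<in>U q \<inter> Z. t q x = u x * y q x)" if q: "q \<in> Z" for q
  proof -
    have "dvd_at Z x (y q) (t q)" if x: "x \<in> U q \<inter> Z" for x
    proof (cases "x \<in> P")
      case True
      then show ?thesis
        using equation_dvd_iff[OF y_equation[OF q] True families_reg_at[OF tr q]] zero[OF q] x by blast
    next
      case False
      have xe: "equation_at Z P x (y q)" using x by (intro y_equation q) auto
      show ?thesis
        by (rule dvd_at_unit[OF equation_reg_at[OF xe] equation_nonzero_outside[OF xe False]])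
          (use x in \<open>auto intro: families_reg_at[OF tr q]\<close>)
    qed
    then show ?thesis
      by (rule regular_quotient[OF cover(1)[OF q] y_nonzero[OF q]]) blast+
  qed
  then have "\<forall>q\<in>Z. \<exists>u. regular (U q \<inter> Z) u \<and> (\<forall>x\<in>U q \<inter> Z. t q x = u x * y q x)" by blast
  from bchoice[OF this] obtain u where
    "\<forall>q\<in>Z. regular (U q \<inter> Z) (u q) \<and> (\<forall>x\<in>U q \<inter> Z. t q x = u q x * y q x)" ..
  then have u: "\<And>q. q \<in> Z \<Longrightarrow> regular (U q \<inter> Z) (u q)"
      "\<And>q x. q \<in> Z \<Longrightarrow> x \<in> U q \<inter> Z \<Longrightarrow> t q x = u q x * y q x"
    by blast+
  define t' where "t' = (\<lambda>q x. if q \<in> Z \<and> x \<in> U q \<inter> Z then u q x else 0)"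
  have "t' \<in> regular_families Z U"
    by (rule regular_familiesI) (auto simp: t'_def intro: regular_cong[OF u(1)])
  moreover have "family_mult t' (family_power y 1) = t"
    by (auto simp: fun_eq_iff family_mult_def family_power_def t'_def u(2) regular_familiesD(2)[OF tr])
  ultimately show ?thesis unfolding divisible_def by blast
qed

lemma divisible_if_restriction_zero:
  assumes t: "t \<in> sections_on Z U h" and z: "restrict_family P t = 0"
  shows "divisible 1 t"
proof -
  obtain p where p: "p \<in> P" using P.nonempty by blast
  have "t p x = 0" if "x \<in> P" for x
    using fun_cong[OF fun_cong[OF z, of p], of x] that p by (simp add: restrict_family_def)
  then have "\<forall>\<^sub>F x in gen P. t p x = 0"
    using P.eventually_gen_open[OF zopen_self P.nonempty] by (auto elim: eventually_mono)
  then show ?thesis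
    by (rule divisible_if_vanishing[OF t p])
qed

lemma family_power_add: "family_mult (family_mult t (family_power y m)) (family_power y n) =
  family_mult t (family_power y (m + n))"
  by (auto simp: fun_eq_iff family_mult_def family_power_def power_add mult_ac)

lemma divisible_Suc:
  assumes "family_mult t (family_power y n) = s" "divisible 1 t"
  shows "divisible (Suc n) s"
  using assms family_power_add[of _ 1 n] unfolding divisible_def by auto

lemma y_family: "t \<in> regular_families Z U \<Longrightarrow> family_mult t (family_power y n) \<in> regular_families Z U"
proof (induction n)
  case 0
  then show ?case by (simp add: family_mult_def family_power_def)
next
  case (Suc n)
  show ?case
  proof (rule regular_familiesI)
    fix p assume p: "p \<in> Z"
    show "regular (U p \<inter> Z) (family_mult t (family_power y (Suc n)) p)"
      using regular_mult[OF y_regular[OF p] regular_familiesD(1)[OF Suc.IH[OF Suc.prems] p]]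
      by (simp add: family_mult_def family_power_def mult_ac)
  qed (simp add: family_mult_def regular_familiesD(2)[OF Suc.prems])
qed

lemma divisible_mono:
  assumes "divisible n s" "m \<le> n"
  shows "divisible m s"
proof -
  obtain t where t: "t \<in> regular_families Z U" "family_mult t (family_power y n) = s"
    using assms(1) unfolding divisible_def by blast
  have "family_mult (family_mult t (family_power y (n - m))) (family_power y m) = s"
    using family_power_add[of t "n - m" m] assms(2) t(2) by simp
  then show ?thesis
    unfolding divisible_def using y_family[OF t(1)] by blast
qed

lemma in_stalk_iff_dvd:
  assumes s: "s \<in> regular_families Z U" and p: "p \<in> Z"
  shows "in_stalk Z p (\<lambda>q. s p q / y p q ^ n) \<longleftrightarrow> dvd_at Z p (\<lambda>x. y p x ^ n) (s p)"
  by (intro in_stalk_quotient reg_at_power y_reg_at families_reg_at[OF s] p cover(2) y_power_nonzero)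

lemma in_stalk_iff_divisible:
  assumes h: "regular_transitions Z U h" and s: "s \<in> sections_on Z U h"
  shows "(\<exists>p\<in>P. in_stalk Z p (\<lambda>q. s p q / y p q ^ n)) \<longleftrightarrow> divisible n s"
proof
  note sr = sections_onD(1)[OF s]
  assume "\<exists>p\<in>P. in_stalk Z p (\<lambda>q. s p q / y p q ^ n)"
  then obtain p where p: "p \<in> P" "in_stalk Z p (\<lambda>q. s p q / y p q ^ n)" by blast
  have pZ: "p \<in> Z" using p subset by blast
  have "dvd_at Z p (\<lambda>x. y p x ^ n) (s p)"
    using p(2) in_stalk_iff_dvd[OF sr pZ] by simp
  then show "divisible n s"
  proof (induction n)
    case 0
    show ?case unfolding divisible_def
      by (rule bexI[OF _ sr]) (simp add: family_mult_def family_power_def)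
  next
    case (Suc n)
    have eq: "equation_at Z P p (y p)" by (rule y_equation[OF pZ cover(2)[OF pZ] pZ])
    have "dvd_at Z p (\<lambda>x. y p x ^ n) (\<lambda>x. y p x ^ Suc n)"
      by (rule dvd_atI[OF equation_reg_at[OF eq]]) simp
    then have "divisible n s"
      using Suc.IH dvd_at_trans Suc.prems by blast
    then obtain t where t: "t \<in> regular_families Z U" "family_mult t (family_power y n) = s"
      unfolding divisible_def by blast
    obtain h' where "t \<in> sections_on Z U h'"
      by (rule twisted_transitions[OF h, of n]) (use t s in blast)
    have tr: "reg_at Z p (t p)" by (rule families_reg_at[OF t(1) pZ cover(2)[OF pZ] pZ])
    have "dvd_at Z p (\<lambda>x. y p x ^ Suc n) (\<lambda>x. t p x * y p x ^ n)"
      using Suc.prems unfolding t(2)[symmetric] by (simp add: family_mult_def family_power_def)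
    then obtain u where u: "reg_at Z p u" "\<forall>\<^sub>F x in nb Z p. t p x * y p x ^ n = u x * y p x ^ Suc n"
      by (rule dvd_atE)
    have "\<forall>\<^sub>F x in gen Z. t p x * y p x ^ n = (u x * y p x) * y p x ^ n"
      using gen_if_nb[OF u(2) pZ] by (simp add: mult_ac)
    then have "\<forall>\<^sub>F x in nb Z p. t p x = u x * y p x"
      by (rule reg_at_cancel[OF tr reg_at_mult[OF u(1) equation_reg_at[OF eq]] y_power_nonzero[OF pZ]])
    then have "dvd_at Z p (y p) (t p)"
      by (rule dvd_at_germI[OF u(1)])
    then have "\<forall>\<^sub>F x in gen P. t p x = 0"
      using equation_dvd_iff[OF eq p(1) tr] by blast
    then have "divisible 1 t"
      by (rule divisible_if_vanishing[OF \<open>t \<in> sections_on Z U h'\<close> p(1)])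
    then show ?case by (rule divisible_Suc[OF t(2)])
  qed
next
  assume "divisible n s"
  then obtain t where t: "t \<in> regular_families Z U" "family_mult t (family_power y n) = s"
    unfolding divisible_def by blast
  obtain p where p: "p \<in> P" using P.nonempty by blast
  have pZ: "p \<in> Z" using p subset by blast
  have "dvd_at Z p (\<lambda>x. y p x ^ n) (s p)"
    by (rule dvd_atI[OF families_reg_at[OF t(1) pZ cover(2)[OF pZ] pZ]])
      (simp add: t(2)[symmetric] family_mult_def family_power_def)
  then show "\<exists>p\<in>P. in_stalk Z p (\<lambda>q. s p q / y p q ^ n)"
    using in_stalk_iff_dvd[OF sections_onD(1)[OF s] pZ] p by blast
qed

lemma quotient_unique:
  assumes t: "t \<in> regular_families Z U" "t' \<in> regular_families Z U"
    and eq: "\<And>p x. p \<in> Z \<Longrightarrow> x \<in> U p \<inter> Z \<Longrightarrow> t p x * y p x ^ n = t' p x * y p x ^ n"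
  shows "t = t'"
proof (rule regular_families_eqI[OF t])
  fix p x assume p: "p \<in> Z" and x: "x \<in> U p \<inter> Z"
  have "U p \<inter> Z \<noteq> {}" using x by blast
  from eventually_gen_open[OF cover(1)[OF p] this] y_power_nonzero[OF p, of n]
  have "\<forall>\<^sub>F x in gen Z. t p x = t' p x"
    by eventually_elim (use eq[OF p] in auto)
  then show "t p x = t' p x"
    by (rule regular_gen_eq[OF cover(1)[OF p] regular_familiesD(1)[OF t(1) p] regular_familiesD(1)[OF t(2) p] _ x])
qed

text \<open>If \<open>t\<close> does not vanish on \<open>P\<close>, then it is not a multiple of \<open>y\<close>.  This is how orders and
  quotients are computed below, instead of by the greatest element or the description that define
  them.\<close>

lemma ord_along_eqI:
  assumes h: "regular_transitions Z U h" and s: "s \<in> sections_on Z U h"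
    and t: "t \<in> regular_families Z U" "family_mult t (family_power y n) = s"
    and nz: "restrict_family P t \<noteq> 0"
  shows "ord_along Z P y s = n" "divide_out Z U y n s = t" "divisible m s \<Longrightarrow> m \<le> n"
proof -
  have le: "m \<le> n" if "divisible m s" for m
  proof (rule ccontr)
    assume "\<not> m \<le> n"
    then have "divisible (Suc n) s" using divisible_mono[OF that] by simp
    then obtain t' where t': "t' \<in> regular_families Z U" "family_mult t' (family_power y (Suc n)) = s"
      unfolding divisible_def by blast
    have "t = family_mult t' (family_power y 1)"
    proof (rule quotient_unique[OF t(1) y_family[OF t'(1)]])
      fix p x
      have "family_mult t (family_power y n) p x = family_mult t' (family_power y (Suc n)) p x"
        using t(2) t'(2) by simp
      then show "t p x * y p x ^ n = family_mult t' (family_power y 1) p x * y p x ^ n"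
        by (simp add: family_mult_def family_power_def mult_ac)
    qed
    note teq = this
    have y0: "y p x = 0" if "p \<in> Z" "x \<in> U p" "x \<in> P" for p x
      by (rule equation_zero_on[OF y_equation]) (use that subset in auto)
    have "restrict_family P t = 0"
    proof -
      have "restrict_family P t p x = 0" for p x
      proof (cases "p \<in> P \<and> x \<in> P")
        case True
        then have "x \<notin> U p \<or> y p x = 0" using y0[of p x] subset by blast
        then show ?thesis
          using teq regular_familiesD(2)[OF t'(1), of p x] by (auto simp: restrict_family_def family_mult_def family_power_def)
      qed (auto simp: restrict_family_def)
      then show ?thesis by (simp add: fun_eq_iff)
    qed
    with nz show False ..
  qed
  then show "divisible m s \<Longrightarrow> m \<le> n" .
  have "divisible n s" using t unfolding divisible_def by blast
  then show "ord_along Z P y s = n"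
    unfolding ord_along_def in_stalk_iff_divisible[OF h s] by (intro Greatest_equality le)
  show "divide_out Z U y n s = t"
    unfolding divide_out_def
  proof (rule the_equality)
    show "t \<in> regular_families Z U \<and> (\<forall>p\<in>Z. \<forall>q\<in>U p \<inter> Z. t p q * y p q ^ n = s p q)"
      using t by (auto simp: family_mult_def family_power_def)
    fix t' assume "t' \<in> regular_families Z U \<and> (\<forall>p\<in>Z. \<forall>q\<in>U p \<inter> Z. t' p q * y p q ^ n = s p q)"
    then show "t' = t"
      using t by (intro quotient_unique[of _ _ n]) (auto simp: family_mult_def family_power_def)
  qed
qed

lemma ord_along_exists:
  assumes h: "regular_transitions Z U h" and s: "s \<in> sections_on Z U h"
    and b: "\<And>n. divisible n s \<Longrightarrow> n \<le> N"
  obtains t n where "t \<in> regular_families Z U" "family_mult t (family_power y n) = s"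
    "restrict_family P t \<noteq> 0"
proof -
  have d0: "divisible 0 s"
    unfolding divisible_def by (rule bexI[OF _ sections_onD(1)[OF s]]) (simp add: family_mult_def family_power_def)
  define n where "n = (GREATEST n. divisible n s)"
  have n: "divisible n s"
    unfolding n_def by (rule GreatestI_nat[where P = "\<lambda>n. divisible n s", OF d0 b])
  then obtain t where t: "t \<in> regular_families Z U" "family_mult t (family_power y n) = s"
    unfolding divisible_def by blast
  obtain h' where h': "t \<in> sections_on Z U h'"
    by (rule twisted_transitions[OF h, of n]) (use t s in blast)
  have "restrict_family P t \<noteq> 0"
  proof
    assume "restrict_family P t = 0"
    then have "divisible (Suc n) s"
      using divisible_Suc[OF t(2) divisible_if_restriction_zero[OF h']] by blast
    then have "Suc n \<le> n"
      unfolding n_def by (rule Greatest_le_nat[where P = "\<lambda>n. divisible n s", OF _ b])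
    then show False by simp
  qed
  with t show ?thesis by (rule that)
qed

end


section \<open>Cartier divisors and numerical classes\<close>

context variety
begin

lemma nonzero_ratfun_gen:
  "nonzero_ratfun Z f \<longleftrightarrow> (\<forall>\<^sub>F x in gen Z. reg_at Z x f \<and> f x \<noteq> 0)"
proof -
  have "(\<exists>p. reg_at Z p f) \<longleftrightarrow> (\<forall>\<^sub>F x in gen Z. reg_at Z x f)"
  proof
    assume "\<exists>p. reg_at Z p f"
    then obtain p where p: "reg_at Z p f" ..
    show "\<forall>\<^sub>F x in gen Z. reg_at Z x f"
      by (rule gen_if_nb[OF reg_at_nearby[OF p] reg_at_in[OF p]])
  next
    assume "\<forall>\<^sub>F x in gen Z. reg_at Z x f"
    then show "\<exists>p. reg_at Z p f"
      by (rule eventually_happens'[OF gen_nontrivial])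
  qed
  then show ?thesis
    unfolding nonzero_ratfun_iff eventually_conj_iff by simp
qed

lemma nonzero_ratfun_mult:
  "nonzero_ratfun Z f \<Longrightarrow> nonzero_ratfun Z g \<Longrightarrow> nonzero_ratfun Z (\<lambda>x. f x * g x)"
  unfolding nonzero_ratfun_gen by (erule (1) eventually_elim2) (simp add: reg_at_mult)

lemma nonzero_ratfun_inverse: "nonzero_ratfun Z f \<Longrightarrow> nonzero_ratfun Z (\<lambda>x. inverse (f x))"
  unfolding nonzero_ratfun_gen by (erule eventually_mono) (simp add: reg_at_inverse)

lemma nonzero_ratfun_divide:
  "nonzero_ratfun Z f \<Longrightarrow> nonzero_ratfun Z g \<Longrightarrow> nonzero_ratfun Z (\<lambda>x. f x / g x)"
  unfolding divide_inverse by (intro nonzero_ratfun_mult nonzero_ratfun_inverse)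

lemma unit_in_stalkE:
  assumes "unit_in_stalk Z p f"
  obtains u where "reg_at Z p u" "u p \<noteq> 0" "\<forall>\<^sub>F x in gen Z. f x = u x"
  using assms unfolding unit_in_stalk_iff by blast

lemma unit_in_stalkI:
  "reg_at Z p u \<Longrightarrow> u p \<noteq> 0 \<Longrightarrow> \<forall>\<^sub>F x in gen Z. f x = u x \<Longrightarrow> unit_in_stalk Z p f"
  unfolding unit_in_stalk_iff by (intro exI[of _ u] conjI)

lemma unit_in_stalk_mult:
  assumes "unit_in_stalk Z p f" "unit_in_stalk Z p g"
  shows "unit_in_stalk Z p (\<lambda>x. f x * g x)"
proof -
  obtain u where u: "reg_at Z p u" "u p \<noteq> 0" "\<forall>\<^sub>F x in gen Z. f x = u x"
    using assms(1) by (rule unit_in_stalkE)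
  obtain v where v: "reg_at Z p v" "v p \<noteq> 0" "\<forall>\<^sub>F x in gen Z. g x = v x"
    using assms(2) by (rule unit_in_stalkE)
  have "\<forall>\<^sub>F x in gen Z. f x * g x = u x * v x"
    using u(3) v(3) by eventually_elim simp
  then show ?thesis
    by (rule unit_in_stalkI[OF reg_at_mult[OF u(1) v(1)], rotated]) (use u v in simp)
qed

lemma unit_in_stalk_inverse:
  assumes "unit_in_stalk Z p f"
  shows "unit_in_stalk Z p (\<lambda>x. inverse (f x))"
proof -
  obtain u where u: "reg_at Z p u" "u p \<noteq> 0" "\<forall>\<^sub>F x in gen Z. f x = u x"
    using assms(1) by (rule unit_in_stalkE)
  have "\<forall>\<^sub>F x in gen Z. inverse (f x) = inverse (u x)"
    using u(3) by eventually_elim simp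
  then show ?thesis
    by (rule unit_in_stalkI[OF reg_at_inverse[OF u(1,2)], rotated]) (use u in simp)
qed

lemma unit_in_stalk_imp_in_stalk: "unit_in_stalk Z p f \<Longrightarrow> in_stalk Z p f"
  unfolding unit_in_stalk_iff in_stalk_iff by blast

lemma cartier_iff:
  "cartier Z D \<longleftrightarrow> (\<forall>p\<in>Z. nonzero_ratfun Z (D p) \<and>
     (\<forall>\<^sub>F q in nb Z p. unit_in_stalk Z q (\<lambda>x. D p x / D q x)))"
  unfolding cartier_def by (auto simp: eventually_nb)

lemma cartier_nonzero: "cartier Z D \<Longrightarrow> p \<in> Z \<Longrightarrow> \<forall>\<^sub>F x in gen Z. D p x \<noteq> 0"
  unfolding cartier_iff nonzero_ratfun_iff by blast

lemma cartier_mult: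
  assumes "cartier Z D" "cartier Z D'"
  shows "cartier Z (\<lambda>p x. D p x * D' p x)"
  unfolding cartier_iff
proof (intro ballI conjI)
  fix p assume p: "p \<in> Z"
  show "nonzero_ratfun Z (\<lambda>x. D p x * D' p x)"
    using assms p unfolding cartier_iff by (simp add: nonzero_ratfun_mult)
  have "\<forall>\<^sub>F q in nb Z p. unit_in_stalk Z q (\<lambda>x. D p x / D q x)"
      "\<forall>\<^sub>F q in nb Z p. unit_in_stalk Z q (\<lambda>x. D' p x / D' q x)"
    using assms p unfolding cartier_iff by simp_all
  then show "\<forall>\<^sub>F q in nb Z p. unit_in_stalk Z q (\<lambda>x. D p x * D' p x / (D q x * D' q x))"
  proof eventually_elim
    case (elim q)
    show ?case using unit_in_stalk_mult[OF elim] by simp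
  qed
qed

lemma cartier_inverse:
  assumes "cartier Z D"
  shows "cartier Z (\<lambda>p x. inverse (D p x))"
  unfolding cartier_iff
proof (intro ballI conjI)
  fix p assume p: "p \<in> Z"
  show "nonzero_ratfun Z (\<lambda>x. inverse (D p x))"
    using assms p unfolding cartier_iff by (simp add: nonzero_ratfun_inverse)
  have "\<forall>\<^sub>F q in nb Z p. unit_in_stalk Z q (\<lambda>x. D p x / D q x)"
    using assms p unfolding cartier_iff by simp_all
  then show "\<forall>\<^sub>F q in nb Z p. unit_in_stalk Z q (\<lambda>x. inverse (D p x) / inverse (D q x))"
  proof eventually_elim
    case (elim q)
    show ?case using unit_in_stalk_inverse[OF elim] by (simp add: divide_inverse)
  qed
qed

lemma cartier_divide:
  "cartier Z D \<Longrightarrow> cartier Z D' \<Longrightarrow> cartier Z (\<lambda>p x. D p x / D' p x)"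
  using cartier_mult[OF _ cartier_inverse] by (simp add: divide_inverse)

lemma cartier_const: "c \<noteq> 0 \<Longrightarrow> cartier Z (\<lambda>p x. c)"
proof -
  assume c: "c \<noteq> 0"
  have r: "nonzero_ratfun Z (\<lambda>_. c)"
    unfolding nonzero_ratfun_iff using c nonempty reg_at_const by auto
  have u: "unit_in_stalk Z p (\<lambda>_. c / c)" if "p \<in> Z" for p
    by (rule unit_in_stalkI[OF reg_at_const[OF that, of 1]]) (use c in auto)
  show ?thesis
    unfolding cartier_iff
    by (intro ballI conjI r eventually_mono[OF eventually_nb_open[OF zopen_self]] u)
qed

lemma equation_quotient_unit:
  assumes "equation_at Z P p f" "equation_at Z P p g" "\<forall>\<^sub>F x in gen Z. g x \<noteq> 0"
  shows "unit_in_stalk Z p (\<lambda>x. f x / g x)"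
proof -
  have r: "reg_at Z p f" "reg_at Z p g"
    using assms unfolding equation_at_def by blast+
  note p = reg_at_in[OF r(1)]
  obtain u where u: "reg_at Z p u" "\<forall>\<^sub>F x in nb Z p. f x = u x * g x"
    using equation_dvd[OF assms(2,1)] by (rule dvd_atE)
  obtain v where v: "reg_at Z p v" "\<forall>\<^sub>F x in nb Z p. g x = v x * f x"
    using equation_dvd[OF assms(1,2)] by (rule dvd_atE)
  have "\<forall>\<^sub>F x in nb Z p. 1 * g x = (v x * u x) * g x"
    using u(2) v(2) by eventually_elim (simp add: mult.assoc)
  then have "\<forall>\<^sub>F x in gen Z. 1 * g x = (v x * u x) * g x"
    by (rule gen_if_nb[OF _ p])
  then have "\<forall>\<^sub>F x in nb Z p. 1 = v x * u x"
    by (rule reg_at_cancel[OF reg_at_const[OF p] reg_at_mult[OF v(1) u(1)] assms(3)])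
  then have "1 = v p * u p"
    by (rule eventually_nb_point[OF _ p])
  then have "u p \<noteq> 0" by auto
  moreover have "\<forall>\<^sub>F x in gen Z. f x / g x = u x"
    using gen_if_nb[OF u(2) p] assms(3) by eventually_elim simp
  ultimately show ?thesis
    by (rule unit_in_stalkI[OF u(1)])
qed

text \<open>The definition of the intersection number subtracts an arbitrary principal divisor \<open>div f\<close>.  So
  if \<open>D' = D + div h\<close>, then \<open>f\<close> for \<open>D\<close> and \<open>f h\<close> for \<open>D'\<close> lead to the same degree.\<close>

lemma intersection_number_mult:
  assumes h: "nonzero_ratfun Z h"
    and D: "\<And>p. p \<in> Z \<Longrightarrow> \<forall>\<^sub>F x in gen Z. D' p x = D p x * h x"
    and C: "C \<subseteq> Z"
    and ex: "\<exists>f E. nonzero_ratfun Z f \<and> (\<forall>p\<in>C. restricts_to Z C (\<lambda>q. D p q / f q) (E p)) \<and>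
      z = (\<Sum>p | p \<in> C \<and> ord_at C p (E p) \<noteq> 0. ord_at C p (E p))"
  shows "\<exists>f E. nonzero_ratfun Z f \<and> (\<forall>p\<in>C. restricts_to Z C (\<lambda>q. D' p q / f q) (E p)) \<and>
      z = (\<Sum>p | p \<in> C \<and> ord_at C p (E p) \<noteq> 0. ord_at C p (E p))"
proof -
  obtain f E where f: "nonzero_ratfun Z f" "\<forall>p\<in>C. restricts_to Z C (\<lambda>q. D p q / f q) (E p)"
    and z: "z = (\<Sum>p | p \<in> C \<and> ord_at C p (E p) \<noteq> 0. ord_at C p (E p))"
    using ex by (elim exE conjE) (rule that)
  have "restricts_to Z C (\<lambda>q. D' p q / (f q * h q)) (E p)" if p: "p \<in> C" for p
  proof -
    have "restricts_to Z C (\<lambda>q. D p q / f q) (E p)"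
      using f(2) p by blast
    then obtain W where W: "zopen Z W" "regular W (E p)" "gen_eq Z (\<lambda>q. D p q / f q) (E p)"
        "\<exists>q\<in>W \<inter> C. E p q \<noteq> 0"
      unfolding restricts_to_def by (elim exE conjE) (rule that)
    have "\<forall>\<^sub>F x in gen Z. h x \<noteq> 0"
      using h unfolding nonzero_ratfun_iff by blast
    moreover have "\<forall>\<^sub>F x in gen Z. D p x / f x = E p x"
      using W(3) unfolding gen_eq_iff .
    moreover have "p \<in> Z" using p C by blast
    note D[OF this]
    ultimately have "\<forall>\<^sub>F x in gen Z. D' p x / (f x * h x) = E p x"
      by eventually_elim simp
    then show ?thesis
      unfolding restricts_to_def gen_eq_iff
      by (intro exI[of _ W] conjI W)
  qed
  then show ?thesis
    by (intro exI[of _ "\<lambda>q. f q * h q"] exI[of _ E] conjI ballI nonzero_ratfun_mult f(1) h z)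
qed

lemma linear_equiv_imp_num_equiv:
  assumes h: "nonzero_ratfun Z h"
    and D: "\<And>p. p \<in> Z \<Longrightarrow> \<forall>\<^sub>F x in gen Z. D' p x = D p x * h x"
  shows "num_equiv Z D D'"
  unfolding num_equiv_def
proof (intro allI impI)
  fix C assume "projective_variety C \<and> has_dim C 1 \<and> C \<subseteq> Z"
  then have C: "C \<subseteq> Z" by blast
  have D': "\<forall>\<^sub>F x in gen Z. D p x = D' p x * inverse (h x)" if "p \<in> Z" for p
  proof -
    have "\<forall>\<^sub>F x in gen Z. h x \<noteq> 0"
      using h unfolding nonzero_ratfun_iff by blast
    with D[OF that] show ?thesis
      by eventually_elim simp
  qed
  show "intersection_number Z D C = intersection_number Z D' C"
    unfolding intersection_number_def
    by (intro arg_cong[where f = The] ext iffI)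
      (rule intersection_number_mult[OF h D C], assumption+,
       rule intersection_number_mult[OF nonzero_ratfun_inverse[OF h] D' C], assumption+)
qed

text \<open>
  \<open>\<Phi>\<close> is the linear functional of the supporting hyperplane, applied to classes of divisors.  It
  carries all information about \<open>N\<^sup>1\<close> and the pseudoeffective cone that enters the proof of the
  bound on orders.
\<close>

lemma facet_functional:
  assumes "facet_of_pseff Z F"
  obtains \<Phi> :: "('k, 'n) family \<Rightarrow> real" where
    "\<forall>D D'. cartier Z D \<longrightarrow> cartier Z D' \<longrightarrow> \<Phi> (\<lambda>p x. D p x * D' p x) = \<Phi> D + \<Phi> D'"
    "\<forall>D D'. cartier Z D \<longrightarrow> cartier Z D' \<longrightarrow> num_equiv Z D D' \<longrightarrow> \<Phi> D = \<Phi> D'"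
    "\<forall>D. effective Z D \<longrightarrow> 0 \<le> \<Phi> D"
    "\<forall>D. effective Z D \<longrightarrow> (\<Phi> D = 0 \<longleftrightarrow> num_class Z D \<in> F)"
proof -
  obtain \<phi> :: "((('k, 'n) family \<Rightarrow> real) \<Rightarrow> real) \<Rightarrow> real" where lin: "linear \<phi>"
    and nonneg: "\<forall>x\<in>pseudoeffective_cone Z. 0 \<le> \<phi> x"
    and F: "F = {x\<in>pseudoeffective_cone Z. \<phi> x = 0}"
    using assms unfolding facet_of_pseff_def by (elim exE conjE) (rule that)
  have add: "num_class Z (\<lambda>p x. D p x * D' p x) = num_class Z D + num_class Z D'"
    if "cartier Z D" "cartier Z D'" for D D'
    using that by (auto simp: num_class_def num_functionals_def fun_eq_iff)
  have eq: "num_class Z D = num_class Z D'" if "cartier Z D" "cartier Z D'" "num_equiv Z D D'" for D D'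
    using that by (auto simp: num_class_def num_functionals_def fun_eq_iff)
  have eff: "num_class Z D \<in> pseudoeffective_cone Z" if "effective Z D" for D
    unfolding pseudoeffective_cone_def
    by (rule subsetD[OF closure_subset], rule hull_inc) (use that in blast)
  show ?thesis
    by (rule that[of "\<lambda>D. \<phi> (num_class Z D)"])
      (use add eq eff nonneg F linear_add[OF lin] in auto)
qed

lemma functional_prod:
  fixes \<Phi> :: "('k, 'n) family \<Rightarrow> real" and \<eta> :: "'a \<Rightarrow> ('k, 'n) family"
  assumes add: "\<forall>D D'. cartier Z D \<longrightarrow> cartier Z D' \<longrightarrow> \<Phi> (\<lambda>p x. D p x * D' p x) = \<Phi> D + \<Phi> D'"
    and "finite A" "\<And>Q. Q \<in> A \<Longrightarrow> cartier Z (\<eta> Q)"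
  shows "cartier Z (\<lambda>p x. \<Prod>Q\<in>A. \<eta> Q p x ^ m Q) \<and>
    \<Phi> (\<lambda>p x. \<Prod>Q\<in>A. \<eta> Q p x ^ m Q) = (\<Sum>Q\<in>A. real (m Q) * \<Phi> (\<eta> Q))"
  using assms(2,3)
proof (induction A rule: finite_induct)
  case empty
  have "\<Phi> (\<lambda>p x. 1) = \<Phi> (\<lambda>p x. 1) + \<Phi> (\<lambda>p x. 1)"
    using add cartier_const[of 1] by fastforce
  then show ?case by (simp add: cartier_const)
next
  case (insert Q A)
  have pow: "cartier Z (\<lambda>p x. \<eta> Q p x ^ k) \<and> \<Phi> (\<lambda>p x. \<eta> Q p x ^ k) = real k * \<Phi> (\<eta> Q)" for k
  proof (induction k)
    case 0
    have "\<Phi> (\<lambda>p x. 1) = \<Phi> (\<lambda>p x. 1) + \<Phi> (\<lambda>p x. 1)"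
      using add cartier_const[of 1] by fastforce
    then show ?case by (simp add: cartier_const)
  next
    case (Suc k)
    have "cartier Z (\<eta> Q)" using insert.prems by simp
    then show ?case
      using Suc add[rule_format, of "\<eta> Q" "\<lambda>p x. \<eta> Q p x ^ k"] cartier_mult[of "\<eta> Q" "\<lambda>p x. \<eta> Q p x ^ k"]
      by (simp add: distrib_right)
  qed
  let ?D = "\<lambda>p x. \<Prod>Q\<in>A. \<eta> Q p x ^ m Q"
  have "cartier Z ?D \<and> \<Phi> ?D = (\<Sum>Q\<in>A. real (m Q) * \<Phi> (\<eta> Q))"
    using insert by simp
  then show ?case
    using insert.hyps pow[of "m Q"] add[rule_format, of "\<lambda>p x. \<eta> Q p x ^ m Q" ?D]
      cartier_mult[of "\<lambda>p x. \<eta> Q p x ^ m Q" ?D]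
    by simp
qed

lemma prime_divisor_hypersurface:
  assumes "prime_divisor Z Q \<eta>"
  shows "hypersurface Z Q"
proof
  show "projective_variety Q" "Q \<subseteq> Z"
    using assms unfolding prime_divisor_def by blast+
  show "Q \<noteq> Z"
    using assms unfolding prime_divisor_def has_dim_def by blast
qed

lemma prime_divisor_equation:
  assumes "prime_divisor Z Q \<eta>" "p \<in> Z"
  shows "\<forall>\<^sub>F q in nb Z p. equation_at Z Q q (\<eta> p)"
proof -
  interpret Q: hypersurface Z Q
    by (rule prime_divisor_hypersurface[OF assms(1)])
  obtain W where W: "p \<in> W" "local_equation Z Q W (\<eta> p)"
    using assms unfolding prime_divisor_def by blast
  have "zopen Z W" using W(2) unfolding local_equation_def by blast
  from eventually_nb_open[OF this W(1)] show ?thesis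
    by (rule eventually_mono) (rule local_equation_at[OF Q.closed W(2)])
qed

lemma prime_divisor_equation_at: "prime_divisor Z Q \<eta> \<Longrightarrow> p \<in> Z \<Longrightarrow> equation_at Z Q p (\<eta> p)"
  by (rule eventually_nb_point[OF prime_divisor_equation])

lemma prime_divisor_effective:
  assumes \<eta>: "prime_divisor Z Q \<eta>"
  shows "cartier Z \<eta>" "effective Z \<eta>"
proof -
  interpret Q: hypersurface Z Q
    by (rule prime_divisor_hypersurface[OF assms(1)])
  note eq = prime_divisor_equation_at[OF \<eta>]
  have "nonzero_ratfun Z (\<eta> p)" if "p \<in> Z" for p
    unfolding nonzero_ratfun_iff
    using Q.equation_reg_at[OF eq[OF that]] Q.equation_nonzero[OF eq[OF that]] by (intro conjI exI)
  moreover have "\<forall>\<^sub>F q in nb Z p. unit_in_stalk Z q (\<lambda>x. \<eta> p x / \<eta> q x)" if "p \<in> Z" for p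
    using prime_divisor_equation[OF \<eta> that]
  proof (rule eventually_mono)
    fix q assume q: "equation_at Z Q q (\<eta> p)"
    then have "q \<in> Z" using Q.equation_reg_at reg_at_in by blast
    then show "unit_in_stalk Z q (\<lambda>x. \<eta> p x / \<eta> q x)"
      by (intro equation_quotient_unit[OF q eq] Q.equation_nonzero[OF eq])
  qed
  ultimately show "cartier Z \<eta>" unfolding cartier_iff by blast
  moreover have "in_stalk Z p (\<eta> p)" if "p \<in> Z" for p
    unfolding in_stalk_iff using Q.equation_reg_at[OF eq[OF that]]
    by (intro exI[of _ "\<eta> p"] conjI always_eventually) auto
  ultimately show "effective Z \<eta>" unfolding effective_def by blast
qed

end

text \<open>The quotient of \<open>s p\<close> and \<open>s q\<close> is \<open>h p q\<close>, with the inverse \<open>h q p\<close>.\<close>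

lemma (in covered_variety) section_cartier:
  assumes h: "regular_transitions Z U h" and s: "s \<in> sections_on Z U h" "s \<noteq> 0"
  shows "cartier Z s"
  unfolding cartier_iff
proof (intro ballI conjI)
  note sr = sections_onD(1)[OF s(1)]
  fix p assume p: "p \<in> Z"
  show "nonzero_ratfun Z (s p)"
    unfolding nonzero_ratfun_iff
    using families_reg_at[OF sr p cover(2)[OF p] p] section_nonzero[OF s p] by (intro conjI exI)
  show "\<forall>\<^sub>F q in nb Z p. unit_in_stalk Z q (\<lambda>x. s p x / s q x)"
  proof (rule eventually_mono[OF eventually_nb_open[OF cover(1)[OF p]]])
    show "p \<in> U p \<inter> Z" using cover(2) p by blast
    fix q assume q: "q \<in> U p \<inter> Z"
    then have qZ: "q \<in> Z" by blast
    have o: "q \<in> U p \<inter> U q \<inter> Z" "q \<in> U q \<inter> U p \<inter> Z" using q cover(2) by blast+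
    have "regular (U p \<inter> U q \<inter> Z) (h p q)" "regular (U q \<inter> U p \<inter> Z) (h q p)"
      using h p qZ unfolding regular_transitions_def by simp_all
    then have r: "reg_at Z q (h p q)" "reg_at Z q (h q p)"
      using reg_at_regular[OF overlap[OF p qZ] _ o(1)] reg_at_regular[OF overlap[OF qZ p] _ o(2)]
      by simp_all
    have ev: "\<forall>\<^sub>F x in gen Z. s p x = h p q x * s q x \<and> s q x = h q p x * s p x"
      using eventually_gen_open[OF overlap[OF p qZ] overlap_nonempty[OF p qZ]]
    proof eventually_elim
      case (elim x)
      then show ?case
        by (intro conjI sections_onD(2)[OF s(1)] p qZ) auto
    qed
    have "\<forall>\<^sub>F x in gen Z. 1 * s q x = (h q p x * h p q x) * s q x"
      using ev by eventually_elim (metis mult.assoc mult_1)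
    then have "\<forall>\<^sub>F x in nb Z q. 1 = h q p x * h p q x"
      by (rule reg_at_cancel[OF reg_at_const[OF qZ] reg_at_mult[OF r(2,1)] section_nonzero[OF s qZ]])
    then have "1 = h q p q * h p q q"
      by (rule eventually_nb_point[OF _ qZ])
    then have "h p q q \<noteq> 0" by auto
    moreover have "\<forall>\<^sub>F x in gen Z. s p x / s q x = h p q x"
      using ev section_nonzero[OF s qZ]
      by eventually_elim (metis nonzero_mult_div_cancel_right)
    ultimately show "unit_in_stalk Z q (\<lambda>x. s p x / s q x)"
      by (rule unit_in_stalkI[OF r(1)])
  qed
qed

lemma (in covered_variety) sections_num_equiv:
  assumes s: "s \<in> sections_on Z U h" "s \<noteq> 0" and t: "t \<in> sections_on Z U h" "t \<noteq> 0"
  shows "num_equiv Z s t"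
proof -
  obtain q where q: "q \<in> Z" using nonempty by blast
  have rat: "nonzero_ratfun Z (u q)" if "u \<in> sections_on Z U h" "u \<noteq> 0" for u
    unfolding nonzero_ratfun_iff
    using families_reg_at[OF sections_onD(1)[OF that(1)] q cover(2)[OF q] q] section_nonzero[OF that q]
    by (intro conjI exI)
  show ?thesis
  proof (rule linear_equiv_imp_num_equiv[OF nonzero_ratfun_divide[OF rat[OF t] rat[OF s]]])
    fix p assume p: "p \<in> Z"
    show "\<forall>\<^sub>F x in gen Z. t p x = s p x * (t q x / s q x)"
      using eventually_gen_open[OF overlap[OF p q] overlap_nonempty[OF p q]] section_nonzero[OF s q]
    proof eventually_elim
      case (elim x)
      then show ?case
        using sections_onD(2)[OF s(1) p q, of x] sections_onD(2)[OF t(1) p q, of x] by simp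
    qed
  qed
qed

text \<open>
  Let \<open>\<Phi>\<close> be the functional of the facet that contains the classes of the components in
  \<open>\<E>\<close>, so that \<open>\<Phi> P > 0\<close>, and \<open>\<Phi> E = 0\<close> for \<open>E \<in> \<E>\<close>.  If \<open>t\<close> vanishes to order \<open>n\<close> along \<open>P\<close>,
  then the divisor of \<open>t\<close> contains \<open>n P\<close> and the fixed components in \<open>\<B>\<close>, hence their sum, and
  comparing it with the linearly equivalent maximal divisor gives \<open>n \<Phi> P \<le> m P \<Phi> P\<close>.  So \<open>M\<close> is
  the multiplicity \<open>m P\<close> of \<open>P\<close> in the maximal divisor.
\<close>

lemma (in divisor_step) maximal_bound:
  assumes h: "regular_transitions Z U h" and S: "S \<subseteq> sections_on Z U h"
    and max: "maximal_in Z P S s"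
  obtains M where "s \<in> S" "s \<noteq> 0" "divisible M s"
    "\<forall>t\<in>S. t \<noteq> 0 \<longrightarrow> (\<forall>n. divisible n t \<longrightarrow> n \<le> M)"
proof -
  obtain \<eta> m \<B> \<E> F where fin: "finite \<B>" "finite \<E>" and disj: "\<B> \<inter> \<E> = {}" "P \<notin> \<B> \<union> \<E>"
    and prime: "\<forall>Q\<in>insert P (\<B> \<union> \<E>). prime_divisor Z Q (\<eta> Q)"
    and unit: "\<forall>p\<in>Z. unit_in_stalk Z p (\<lambda>x. s p x / (\<Prod>Q\<in>insert P (\<B> \<union> \<E>). \<eta> Q p x ^ m Q))"
    and base: "\<forall>Q\<in>\<B>. \<forall>t\<in>S. \<forall>p\<in>Z. in_stalk Z p (\<lambda>x. t p x / \<eta> Q p x ^ m Q)"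
    and facet: "facet_of_pseff Z F" "num_class Z (\<eta> P) \<notin> F" "\<forall>Q\<in>\<E>. num_class Z (\<eta> Q) \<in> F"
    and sS: "s \<in> S"
    using max unfolding maximal_in_def by (elim exE conjE) (rule that)
  obtain \<Phi> :: "('k, 'n) family \<Rightarrow> real" where
    add: "\<forall>D D'. cartier Z D \<longrightarrow> cartier Z D' \<longrightarrow> \<Phi> (\<lambda>p x. D p x * D' p x) = \<Phi> D + \<Phi> D'"
    and equiv: "\<forall>D D'. cartier Z D \<longrightarrow> cartier Z D' \<longrightarrow> num_equiv Z D D' \<longrightarrow> \<Phi> D = \<Phi> D'"
    and nonneg: "\<forall>D. effective Z D \<longrightarrow> 0 \<le> \<Phi> D"
    and zero: "\<forall>D. effective Z D \<longrightarrow> (\<Phi> D = 0 \<longleftrightarrow> num_class Z D \<in> F)"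
    using facet_functional[OF facet(1)] .
  have gen_eq: "\<Phi> D = \<Phi> D'" if "cartier Z D" "cartier Z D'"
    and "\<And>p. p \<in> Z \<Longrightarrow> \<forall>\<^sub>F x in gen Z. D' p x = D p x" for D D'
  proof -
    have "nonzero_ratfun Z (\<lambda>_. 1)"
      using cartier_const[of 1] nonempty unfolding cartier_iff by auto
    then have "num_equiv Z D D'"
      by (rule linear_equiv_imp_num_equiv) (use that(3) in simp)
    with equiv that(1,2) show ?thesis by blast
  qed
  have one: "\<Phi> (\<lambda>p x. 1) = 0"
    using functional_prod[OF add, of "{}" undefined] by simp
  define A where "A = insert P (\<B> \<union> \<E>)"
  have A: "finite A" "\<And>Q. Q \<in> A \<Longrightarrow> prime_divisor Z Q (\<eta> Q)"
    using fin prime unfolding A_def by auto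
  note cart = prime_divisor_effective(1)[OF A(2)] and eff = prime_divisor_effective(2)[OF A(2)]
  note eq = prime_divisor_equation_at[OF A(2)]
  have PA: "P \<in> A" unfolding A_def by simp
  have \<Phi>P: "0 < \<Phi> (\<eta> P)"
    using nonneg zero eff[OF PA] facet(2) by (metis order_le_less)
  have \<Phi>E: "\<Phi> (\<eta> Q) = 0" if "Q \<in> \<E>" for Q
    using zero facet(3) eff[of Q] that unfolding A_def by blast
  define D where "D = (\<lambda>p x. \<Prod>Q\<in>A. \<eta> Q p x ^ m Q)"
  have D: "cartier Z D" "\<Phi> D = real (m P) * \<Phi> (\<eta> P) + (\<Sum>Q\<in>\<B>. real (m Q) * \<Phi> (\<eta> Q))"
  proof -
    have "cartier Z D \<and> \<Phi> D = (\<Sum>Q\<in>A. real (m Q) * \<Phi> (\<eta> Q))"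
      unfolding D_def by (rule functional_prod[OF add A(1) cart])
    moreover have "(\<Sum>Q\<in>A. real (m Q) * \<Phi> (\<eta> Q)) =
        real (m P) * \<Phi> (\<eta> P) + (\<Sum>Q\<in>\<B>. real (m Q) * \<Phi> (\<eta> Q))"
      unfolding A_def using fin disj by (simp add: sum.union_disjoint \<Phi>E)
    ultimately show "cartier Z D" "\<Phi> D = real (m P) * \<Phi> (\<eta> P) + (\<Sum>Q\<in>\<B>. real (m Q) * \<Phi> (\<eta> Q))"
      by auto
  qed
  have unit': "unit_in_stalk Z p (\<lambda>x. s p x / D p x)" if "p \<in> Z" for p
    using unit that unfolding D_def A_def by blast
  have D_nonzero: "\<forall>\<^sub>F x in gen Z. D p x \<noteq> 0" if "p \<in> Z" for p
    by (rule cartier_nonzero[OF D(1) that])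
  have s_nonzero: "s \<noteq> 0"
  proof
    assume s0: "s = 0"
    obtain p where p: "p \<in> Z" using nonempty by blast
    obtain u where u: "reg_at Z p u" "u p \<noteq> 0" "\<forall>\<^sub>F x in gen Z. s p x / D p x = u x"
      using unit'[OF p] by (rule unit_in_stalkE)
    have "\<forall>\<^sub>F x in gen Z. u x \<noteq> 0"
      using gen_if_nb[OF reg_at_nonzero[OF u(1,2)] p] .
    moreover have "\<forall>\<^sub>F x in gen Z. u x = 0"
      using u(3) by eventually_elim (simp add: s0)
    ultimately show False using not_gen_zero_nonzero by blast
  qed
  have sec: "s \<in> sections_on Z U h" using sS S by blast
  have s_cart: "cartier Z s" by (rule section_cartier[OF h sec s_nonzero])
  \<comment> \<open>\<open>s\<close> and \<open>D\<close> differ by a unit \<open>u\<close>.  Both \<open>u\<close> and its inverse \<open>v\<close> are effective, and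
    \<open>\<Phi> u + \<Phi> v = 0\<close>.\<close>
  have \<Phi>s: "\<Phi> s = \<Phi> D"
  proof -
    let ?u = "\<lambda>p x. s p x / D p x" and ?v = "\<lambda>p x. inverse (s p x / D p x)"
    have u: "cartier Z ?u" by (rule cartier_divide[OF s_cart D(1)])
    have v: "cartier Z ?v" by (rule cartier_inverse[OF u])
    have "effective Z ?u"
      unfolding effective_def using u unit_in_stalk_imp_in_stalk[OF unit'] by simp
    moreover have "effective Z ?v"
      unfolding effective_def using v unit_in_stalk_imp_in_stalk[OF unit_in_stalk_inverse[OF unit']] by simp
    ultimately have "0 \<le> \<Phi> ?u" "0 \<le> \<Phi> ?v"
      using nonneg by simp_all
    moreover have "\<Phi> ?u + \<Phi> ?v = 0"
    proof -
      have "\<Phi> (\<lambda>p x. 1) = \<Phi> (\<lambda>p x. ?u p x * ?v p x)"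
      proof (rule gen_eq[OF cartier_const cartier_mult[OF u v]])
        fix p assume "p \<in> Z"
        from cartier_nonzero[OF u this] show "\<forall>\<^sub>F x in gen Z. ?u p x * ?v p x = 1"
          by eventually_elim (simp add: field_simps)
      qed simp
      moreover have "\<Phi> (\<lambda>p x. ?u p x * ?v p x) = \<Phi> ?u + \<Phi> ?v"
        using add u v by blast
      ultimately show ?thesis using one by linarith
    qed
    ultimately have "\<Phi> ?u = 0" by linarith
    moreover have "\<Phi> s = \<Phi> (\<lambda>p x. ?u p x * D p x)"
    proof (rule gen_eq[OF s_cart cartier_mult[OF u D(1)]])
      fix p assume "p \<in> Z"
      from D_nonzero[OF this] show "\<forall>\<^sub>F x in gen Z. ?u p x * D p x = s p x"
        by eventually_elim simp
    qed
    moreover have "\<Phi> (\<lambda>p x. ?u p x * D p x) = \<Phi> ?u + \<Phi> D"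
      using add u D(1) by blast
    ultimately show ?thesis by linarith
  qed
  have bound: "n \<le> m P" if t: "t \<in> S" "t \<noteq> 0" and n: "divisible n t" for t n
  proof -
    have tsec: "t \<in> sections_on Z U h" using t S by blast
    note tr = sections_onD(1)[OF tsec]
    have t_cart: "cartier Z t" by (rule section_cartier[OF h tsec t(2)])
    \<comment> \<open>\<open>D'\<close> is the divisor \<open>n P + \<Sum> m B B\<close>, over \<open>B \<in> \<B>\<close>, which \<open>t\<close> contains.\<close>
    define A' where "A' = insert P \<B>"
    define m' where "m' = m(P := n)"
    define D' where "D' = (\<lambda>p x. \<Prod>Q\<in>A'. \<eta> Q p x ^ m' Q)"
    have A': "finite A'" "A' \<subseteq> A" unfolding A'_def A_def using fin by auto
    have "cartier Z D' \<and> \<Phi> D' = (\<Sum>Q\<in>A'. real (m' Q) * \<Phi> (\<eta> Q))"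
      unfolding D'_def by (rule functional_prod[OF add A'(1) cart]) (use A' in blast)
    moreover have "(\<Sum>Q\<in>\<B>. real (m' Q) * \<Phi> (\<eta> Q)) = (\<Sum>Q\<in>\<B>. real (m Q) * \<Phi> (\<eta> Q))"
      by (rule sum.cong) (use disj in \<open>auto simp: m'_def\<close>)
    ultimately have D': "cartier Z D'" "\<Phi> D' = real n * \<Phi> (\<eta> P) + (\<Sum>Q\<in>\<B>. real (m Q) * \<Phi> (\<eta> Q))"
      using fin disj unfolding A'_def by (auto simp: m'_def)
    have "dvd_at Z p (D' p) (t p)" if p: "p \<in> Z" for p
      unfolding D'_def
    proof (rule dvd_at_prod_equations[OF variety_axioms families_reg_at[OF tr p cover(2)[OF p] p] A'(1)])
      fix Q assume Q: "Q \<in> A'"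
      then have QA: "Q \<in> A" using A' by blast
      show "hypersurface Z Q" by (rule prime_divisor_hypersurface[OF A(2)[OF QA]])
      then interpret Q: hypersurface Z Q .
      show e: "equation_at Z Q p (\<eta> Q p)" by (rule eq[OF QA p])
      show "dvd_at Z p (\<lambda>x. \<eta> Q p x ^ m' Q) (t p)"
      proof (cases "Q = P")
        case True
        obtain t' where t': "t' \<in> regular_families Z U" "family_mult t' (family_power y n) = t"
          using n unfolding divisible_def by blast
        have "dvd_at Z p (\<lambda>x. \<eta> P p x ^ n) (\<lambda>x. y p x ^ n)"
          using e y_equation[OF p cover(2)[OF p] p] unfolding True by (intro dvd_at_power equation_dvd)
        moreover have "dvd_at Z p (\<lambda>x. y p x ^ n) (t p)"
          by (rule dvd_atI[OF families_reg_at[OF t'(1) p cover(2)[OF p] p]])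
            (simp add: t'(2)[symmetric] family_mult_def family_power_def)
        ultimately show ?thesis
          using dvd_at_trans by (simp add: True m'_def)
      next
        case False
        then have "Q \<in> \<B>" using Q unfolding A'_def by blast
        then have "in_stalk Z p (\<lambda>x. t p x / \<eta> Q p x ^ m Q)"
          using base t(1) p by blast
        then show ?thesis
          using in_stalk_quotient[OF families_reg_at[OF tr p cover(2)[OF p] p]
              reg_at_power[OF Q.equation_reg_at[OF e]] Q.equation_nonzero_power[OF e]] False
          by (simp add: m'_def)
      qed
    qed
    moreover have "reg_at Z p (D' p)" if "p \<in> Z" for p
      unfolding D'_def by (intro reg_at_prod A' that reg_at_power) 
        (use eq[OF _ that] A' in \<open>auto simp: equation_at_def\<close>)
    ultimately have "in_stalk Z p (\<lambda>x. t p x / D' p x)" if "p \<in> Z" for p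
      using in_stalk_quotient[OF families_reg_at[OF tr that cover(2)[OF that] that] _ cartier_nonzero[OF D'(1) that]]
        that by blast
    moreover have R: "cartier Z (\<lambda>p x. t p x / D' p x)"
      by (rule cartier_divide[OF t_cart D'(1)])
    ultimately have "0 \<le> \<Phi> (\<lambda>p x. t p x / D' p x)"
      using nonneg unfolding effective_def by blast
    moreover have "\<Phi> t = \<Phi> (\<lambda>p x. t p x / D' p x * D' p x)"
    proof (rule gen_eq[OF t_cart cartier_mult[OF R D'(1)]])
      fix p assume "p \<in> Z"
      from cartier_nonzero[OF D'(1) this] show "\<forall>\<^sub>F x in gen Z. t p x / D' p x * D' p x = t p x"
        by eventually_elim simp
    qed
    moreover have "\<Phi> s = \<Phi> t"
      using equiv s_cart t_cart sections_num_equiv[OF sec s_nonzero tsec t(2)] by blast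
    moreover have "\<Phi> (\<lambda>p x. t p x / D' p x * D' p x) = \<Phi> (\<lambda>p x. t p x / D' p x) + \<Phi> D'"
      using add R D'(1) by blast
    ultimately have "real n * \<Phi> (\<eta> P) \<le> real (m P) * \<Phi> (\<eta> P)"
      using D'(2) D(2) \<Phi>s by linarith
    then show ?thesis using \<Phi>P by simp
  qed
  have "divisible (m P) s"
  proof -
    obtain p where p: "p \<in> P" using P.nonempty by blast
    then have pZ: "p \<in> Z" using subset by blast
    note sr = families_reg_at[OF sections_onD(1)[OF sec] pZ cover(2)[OF pZ] pZ]
    have reg: "reg_at Z p (\<eta> Q p)" if "Q \<in> A" for Q
      using eq[OF that pZ] unfolding equation_at_def by blast
    have "reg_at Z p (D p)"
      unfolding D_def by (intro reg_at_prod A pZ reg_at_power reg)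
    then have "dvd_at Z p (D p) (s p)"
      using in_stalk_quotient[OF sr _ D_nonzero[OF pZ]] unit_in_stalk_imp_in_stalk[OF unit'[OF pZ]] by blast
    moreover have "dvd_at Z p (\<lambda>x. \<eta> P p x ^ m P) (D p)"
    proof (rule dvd_atI)
      show "reg_at Z p (\<lambda>x. \<Prod>Q\<in>A - {P}. \<eta> Q p x ^ m Q)"
        using A(1) by (intro reg_at_prod pZ reg_at_power reg) auto
      show "D p x = (\<Prod>Q\<in>A - {P}. \<eta> Q p x ^ m Q) * \<eta> P p x ^ m P" for x
        unfolding D_def using prod.remove[OF A(1) PA, of "\<lambda>Q. \<eta> Q p x ^ m Q"] by (simp add: mult.commute)
    qed
    moreover have "dvd_at Z p (\<lambda>x. y p x ^ m P) (\<lambda>x. \<eta> P p x ^ m P)"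
      by (intro dvd_at_power equation_dvd[OF y_equation[OF pZ cover(2)[OF pZ] pZ] eq[OF PA pZ]])
    ultimately have "dvd_at Z p (\<lambda>x. y p x ^ m P) (s p)"
      using dvd_at_trans by blast
    then show ?thesis
      using in_stalk_iff_divisible[OF h sec, of "m P"] in_stalk_iff_dvd[OF sections_onD(1)[OF sec] pZ] p by blast
  qed
  then show ?thesis
    by (rule that[OF sS s_nonzero]) (use bound in blast)
qed


section \<open>Valuations of sections along a flag\<close>

lemma regular_families_add:
  assumes "s \<in> regular_families Z U" "t \<in> regular_families Z U"
  shows "s + t \<in> regular_families Z U"
proof (rule regular_familiesI)
  fix p assume p: "p \<in> Z"
  show "regular (U p \<inter> Z) ((s + t) p)"
    using regular_add[OF regular_familiesD(1)[OF assms(1) p] regular_familiesD(1)[OF assms(2) p]]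
    by (simp add: plus_fun_def)
qed (simp add: regular_familiesD(2)[OF assms(1)] regular_familiesD(2)[OF assms(2)])

lemma regular_families_scale:
  assumes "s \<in> regular_families Z U"
  shows "scale_family c s \<in> regular_families Z U"
  unfolding scale_family_def
proof (rule regular_familiesI)
  fix p assume p: "p \<in> Z"
  show "regular (U p \<inter> Z) (\<lambda>q. c * s p q)"
    by (rule regular_mult[OF regular_const regular_familiesD(1)[OF assms p]])
qed (simp add: regular_familiesD(2)[OF assms])

lemma regular_families_zero: "0 \<in> regular_families Z U"
proof (rule regular_familiesI)
  fix p show "regular (U p \<inter> Z) (0 p)"
    using regular_const[of "U p \<inter> Z" 0] by (simp add: zero_fun_def)
qed simp

lemma subspace_sections_on: "module.subspace scale_family (sections_on Z U h)"
proof -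
  interpret module "scale_family :: 'a \<Rightarrow> ('a, 'b) family \<Rightarrow> _" by (rule module_scale_family)
  show ?thesis
  proof (rule subspaceI)
    show "0 \<in> sections_on Z U h"
      by (rule sections_onI[OF regular_families_zero]) simp
    fix s t assume st: "s \<in> sections_on Z U h" "t \<in> sections_on Z U h"
    show "s + t \<in> sections_on Z U h"
    proof (rule sections_onI[OF regular_families_add[OF st[THEN sections_onD(1)]]])
      fix p q x assume "p \<in> Z" "q \<in> Z" "x \<in> U p \<inter> U q \<inter> Z"
      then show "(s + t) p x = h p q x * (s + t) q x"
        using sections_onD(2)[OF st(1), of p q x] sections_onD(2)[OF st(2), of p q x]
        by (simp add: distrib_left)
    qed
  next
    fix c s assume s: "s \<in> sections_on Z U h"
    show "scale_family c s \<in> sections_on Z U h"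
    proof (rule sections_onI[OF regular_families_scale[OF s[THEN sections_onD(1)]]])
      fix p q x assume "p \<in> Z" "q \<in> Z" "x \<in> U p \<inter> U q \<inter> Z"
      then show "scale_family c s p x = h p q x * scale_family c s q x"
        using sections_onD(2)[OF s, of p q x] by (simp add: scale_family_def)
    qed
  qed
qed

lemma system_mult_sections:
  assumes "V \<subseteq> sections_on Z U h" "W \<subseteq> sections_on Z U h'"
  shows "system_mult V W \<subseteq> sections_on Z U (\<lambda>p q x. h p q x * h' p q x)"
  unfolding system_mult_def
  by (rule module.span_minimal[OF module_scale_family _ subspace_sections_on])
    (use assms sections_on_mult in blast)

lemma mult_in_system_mult: "s \<in> V \<Longrightarrow> t \<in> W \<Longrightarrow> family_mult s t \<in> system_mult V W"
  unfolding system_mult_def by (rule module.span_base[OF module_scale_family]) blast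

lemma system_mult_nonzero:
  assumes "f \<in> system_mult V W" "f \<noteq> 0"
  obtains s t where "s \<in> V" "t \<in> W" "s \<noteq> 0" "t \<noteq> 0"
proof -
  interpret module "scale_family :: 'a \<Rightarrow> ('a, 'b) family \<Rightarrow> _" by (rule module_scale_family)
  have "\<exists>s\<in>V. \<exists>t\<in>W. s \<noteq> 0 \<and> t \<noteq> 0"
  proof (rule ccontr)
    assume neg: "\<not> (\<exists>s\<in>V. \<exists>t\<in>W. s \<noteq> 0 \<and> t \<noteq> 0)"
    have "{family_mult s t | s t. s \<in> V \<and> t \<in> W} \<subseteq> {0}"
    proof clarify
      fix s t assume "s \<in> V" "t \<in> W"
      then have "s = 0 \<or> t = 0" using neg by blast
      then show "family_mult s t = 0" by (auto simp: family_mult_def fun_eq_iff)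
    qed
    then have "system_mult V W \<subseteq> {0}"
      unfolding system_mult_def by (rule span_minimal[OF _ subspace_single_0])
    then show False using assms by blast
  qed
  then show ?thesis using that by blast
qed

lemma family_mult_power_mult:
  "family_mult (family_mult s (family_power y m)) (family_mult t (family_power y n)) =
   family_mult (family_mult s t) (family_power y (m + n))"
  by (simp add: family_mult_def family_power_def power_add fun_eq_iff mult_ac)

lemma restricted_system_cong:
  "(\<And>j. 1 \<le> j \<Longrightarrow> j \<le> r \<Longrightarrow> a j = b j) \<Longrightarrow> restricted_system U Y y V a r = restricted_system U Y y V b r"
  by (induction r) simp_all

lemma nu_Suc: "nu U Y y (Suc r) f =
    (nu U Y y r f)(Suc r := ord_along (Y r) (Y (Suc r)) (y (Suc r)) (residual U Y y f r))"
  by (auto simp: nu_def fun_eq_iff le_Suc_eq)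

lemma nu_set_support: "a \<in> nu_set U Y y r V \<Longrightarrow> \<not> (1 \<le> j \<and> j \<le> r) \<Longrightarrow> a j = 0"
  by (auto simp: nu_set_def nu_def)

lemma nu_setI: "f \<in> V \<Longrightarrow> f \<noteq> 0 \<Longrightarrow> nu U Y y r f = a \<Longrightarrow> a \<in> nu_set U Y y r V"
  unfolding nu_set_def by (rule image_eqI[of _ _ f]) auto

locale flagged =
  fixes X :: "('k::field, 'n::finite) pspace set" and d :: nat
    and U :: "('k, 'n) pspace \<Rightarrow> ('k, 'n) pspace set"
    and Y :: "nat \<Rightarrow> ('k, 'n) pspace set" and y :: "nat \<Rightarrow> ('k, 'n) family"
  assumes neighbourhoods: "open_neighbourhoods X U" and flag: "flag X d U Y y"
begin

lemma Y_0: "Y 0 = X"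
  using flag unfolding flag_def by blast

lemma Y_Suc: "r < d \<Longrightarrow> Y (Suc r) \<subseteq> Y r"
  using flag unfolding flag_def by blast

lemma Y_subset: "r \<le> s \<Longrightarrow> s \<le> d \<Longrightarrow> Y s \<subseteq> Y r"
proof (induction s rule: dec_induct)
  case (step s)
  then show ?case using Y_Suc[of s] by simp
qed simp

lemma covered:
  assumes "r \<le> d"
  shows "covered_variety (Y r) U"
proof
  show "projective_variety (Y r)"
    using flag assms unfolding flag_def by blast
  have sub: "Y r \<subseteq> X" using Y_subset[of 0 r] assms Y_0 by simp
  fix p assume "p \<in> Y r"
  then have p: "zopen X (U p)" "p \<in> U p"
    using sub neighbourhoods unfolding open_neighbourhoods_def by blast+
  show "zopen (Y r) (U p \<inter> Y r)" by (rule zopen_restrict[OF p(1) sub])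
  show "p \<in> U p" by (rule p(2))
qed

lemma step:
  assumes r: "r < d"
  shows "divisor_step (Y r) (Y (Suc r)) U (y (Suc r))"
proof -
  interpret covered_variety "Y r" U by (rule covered) (use r in simp)
  show ?thesis
  proof
    show "projective_variety (Y (Suc r))" "Y (Suc r) \<subseteq> Y r"
      using flag r unfolding flag_def by auto
    have "has_dim (Y r) (Suc (d - Suc r))" "has_dim (Y (Suc r)) (d - Suc r)"
      using flag r unfolding flag_def by (auto simp: Suc_diff_Suc)
    then show "Y (Suc r) \<noteq> Y r" unfolding has_dim_def by auto
    show "local_equation (Y r) (Y (Suc r)) (U p \<inter> Y r) (y (Suc r) p)" if "p \<in> Y r" for p
      using flag r that unfolding flag_def by blast
  qed
qed

abbreviation "res V a r \<equiv> restricted_system U Y y V a r"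
abbreviation "Nu r V \<equiv> nu_set U Y y r V"
abbreviation "divis r n s \<equiv> divisor_step.divisible (Y r) U (y (Suc r)) n s"

definition bundle_system :: "('k, 'n) family set \<Rightarrow> bool" where
  "bundle_system V \<longleftrightarrow> (\<exists>h. regular_transitions X U h \<and> V \<subseteq> sections_on X U h)"

lemma bundle_system_mult:
  assumes "bundle_system V" "bundle_system W"
  shows "bundle_system (system_mult V W)"
proof -
  obtain h h' where "regular_transitions X U h" "V \<subseteq> sections_on X U h"
      "regular_transitions X U h'" "W \<subseteq> sections_on X U h'"
    using assms unfolding bundle_system_def by blast
  then show ?thesis
    unfolding bundle_system_def
    by (intro exI[of _ "\<lambda>p q x. h p q x * h' p q x"] conjI regular_transitions_mult system_mult_sections)
qed

lemma restricted_sections: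
  assumes V: "bundle_system V" and r: "r \<le> d"
  obtains h where "regular_transitions (Y r) U h" "res V a r \<subseteq> sections_on (Y r) U h"
proof -
  have "\<exists>h. regular_transitions (Y r) U h \<and> res V a r \<subseteq> sections_on (Y r) U h"
    using r
  proof (induction r)
    case 0
    then show ?case using V Y_0 unfolding bundle_system_def by simp
  next
    case (Suc r)
    interpret divisor_step "Y r" "Y (Suc r)" U "y (Suc r)" by (rule step) (use Suc.prems in simp)
    obtain h where h: "regular_transitions (Y r) U h" "res V a r \<subseteq> sections_on (Y r) U h"
      using Suc by auto
    obtain h' where h': "regular_transitions (Y r) U h'"
      "\<forall>t\<in>regular_families (Y r) U. family_mult t (family_power (y (Suc r)) (a (Suc r))) \<in> sections_on (Y r) U h \<longrightarrow>
        t \<in> sections_on (Y r) U h'"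
      using twisted_transitions[OF h(1)] .
    have "res V a (Suc r) \<subseteq> sections_on (Y (Suc r)) U h'"
      using h(2) h'(2) by (auto simp: system_minus_def intro!: restrict_sections)
    then show ?case using restrict_transitions[OF h'(1)] by blast
  qed
  then show ?thesis using that by blast
qed

text \<open>\<open>ord_along\<close> is the greatest exponent that satisfies a condition, and it has an arbitrary value
  if there is no greatest one.  So this boundedness along the first \<open>r\<close> divisors of the flag is
  what makes truncated valuations meaningful.  It will come from maximal divisors.\<close>

definition orders_bounded :: "('k, 'n) family set \<Rightarrow> nat \<Rightarrow> bool" where
  "orders_bounded V r \<longleftrightarrow> (\<forall>k<r. \<forall>a\<in>Nu k V. \<exists>M. \<forall>s\<in>res V a k. s \<noteq> 0 \<longrightarrow> (\<forall>n. divis k n s \<longrightarrow> n \<le> M))"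

lemma orders_boundedD:
  assumes "orders_bounded V r" "k < r" "a \<in> Nu k V"
  obtains M where "\<forall>s\<in>res V a k. s \<noteq> 0 \<longrightarrow> (\<forall>n. divis k n s \<longrightarrow> n \<le> M)"
  using assms unfolding orders_bounded_def by blast

lemma orders_bounded_Suc:
  "orders_bounded V (Suc r) \<longleftrightarrow> orders_bounded V r \<and>
    (\<forall>a\<in>Nu r V. \<exists>M. \<forall>s\<in>res V a r. s \<noteq> 0 \<longrightarrow> (\<forall>n. divis r n s \<longrightarrow> n \<le> M))"
  unfolding orders_bounded_def less_Suc_eq by auto

lemma ord_along_residual:
  assumes S: "bundle_system S" and r: "r < d" and b: "orders_bounded S (Suc r)"
    and a: "a \<in> Nu r S" and s: "s \<in> res S a r" "s \<noteq> 0"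
  obtains h h' t n where "regular_transitions (Y r) U h" "s \<in> sections_on (Y r) U h"
    "t \<in> sections_on (Y r) U h'" "family_mult t (family_power (y (Suc r)) n) = s"
    "restrict_family (Y (Suc r)) t \<noteq> 0" "ord_along (Y r) (Y (Suc r)) (y (Suc r)) s = n"
proof -
  interpret divisor_step "Y r" "Y (Suc r)" U "y (Suc r)" by (rule step[OF r])
  obtain h where h: "regular_transitions (Y r) U h" "res S a r \<subseteq> sections_on (Y r) U h"
    using restricted_sections[OF S less_imp_le[OF r]] .
  have sec: "s \<in> sections_on (Y r) U h" using s(1) h(2) by blast
  obtain M where M: "\<forall>s\<in>res S a r. s \<noteq> 0 \<longrightarrow> (\<forall>n. divisible n s \<longrightarrow> n \<le> M)"
    using orders_boundedD[OF b lessI a] .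
  have M': "divisible n s \<Longrightarrow> n \<le> M" for n using M s by blast
  obtain t n where t: "t \<in> regular_families (Y r) U" "family_mult t (family_power (y (Suc r)) n) = s"
      "restrict_family (Y (Suc r)) t \<noteq> 0"
    by (rule ord_along_exists[OF h(1) sec M'])
  obtain h' where h': "regular_transitions (Y r) U h'"
      "\<forall>t\<in>regular_families (Y r) U. family_mult t (family_power (y (Suc r)) n) \<in> sections_on (Y r) U h \<longrightarrow>
        t \<in> sections_on (Y r) U h'"
    using twisted_transitions[OF h(1)] .
  have "t \<in> sections_on (Y r) U h'"
    by (rule h'(2)[THEN bspec, OF t(1), THEN mp]) (unfold t(2), rule sec)
  from that[OF h(1) sec this t(2,3) ord_along_eqI(1)[OF h(1) sec t]] show ?thesis .
qed

lemma residual_step: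
  assumes V: "bundle_system V" and r: "r < d"
    and s: "s = residual U Y y f r" "s \<in> res V (nu U Y y r f) r"
    and t: "t \<in> regular_families (Y r) U" "family_mult t (family_power (y (Suc r)) n) = s"
      "restrict_family (Y (Suc r)) t \<noteq> 0"
  shows "residual U Y y f (Suc r) = restrict_family (Y (Suc r)) t"
    and "nu U Y y (Suc r) f = (nu U Y y r f)(Suc r := n)"
proof -
  interpret divisor_step "Y r" "Y (Suc r)" U "y (Suc r)" by (rule step[OF r])
  obtain h where h: "regular_transitions (Y r) U h" "res V (nu U Y y r f) r \<subseteq> sections_on (Y r) U h"
    using restricted_sections[OF V less_imp_le[OF r]] .
  have "s \<in> sections_on (Y r) U h" using s h by blast
  note * = ord_along_eqI[OF h(1) this t]
  show "residual U Y y f (Suc r) = restrict_family (Y (Suc r)) t"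
    "nu U Y y (Suc r) f = (nu U Y y r f)(Suc r := n)"
    using *(1,2) s(1) by (simp_all add: nu_Suc)
qed

lemma residual_in_restricted_system:
  assumes V: "bundle_system V" and f: "f \<in> V" "f \<noteq> 0"
  shows "orders_bounded V r \<Longrightarrow> r \<le> d \<Longrightarrow>
    residual U Y y f r \<in> res V (nu U Y y r f) r \<and> residual U Y y f r \<noteq> 0"
proof (induction r)
  case 0
  show ?case unfolding residual.simps restricted_system.simps using f by blast
next
  case (Suc r)
  then have r: "r < d" by simp
  interpret divisor_step "Y r" "Y (Suc r)" U "y (Suc r)" by (rule step[OF r])
  let ?s = "residual U Y y f r"
  have s: "?s \<in> res V (nu U Y y r f) r" "?s \<noteq> 0"
    using Suc.IH[OF orders_bounded_Suc[THEN iffD1, THEN conjunct1, OF Suc.prems(1)] less_imp_le[OF r]]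
    by (rule conjunct1, rule conjunct2)
  have "nu U Y y r f \<in> Nu r V" by (rule nu_setI[OF f refl])
  then obtain h' t n where t': "t \<in> sections_on (Y r) U h'"
      and t: "family_mult t (family_power (y (Suc r)) n) = ?s" "restrict_family (Y (Suc r)) t \<noteq> 0"
    by (rule ord_along_residual[OF V r Suc.prems(1) _ s])
  note tr = sections_onD(1)[OF t']
  note * = residual_step[OF V r refl s(1) tr t]
  have "res V (nu U Y y (Suc r) f) r = res V (nu U Y y r f) r"
    by (rule restricted_system_cong) (simp add: *(2))
  then have "restrict_family (Y (Suc r)) t \<in> res V (nu U Y y (Suc r) f) (Suc r)"
    using tr t(1) s(1) by (auto simp: system_minus_def *(2))
  then show ?case unfolding *(1) using t(2) by blast
qed

text \<open>An element \<open>s\<close> of the restricted system is the restriction of some \<open>t\<close>.  As \<open>s \<noteq> 0\<close>, the order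
  of \<open>t y\<^sup>a\<close> along the divisor is the exponent \<open>a\<close> and not larger, so \<open>s\<close> is the next residual
  section of any lift of \<open>t y\<^sup>a\<close>.\<close>

lemma restricted_system_lift:
  assumes V: "bundle_system V"
  shows "r \<le> d \<Longrightarrow> s \<in> res V a r \<Longrightarrow> s \<noteq> 0 \<Longrightarrow>
    \<exists>f\<in>V. f \<noteq> 0 \<and> residual U Y y f r = s \<and> (\<forall>j. 1 \<le> j \<and> j \<le> r \<longrightarrow> nu U Y y r f j = a j)"
proof (induction r arbitrary: s)
  case 0
  then show ?case by auto
next
  case (Suc r)
  then have r: "r < d" by simp
  interpret divisor_step "Y r" "Y (Suc r)" U "y (Suc r)" by (rule step[OF r])
  obtain t where t: "s = restrict_family (Y (Suc r)) t" "t \<in> regular_families (Y r) U"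
      "family_mult t (family_power (y (Suc r)) (a (Suc r))) \<in> res V a r"
    using Suc.prems(2) by (auto simp: system_minus_def)
  define s' where "s' = family_mult t (family_power (y (Suc r)) (a (Suc r)))"
  have s'_nz: "s' \<noteq> 0"
  proof
    assume z: "s' = 0"
    have "t = 0"
    proof (rule quotient_unique[OF t(2) regular_families_zero])
      fix p x
      show "t p x * y (Suc r) p x ^ a (Suc r) = 0 p x * y (Suc r) p x ^ a (Suc r)"
        using fun_cong[OF fun_cong[OF z, of p], of x] by (simp add: s'_def family_mult_def family_power_def)
    qed
    moreover have "restrict_family (Y (Suc r)) (0 :: ('k, 'n) family) = 0"
      by (simp add: restrict_family_def fun_eq_iff)
    ultimately show False using Suc.prems(3) unfolding t(1) by blast
  qed
  obtain f where f: "f \<in> V" "f \<noteq> 0" "residual U Y y f r = s'"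
      "\<forall>j. 1 \<le> j \<and> j \<le> r \<longrightarrow> nu U Y y r f j = a j"
    using Suc.IH[OF less_imp_le[OF r] t(3)[folded s'_def] s'_nz] by blast
  have "res V (nu U Y y r f) r = res V a r"
    by (rule restricted_system_cong) (use f(4) in simp)
  then have s': "s' \<in> res V (nu U Y y r f) r"
    using t(3) unfolding s'_def by simp
  have nz: "restrict_family (Y (Suc r)) t \<noteq> 0" using Suc.prems(3) unfolding t(1) .
  note * = residual_step[OF V r f(3)[symmetric] s' t(2) s'_def[symmetric] nz]
  have "nu U Y y (Suc r) f j = a j" if "1 \<le> j \<and> j \<le> Suc r" for j
    using that f(4) by (auto simp: *(2) le_Suc_eq)
  then show ?case
    using f(1,2) *(1) t(1) by blast
qed

lemma restricted_system_lift_exact: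
  assumes V: "bundle_system V" and r: "r \<le> d" and a: "a \<in> Nu r V" and s: "s \<in> res V a r" "s \<noteq> 0"
  obtains f where "f \<in> V" "f \<noteq> 0" "residual U Y y f r = s" "nu U Y y r f = a"
proof -
  obtain f where f: "f \<in> V" "f \<noteq> 0" "residual U Y y f r = s"
      "\<forall>j. 1 \<le> j \<and> j \<le> r \<longrightarrow> nu U Y y r f j = a j"
    using restricted_system_lift[OF V r s] by blast
  have "nu U Y y r f j = a j" for j
    using f(4) nu_set_support[OF a, of j] by (cases "1 \<le> j \<and> j \<le> r") (auto simp: nu_def)
  then show ?thesis using that f by blast
qed

text \<open>Residual sections are multiplicative because the product of two sections that do not vanish on
  an irreducible divisor does not vanish on it either.\<close>

lemma nu_mult:
  assumes V: "bundle_system V" and W: "bundle_system W"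
    and f: "f \<in> V" "f \<noteq> 0" and g: "g \<in> W" "g \<noteq> 0"
  shows "orders_bounded V r \<Longrightarrow> orders_bounded W r \<Longrightarrow> r \<le> d \<Longrightarrow>
    residual U Y y (family_mult f g) r = family_mult (residual U Y y f r) (residual U Y y g r) \<and>
    nu U Y y r (family_mult f g) = nu U Y y r f + nu U Y y r g"
proof (induction r)
  case 0
  show ?case by (simp add: nu_def fun_eq_iff)
next
  case (Suc r)
  then have r: "r < d" and b: "orders_bounded V r" "orders_bounded W r"
    unfolding orders_bounded_Suc by simp_all
  interpret divisor_step "Y r" "Y (Suc r)" U "y (Suc r)" by (rule step[OF r])
  have IH: "residual U Y y (family_mult f g) r = family_mult (residual U Y y f r) (residual U Y y g r)"
    "nu U Y y r (family_mult f g) = nu U Y y r f + nu U Y y r g"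
    using Suc.IH[OF b less_imp_le[OF r]] by (rule conjunct1, rule conjunct2)
  have ex: "\<exists>h h' t n. regular_transitions (Y r) U h \<and> residual U Y y f r \<in> sections_on (Y r) U h \<and>
      t \<in> sections_on (Y r) U h' \<and> family_mult t (family_power (y (Suc r)) n) = residual U Y y f r \<and>
      restrict_family (Y (Suc r)) t \<noteq> 0 \<and>
      residual U Y y f (Suc r) = restrict_family (Y (Suc r)) t \<and>
      nu U Y y (Suc r) f = (nu U Y y r f)(Suc r := n)"
    if V: "bundle_system V" and f: "f \<in> V" "f \<noteq> 0" and b: "orders_bounded V (Suc r)" for V f
  proof -
    let ?s = "residual U Y y f r"
    have s: "?s \<in> res V (nu U Y y r f) r" "?s \<noteq> 0"
      using residual_in_restricted_system[OF V f
          orders_bounded_Suc[THEN iffD1, THEN conjunct1, OF b] less_imp_le[OF r]]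
      by (rule conjunct1, rule conjunct2)
    have "nu U Y y r f \<in> Nu r V" by (rule nu_setI[OF f refl])
    then obtain h h' t n where t: "regular_transitions (Y r) U h" "?s \<in> sections_on (Y r) U h"
        "t \<in> sections_on (Y r) U h'" "family_mult t (family_power (y (Suc r)) n) = ?s"
        "restrict_family (Y (Suc r)) t \<noteq> 0"
      by (rule ord_along_residual[OF V r b _ s])
    show ?thesis
      by (rule exI[of _ h], rule exI[of _ h'], rule exI[of _ t], rule exI[of _ n])
        (intro conjI t residual_step[OF V r refl s(1) sections_onD(1)[OF t(3)] t(4,5)])
  qed
  obtain h1 h1' t1 n1 where 1: "regular_transitions (Y r) U h1" "residual U Y y f r \<in> sections_on (Y r) U h1"
      "t1 \<in> sections_on (Y r) U h1'" "family_mult t1 (family_power (y (Suc r)) n1) = residual U Y y f r"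
      "restrict_family (Y (Suc r)) t1 \<noteq> 0"
      "residual U Y y f (Suc r) = restrict_family (Y (Suc r)) t1"
      "nu U Y y (Suc r) f = (nu U Y y r f)(Suc r := n1)"
    using ex[OF V f Suc.prems(1)] by (elim exE conjE) (rule that)
  obtain h2 h2' t2 n2 where 2: "regular_transitions (Y r) U h2" "residual U Y y g r \<in> sections_on (Y r) U h2"
      "t2 \<in> sections_on (Y r) U h2'" "family_mult t2 (family_power (y (Suc r)) n2) = residual U Y y g r"
      "restrict_family (Y (Suc r)) t2 \<noteq> 0"
      "residual U Y y g (Suc r) = restrict_family (Y (Suc r)) t2"
      "nu U Y y (Suc r) g = (nu U Y y r g)(Suc r := n2)"
    using ex[OF W g Suc.prems(2)] by (elim exE conjE) (rule that)
  let ?t = "family_mult t1 t2"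
  have eq: "family_mult ?t (family_power (y (Suc r)) (n1 + n2)) = residual U Y y (family_mult f g) r"
    unfolding IH(1) 1(4)[symmetric] 2(4)[symmetric] family_mult_power_mult ..
  have "restrict_family (Y (Suc r)) ?t \<noteq> 0"
    unfolding restrict_mult
    by (rule P.section_mult_nonzero[OF restrict_sections[OF 1(3)] 1(5) restrict_sections[OF 2(3)] 2(5)])
  moreover have "residual U Y y (family_mult f g) r \<in> sections_on (Y r) U (\<lambda>p q x. h1 p q x * h2 p q x)"
    unfolding IH(1) by (rule sections_on_mult[OF 1(2) 2(2)])
  ultimately have *: "ord_along (Y r) (Y (Suc r)) (y (Suc r)) (residual U Y y (family_mult f g) r) = n1 + n2"
    "divide_out (Y r) U (y (Suc r)) (n1 + n2) (residual U Y y (family_mult f g) r) = ?t"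
    using ord_along_eqI(1,2)[OF regular_transitions_mult[OF 1(1) 2(1)] _
        regular_families_mult[OF sections_onD(1)[OF 1(3)] sections_onD(1)[OF 2(3)]] eq] by blast+
  have "residual U Y y (family_mult f g) (Suc r) = family_mult (residual U Y y f (Suc r)) (residual U Y y g (Suc r))"
    unfolding residual.simps(2)[of U Y y "family_mult f g"] * restrict_mult 1(6) 2(6) ..
  moreover have "nu U Y y (Suc r) (family_mult f g) = nu U Y y (Suc r) f + nu U Y y (Suc r) g"
    unfolding 1(7) 2(7) nu_Suc[of U Y y r "family_mult f g"] * IH(2) by (auto simp: fun_eq_iff)
  ultimately show ?case ..
qed

end


section \<open>Additivity of the values\<close>

context flagged
begin

lemma orders_bounded_if_maximal:
  assumes S: "bundle_system S" and r: "r < d" and b: "orders_bounded S r"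
    and max: "\<forall>a\<in>Nu r S. \<exists>s. maximal_in (Y r) (Y (Suc r)) (res S a r) s"
  shows "orders_bounded S (Suc r)"
proof -
  interpret divisor_step "Y r" "Y (Suc r)" U "y (Suc r)" by (rule step[OF r])
  have "\<exists>M. \<forall>s\<in>res S a r. s \<noteq> 0 \<longrightarrow> (\<forall>n. divisible n s \<longrightarrow> n \<le> M)" if a: "a \<in> Nu r S" for a
  proof -
    obtain s where s: "maximal_in (Y r) (Y (Suc r)) (res S a r) s"
      using max a by blast
    obtain h where h: "regular_transitions (Y r) U h" "res S a r \<subseteq> sections_on (Y r) U h"
      using restricted_sections[OF S less_imp_le[OF r]] .
    show ?thesis
      by (rule maximal_bound[OF h s]) (rule exI)
  qed
  then show ?thesis
    unfolding orders_bounded_Suc using b by blast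
qed

text \<open>As there is a section that does not vanish at the point of the flag, saturation implies that
  all orders below an attained one are attained.\<close>

lemma smaller_orders_attained:
  assumes S: "bundle_system S" and r: "r < d"
    and a: "a \<in> Nu r S" and u: "u \<in> res S a r" "\<forall>p\<in>Y d. u p p \<noteq> 0"
    and sat: "saturated (Y r) (Y (Suc r)) (y (Suc r)) (res S a r)"
    and s: "s \<in> res S a r" "s \<noteq> 0" and n: "n \<le> ord_along (Y r) (Y (Suc r)) (y (Suc r)) s"
  shows "a(Suc r := n) \<in> Nu (Suc r) S"
proof -
  interpret divisor_step "Y r" "Y (Suc r)" U "y (Suc r)" by (rule step[OF r])
  let ?ord = "ord_along (Y r) (Y (Suc r)) (y (Suc r))"
  obtain h where h: "regular_transitions (Y r) U h" "res S a r \<subseteq> sections_on (Y r) U h"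
    using restricted_sections[OF S less_imp_le[OF r]] .
  interpret D: covered_variety "Y d" U by (rule covered) simp
  obtain p where p: "p \<in> Y d" using D.nonempty by blast
  have pP: "p \<in> Y (Suc r)" using p Y_subset[of "Suc r" d] r by auto
  have up: "u p p \<noteq> 0" using u(2) p by blast
  have sec: "u \<in> sections_on (Y r) U h" using u(1) h(2) by blast
  have "restrict_family (Y (Suc r)) u p p = u p p"
    using pP by (simp add: restrict_family_def)
  then have "restrict_family (Y (Suc r)) u \<noteq> 0" using up by auto
  then have "?ord u = 0"
    by (intro ord_along_eqI(1)[OF h(1) sec sections_onD(1)[OF sec]])
      (simp_all add: family_mult_def family_power_def)
  moreover have "u \<noteq> 0" using up by auto
  moreover obtain lo hi where "?ord ` (res S a r - {0}) = {lo..hi}"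
    using sat unfolding saturated_def by blast
  ultimately have "0 \<in> {lo..hi}" "?ord s \<in> {lo..hi}"
    using u(1) s by (metis Diff_iff imageI singletonD, metis Diff_iff imageI singletonD)
  then have "n \<in> {lo..hi}" using n by simp
  then have "n \<in> ?ord ` (res S a r - {0})"
    using \<open>?ord ` (res S a r - {0}) = {lo..hi}\<close> by simp
  then obtain s' where s': "s' \<in> res S a r" "s' \<noteq> 0" "?ord s' = n" by blast
  obtain f where f: "f \<in> S" "f \<noteq> 0" "residual U Y y f r = s'" "nu U Y y r f = a"
    using restricted_system_lift_exact[OF S less_imp_le[OF r] a s'(1,2)] .
  have "nu U Y y (Suc r) f = a(Suc r := n)"
    unfolding nu_Suc f(3,4) s'(3) ..
  then show ?thesis
    by (rule nu_setI[OF f(1,2)])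
qed

lemma nu_set_0: "Nu 0 S = (if S \<subseteq> {0} then {} else {0})"
  by (auto simp: nu_set_def nu_def fun_eq_iff image_iff)

text \<open>Let \<open>f\<close> have the value \<open>c\<close> up to step \<open>r\<close> and the order \<open>n\<close> at the next step.  The maximal
  divisor of condition (ii) is the sum of the divisors of \<open>s\<close> and \<open>t\<close>, so \<open>n\<close> is at most the sum of
  the orders \<open>i\<close> of \<open>s\<close> and \<open>j\<close> of \<open>t\<close>.  Then \<open>n = k + (n - k)\<close> with \<open>k \<le> i\<close> and
  \<open>n - k \<le> j\<close>, and both summands are attained orders.  Boundedness is carried along in the
  induction since it is a premise of the additivity of values.\<close>

lemma nu_set_system_mult:
  assumes V: "bundle_system V" and W: "bundle_system W"
  shows "r \<le> d \<Longrightarrow> D_condition d U Y y V W r \<Longrightarrow>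
    Nu r (system_mult V W) = {a + b | a b. a \<in> Nu r V \<and> b \<in> Nu r W} \<and>
    orders_bounded V r \<and> orders_bounded W r \<and> orders_bounded (system_mult V W) r"
proof (induction r)
  case 0
  have X: "covered_variety X U" using covered[of 0] Y_0 by simp
  have "(\<exists>f\<in>system_mult V W. f \<noteq> 0) \<longleftrightarrow> (\<exists>s\<in>V. s \<noteq> 0) \<and> (\<exists>t\<in>W. t \<noteq> 0)"
  proof
    assume "\<exists>f\<in>system_mult V W. f \<noteq> 0"
    then obtain f where "f \<in> system_mult V W" "f \<noteq> 0" by blast
    then show "(\<exists>s\<in>V. s \<noteq> 0) \<and> (\<exists>t\<in>W. t \<noteq> 0)"
      by (rule system_mult_nonzero) blast
  next
    assume "(\<exists>s\<in>V. s \<noteq> 0) \<and> (\<exists>t\<in>W. t \<noteq> 0)"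
    then obtain s t where st: "s \<in> V" "s \<noteq> 0" "t \<in> W" "t \<noteq> 0" by blast
    then obtain h h' where "s \<in> sections_on X U h" "t \<in> sections_on X U h'"
      using V W unfolding bundle_system_def by blast
    then have "family_mult s t \<noteq> 0"
      using covered_variety.section_mult_nonzero[OF X _ st(2) _ st(4)] by blast
    then show "\<exists>f\<in>system_mult V W. f \<noteq> 0"
      using mult_in_system_mult[OF st(1,3)] by blast
  qed
  then have "Nu 0 (system_mult V W) = {a + b | a b. a \<in> Nu 0 V \<and> b \<in> Nu 0 W}"
    unfolding nu_set_0 by auto
  then show ?case unfolding orders_bounded_def by blast
next
  case (Suc r)
  then have r: "r < d" by simp
  note le = less_imp_le[OF r]
  interpret divisor_step "Y r" "Y (Suc r)" U "y (Suc r)" by (rule step[OF r])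
  let ?ord = "ord_along (Y r) (Y (Suc r)) (y (Suc r))"
  let ?VW = "system_mult V W"
  note VW = bundle_system_mult[OF V W]
  have D: "D_condition d U Y y V W r" "D_step d U Y y V W r"
    using Suc.prems(2) by simp_all
  have IH: "Nu r ?VW = {a + b | a b. a \<in> Nu r V \<and> b \<in> Nu r W}"
    "orders_bounded V r" "orders_bounded W r" "orders_bounded ?VW r"
    using Suc.IH[OF le D(1)] by blast+
  have maxV: "\<forall>a\<in>Nu r V. \<exists>s. maximal_in (Y r) (Y (Suc r)) (res V a r) s"
    and maxW: "\<forall>a\<in>Nu r W. \<exists>s. maximal_in (Y r) (Y (Suc r)) (res W a r) s"
    and ptV: "\<forall>a\<in>Nu r V. \<exists>s\<in>res V a r. \<forall>p\<in>Y d. s p p \<noteq> 0"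
    and ptW: "\<forall>a\<in>Nu r W. \<exists>s\<in>res W a r. \<forall>p\<in>Y d. s p p \<noteq> 0"
    and satV: "\<forall>a\<in>Nu r V. saturated (Y r) (Y (Suc r)) (y (Suc r)) (res V a r)"
    and satW: "\<forall>a\<in>Nu r W. saturated (Y r) (Y (Suc r)) (y (Suc r)) (res W a r)"
    and prod: "\<forall>c. (\<exists>a\<in>Nu r V. \<exists>b\<in>Nu r W. c = a + b) \<longrightarrow>
      (\<exists>a\<in>Nu r V. \<exists>b\<in>Nu r W. a + b = c \<and> (\<exists>s\<in>res V a r. \<exists>t\<in>res W b r.
         maximal_in (Y r) (Y (Suc r)) (res ?VW c r) (family_mult s t)))"
    using D(2) unfolding D_step_def Let_def by blast+
  have prod': "\<exists>a\<in>Nu r V. \<exists>b\<in>Nu r W. a + b = c \<and> (\<exists>s\<in>res V a r. \<exists>t\<in>res W b r.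
         maximal_in (Y r) (Y (Suc r)) (res ?VW c r) (family_mult s t))" if "c \<in> Nu r ?VW" for c
    using prod[rule_format, of c] that unfolding IH(1) by blast
  have bV: "orders_bounded V (Suc r)"
    by (rule orders_bounded_if_maximal[OF V r IH(2) maxV])
  have bW: "orders_bounded W (Suc r)"
    by (rule orders_bounded_if_maximal[OF W r IH(3) maxW])
  have bVW: "orders_bounded ?VW (Suc r)"
    by (rule orders_bounded_if_maximal[OF VW r IH(4)]) (use prod' in blast)
  have "Nu (Suc r) ?VW \<subseteq> {a + b | a b. a \<in> Nu (Suc r) V \<and> b \<in> Nu (Suc r) W}"
  proof
    fix c' assume "c' \<in> Nu (Suc r) ?VW"
    then obtain f where f: "f \<in> ?VW" "f \<noteq> 0" "c' = nu U Y y (Suc r) f"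
      unfolding nu_set_def by blast
    define c where "c = nu U Y y r f"
    define w where "w = residual U Y y f r"
    define n where "n = ?ord w"
    have c: "c \<in> Nu r ?VW" unfolding c_def by (rule nu_setI[OF f(1,2) refl])
    obtain a b s t where ab: "a \<in> Nu r V" "b \<in> Nu r W" "a + b = c" "s \<in> res V a r" "t \<in> res W b r"
      and max: "maximal_in (Y r) (Y (Suc r)) (res ?VW c r) (family_mult s t)"
      using prod'[OF c] by blast
    obtain h where h: "regular_transitions (Y r) U h" "res ?VW c r \<subseteq> sections_on (Y r) U h"
      using restricted_sections[OF VW le] .
    obtain M where M: "family_mult s t \<in> res ?VW c r" "family_mult s t \<noteq> 0" "divisible M (family_mult s t)"
        "\<forall>t\<in>res ?VW c r. t \<noteq> 0 \<longrightarrow> (\<forall>n. divisible n t \<longrightarrow> n \<le> M)"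
      using maximal_bound[OF h max] .
    have nz: "s \<noteq> 0" "t \<noteq> 0"
    proof -
      have "family_mult 0 t = 0" "family_mult s 0 = 0"
        by (simp_all add: family_mult_def fun_eq_iff)
      then show "s \<noteq> 0" "t \<noteq> 0" using M(2) by auto
    qed
    obtain h1 s' i where s': "s' \<in> sections_on (Y r) U h1"
        "family_mult s' (family_power (y (Suc r)) i) = s"
        "restrict_family (Y (Suc r)) s' \<noteq> 0" "?ord s = i"
      by (rule ord_along_residual[OF V r bV ab(1,4) nz(1)])
    obtain h2 t' j where t': "t' \<in> sections_on (Y r) U h2"
        "family_mult t' (family_power (y (Suc r)) j) = t"
        "restrict_family (Y (Suc r)) t' \<noteq> 0" "?ord t = j"
      by (rule ord_along_residual[OF W r bW ab(2,5) nz(2)])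
    have "M \<le> i + j"
    proof -
      have "restrict_family (Y (Suc r)) (family_mult s' t') \<noteq> 0"
        unfolding restrict_mult
        by (rule P.section_mult_nonzero[OF restrict_sections[OF s'(1)] s'(3) restrict_sections[OF t'(1)] t'(3)])
      moreover have "family_mult (family_mult s' t') (family_power (y (Suc r)) (i + j)) = family_mult s t"
        unfolding s'(2)[symmetric] t'(2)[symmetric] family_mult_power_mult ..
      ultimately show ?thesis
        by (intro ord_along_eqI(3)[OF h(1) _ regular_families_mult[OF s'(1)[THEN sections_onD(1)] t'(1)[THEN sections_onD(1)]] _ _ M(3)]
            subsetD[OF h(2) M(1)])
    qed
    moreover have "n \<le> M"
    proof -
      have w: "w \<in> res ?VW c r" "w \<noteq> 0"
        using residual_in_restricted_system[OF VW f(1,2) IH(4) le] unfolding w_def c_def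
        by (rule conjunct1, rule conjunct2)
      obtain h' w' k where w': "w' \<in> sections_on (Y r) U h'"
          "family_mult w' (family_power (y (Suc r)) k) = w" "?ord w = k"
        by (rule ord_along_residual[OF VW r bVW c w])
      have "divisible n w"
        unfolding divisible_def n_def w'(3) using sections_onD(1)[OF w'(1)] w'(2) by blast
      then show ?thesis using M(4) w by blast
    qed
    ultimately have n: "n \<le> i + j" by simp
    define k where "k = min i n"
    have k: "k \<le> i" "n - k \<le> j" "k + (n - k) = n" using n unfolding k_def by auto
    obtain u where u: "u \<in> res V a r" "\<forall>p\<in>Y d. u p p \<noteq> 0" using ptV ab(1) by blast
    obtain v where v: "v \<in> res W b r" "\<forall>p\<in>Y d. v p p \<noteq> 0" using ptW ab(2) by blast
    have "a(Suc r := k) \<in> Nu (Suc r) V"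
      using smaller_orders_attained[OF V r ab(1) u satV[THEN bspec, OF ab(1)] ab(4) nz(1)] k(1) s'(4) by simp
    moreover have "b(Suc r := n - k) \<in> Nu (Suc r) W"
      using smaller_orders_attained[OF W r ab(2) v satW[THEN bspec, OF ab(2)] ab(5) nz(2)] k(2) t'(4) by simp
    moreover have "c' = a(Suc r := k) + b(Suc r := n - k)"
      unfolding f(3) nu_Suc c_def[symmetric] w_def[symmetric] n_def[symmetric] ab(3)[symmetric]
      using k(3) by (auto simp: fun_eq_iff)
    ultimately show "c' \<in> {a + b | a b. a \<in> Nu (Suc r) V \<and> b \<in> Nu (Suc r) W}" by blast
  qed
  moreover have "{a + b | a b. a \<in> Nu (Suc r) V \<and> b \<in> Nu (Suc r) W} \<subseteq> Nu (Suc r) ?VW"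
  proof clarify
    fix a b assume "a \<in> Nu (Suc r) V" "b \<in> Nu (Suc r) W"
    then obtain f g where f: "f \<in> V" "f \<noteq> 0" "a = nu U Y y (Suc r) f"
      and g: "g \<in> W" "g \<noteq> 0" "b = nu U Y y (Suc r) g"
      unfolding nu_set_def by blast
    have X: "covered_variety X U" using covered[of 0] Y_0 by simp
    obtain h h' where "f \<in> sections_on X U h" "g \<in> sections_on X U h'"
      using V W f(1) g(1) unfolding bundle_system_def by blast
    then have "family_mult f g \<noteq> 0"
      using covered_variety.section_mult_nonzero[OF X _ f(2) _ g(2)] by blast
    moreover have "nu U Y y (Suc r) (family_mult f g) = a + b"
      using nu_mult[OF V W f(1,2) g(1,2) bV bW Suc.prems(1)] unfolding f(3) g(3) by (rule conjunct2)
    ultimately show "a + b \<in> Nu (Suc r) ?VW"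
      by (intro nu_setI[OF mult_in_system_mult[OF f(1) g(1)]])
  qed
  ultimately show ?case using bV bW bVW by blast
qed

lemma finite_nu_set:
  assumes V: "bundle_system V"
  shows "orders_bounded V r \<Longrightarrow> r \<le> d \<Longrightarrow> finite (Nu r V)"
proof (induction r)
  case 0
  show ?case unfolding nu_set_0 by simp
next
  case (Suc r)
  then have r: "r < d" by simp
  interpret divisor_step "Y r" "Y (Suc r)" U "y (Suc r)" by (rule step[OF r])
  have b: "orders_bounded V r"
    by (rule orders_bounded_Suc[THEN iffD1, THEN conjunct1, OF Suc.prems(1)])
  have "\<forall>a\<in>Nu r V. \<exists>M. \<forall>s\<in>res V a r. s \<noteq> 0 \<longrightarrow> (\<forall>n. divisible n s \<longrightarrow> n \<le> M)"
    by (rule orders_bounded_Suc[THEN iffD1, THEN conjunct2, OF Suc.prems(1)])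
  from bchoice[OF this] obtain M where
    M: "\<forall>a\<in>Nu r V. \<forall>s\<in>res V a r. s \<noteq> 0 \<longrightarrow> (\<forall>n. divisible n s \<longrightarrow> n \<le> M a)" ..
  have "Nu (Suc r) V \<subseteq> (\<Union>a\<in>Nu r V. (\<lambda>n. a(Suc r := n)) ` {..M a})"
  proof
    fix c assume "c \<in> Nu (Suc r) V"
    then obtain f where f: "f \<in> V" "f \<noteq> 0" "c = nu U Y y (Suc r) f"
      unfolding nu_set_def by blast
    let ?a = "nu U Y y r f" and ?s = "residual U Y y f r"
    have a: "?a \<in> Nu r V" by (rule nu_setI[OF f(1,2) refl])
    have s: "?s \<in> res V ?a r" "?s \<noteq> 0"
      using residual_in_restricted_system[OF V f(1,2) b less_imp_le[OF r]]
      by (rule conjunct1, rule conjunct2)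
    obtain h' t n where t: "t \<in> sections_on (Y r) U h'"
        "family_mult t (family_power (y (Suc r)) n) = ?s"
        "ord_along (Y r) (Y (Suc r)) (y (Suc r)) ?s = n"
      by (rule ord_along_residual[OF V r Suc.prems(1) a s])
    have "divisible n ?s"
      using sections_onD(1)[OF t(1)] t(2) unfolding divisible_def by blast
    then have "n \<le> M ?a" using M a s by blast
    moreover have "c = ?a(Suc r := n)" unfolding f(3) nu_Suc t(3) ..
    ultimately show "c \<in> (\<Union>a\<in>Nu r V. (\<lambda>n. a(Suc r := n)) ` {..M a})" using a by blast
  qed
  moreover have "finite (Nu r V)" by (rule Suc.IH[OF b less_imp_le[OF r]])
  ultimately show ?case by (auto intro: finite_subset)
qed

end

lemma system_power_0: "system_power X U V 0 =
  range (\<lambda>c p q. if p \<in> X \<and> q \<in> U p \<inter> X then c else 0)"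
proof -
  interpret module "scale_family :: 'a \<Rightarrow> ('a, 'b) family \<Rightarrow> _" by (rule module_scale_family)
  have "{(\<lambda>p q. if p \<in> X \<and> q \<in> U p \<inter> X then \<Prod>j<(0::nat). s j p q else 0) | s. \<forall>j<(0::nat). s j \<in> V} =
      {(\<lambda>p q. if p \<in> X \<and> q \<in> U p \<inter> X then 1 else 0)}"
    by (auto cong: if_cong)
  then have "system_power X U V 0 =
      range (\<lambda>c. scale_family c (\<lambda>p q. if p \<in> X \<and> q \<in> U p \<inter> X then 1 else 0))"
    unfolding system_power_def by (simp only: span_singleton)
  moreover have "scale_family c (\<lambda>p q. if p \<in> X \<and> q \<in> U p \<inter> X then 1 else 0) =
      (\<lambda>p q. if p \<in> X \<and> q \<in> U p \<inter> X then c else 0)" for c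
    by (auto simp: scale_family_def fun_eq_iff)
  ultimately show ?thesis by simp
qed

lemma system_power_Suc: "system_power X U V (Suc m) = system_mult V (system_power X U V m)"
proof -
  interpret module "scale_family :: 'a \<Rightarrow> ('a, 'b) family \<Rightarrow> _" by (rule module_scale_family)
  define pf where "pf = (\<lambda>(m::nat) s p q. if p \<in> X \<and> q \<in> U p \<inter> X then \<Prod>j<m. (s j :: ('a, 'b) family) p q else 0)"
  define G where "G = (\<lambda>m. {pf m s | s. \<forall>j<m. s j \<in> V})"
  have power: "system_power X U V m = span (G m)" for m
    unfolding system_power_def G_def pf_def ..
  have pf: "pf (Suc m) s = family_mult (s m) (pf m s)" for s
    by (auto simp: pf_def family_mult_def fun_eq_iff mult.commute)
  show ?thesis
    unfolding power
  proof (rule subset_antisym)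
    have "G (Suc m) \<subseteq> {family_mult s t | s t. s \<in> V \<and> t \<in> span (G m)}"
    proof
      fix w assume "w \<in> G (Suc m)"
      then obtain s where s: "w = family_mult (s m) (pf m s)" "\<forall>j<Suc m. s j \<in> V"
        unfolding G_def pf by blast
      then have "pf m s \<in> span (G m)" by (intro span_base) (auto simp: G_def)
      with s show "w \<in> {family_mult s t | s t. s \<in> V \<and> t \<in> span (G m)}" by blast
    qed
    then show "span (G (Suc m)) \<subseteq> system_mult V (span (G m))"
      unfolding system_mult_def by (rule span_mono)
    have "family_mult v w \<in> span (G (Suc m))" if v: "v \<in> V" and w: "w \<in> span (G m)" for v w
      using w
    proof (induction rule: span_induct)
      case base
      show ?case
      proof (rule subspaceI)
        have "family_mult v 0 = 0" by (simp add: family_mult_def fun_eq_iff)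
        then show "0 \<in> {w. family_mult v w \<in> span (G (Suc m))}" using span_zero by simp
        fix x z assume "x \<in> {w. family_mult v w \<in> span (G (Suc m))}" "z \<in> {w. family_mult v w \<in> span (G (Suc m))}"
        moreover have "family_mult v (x + z) = family_mult v x + family_mult v z"
          by (simp add: family_mult_def fun_eq_iff distrib_left)
        ultimately show "x + z \<in> {w. family_mult v w \<in> span (G (Suc m))}"
          using span_add by simp
      next
        fix c x assume "x \<in> {w. family_mult v w \<in> span (G (Suc m))}"
        moreover have "family_mult v (scale_family c x) = scale_family c (family_mult v x)"
          by (simp add: family_mult_def scale_family_def fun_eq_iff)
        ultimately show "scale_family c x \<in> {w. family_mult v w \<in> span (G (Suc m))}"
          using span_scale by simp
      qed
    next
      case (step w)
      then obtain s where s: "w = pf m s" "\<forall>j<m. s j \<in> V" unfolding G_def by blast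
      have "pf m s = pf m (s(m := v))"
        by (auto simp: pf_def fun_eq_iff)
      then have "family_mult v w = pf (Suc m) (s(m := v))"
        unfolding s(1) pf by simp
      then show ?case
        using s(2) v by (intro span_base) (auto simp: G_def less_Suc_eq)
    qed
    then show "system_mult V (span (G m)) \<subseteq> span (G (Suc m))"
      unfolding system_mult_def by (intro span_minimal subspace_span) blast
  qed
qed

lemma system_power_1:
  assumes "V \<subseteq> regular_families X U" "module.subspace scale_family V"
  shows "system_power X U V 1 = V"
proof -
  interpret module "scale_family :: 'a \<Rightarrow> ('a, 'b) family \<Rightarrow> _" by (rule module_scale_family)
  have eq: "(\<lambda>p q. if p \<in> X \<and> q \<in> U p \<inter> X then \<Prod>j<1. s j p q else 0) = s 0" if "s 0 \<in> V" for s :: "nat \<Rightarrow> ('a, 'b) family"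
  proof (intro ext)
    fix p q
    have "s 0 \<in> regular_families X U" using that assms(1) by blast
    from regular_familiesD(2)[OF this, of p q]
    show "(if p \<in> X \<and> q \<in> U p \<inter> X then \<Prod>j<1. s j p q else 0) = s 0 p q" by auto
  qed
  have "{(\<lambda>p q. if p \<in> X \<and> q \<in> U p \<inter> X then \<Prod>j<(1::nat). s j p q else 0) | s. \<forall>j<(1::nat). s j \<in> V} = V"
  proof
    show "{(\<lambda>p q. if p \<in> X \<and> q \<in> U p \<inter> X then \<Prod>j<(1::nat). s j p q else 0) | s. \<forall>j<(1::nat). s j \<in> V} \<subseteq> V"
    proof clarify
      fix s :: "nat \<Rightarrow> ('a, 'b) family" assume "\<forall>j<1. s j \<in> V"
      then have "s 0 \<in> V" by simp
      with eq[of s] show "(\<lambda>p q. if p \<in> X \<and> q \<in> U p \<inter> X then \<Prod>j<1. s j p q else 0) \<in> V" by simp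
    qed
    show "V \<subseteq> {(\<lambda>p q. if p \<in> X \<and> q \<in> U p \<inter> X then \<Prod>j<(1::nat). s j p q else 0) | s. \<forall>j<(1::nat). s j \<in> V}"
    proof
      fix v assume v: "v \<in> V"
      with eq[of "\<lambda>_. v"]
      show "v \<in> {(\<lambda>p q. if p \<in> X \<and> q \<in> U p \<inter> X then \<Prod>j<(1::nat). s j p q else 0) | s. \<forall>j<(1::nat). s j \<in> V}"
        by (intro CollectI exI[of _ "\<lambda>_. v"]) simp
    qed
  qed
  then show ?thesis
    unfolding system_power_def using assms(2) by (simp only: span_eq_iff)
qed

context flagged
begin

text \<open>A nonzero constant restricts to a nonzero constant at each step.  The degree zero part of the
  graded semigroup consists of the values of the constants.\<close>

lemma nu_const:
  assumes c: "c \<noteq> 0"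
  defines "C \<equiv> \<lambda>r p q. if p \<in> Y r \<and> q \<in> U p \<inter> Y r then c else 0"
  shows "r \<le> d \<Longrightarrow> residual U Y y (C 0) r = C r \<and> nu U Y y r (C 0) = 0"
proof (induction r)
  case 0
  show ?case by (simp add: nu_def fun_eq_iff)
next
  case (Suc r)
  then have r: "r < d" by simp
  interpret divisor_step "Y r" "Y (Suc r)" U "y (Suc r)" by (rule step[OF r])
  have IH: "residual U Y y (C 0) r = C r" "nu U Y y r (C 0) = 0"
    using Suc.IH[OF less_imp_le[OF r]] by (rule conjunct1, rule conjunct2)
  have fam: "C r \<in> regular_families (Y r) U"
    by (rule regular_familiesI) (auto simp: C_def intro: regular_cong[OF regular_const[of _ c]])
  have sec: "C r \<in> sections_on (Y r) U (\<lambda>_ _ _. 1)"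
    by (rule sections_onI[OF fam]) (auto simp: C_def)
  have tr: "regular_transitions (Y r) U (\<lambda>_ _ _. 1)"
    unfolding regular_transitions_def by (intro ballI regular_const)
  have rs: "restrict_family (Y (Suc r)) (C r) = C (Suc r)"
    using subset by (auto simp: restrict_family_def C_def fun_eq_iff)
  obtain p where p: "p \<in> Y (Suc r)" using P.nonempty by blast
  have "C (Suc r) p p = c" using p P.cover(2)[OF p] by (simp add: C_def)
  then have "C (Suc r) \<noteq> 0" using c by auto
  then have nz: "restrict_family (Y (Suc r)) (C r) \<noteq> 0" unfolding rs .
  have one: "family_mult (C r) (family_power (y (Suc r)) 0) = C r"
    by (simp add: family_mult_def family_power_def)
  note * = ord_along_eqI(1,2)[OF tr sec fam one nz]
  have "residual U Y y (C 0) (Suc r) = C (Suc r)"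
    unfolding residual.simps(2) IH(1) * rs ..
  moreover have "nu U Y y (Suc r) (C 0) = 0"
    unfolding nu_Suc IH * by (auto simp: fun_eq_iff)
  ultimately show ?case ..
qed

lemma nu_set_system_power_0:
  assumes "r \<le> d"
  shows "Nu r (system_power X U V 0) = {0}"
proof -
  define C where "C = (\<lambda>c p q. if p \<in> X \<and> q \<in> U p \<inter> X then c else (0 :: 'k))"
  interpret covered_variety X U using covered[of 0] Y_0 by simp
  obtain p where p: "p \<in> X" using nonempty by blast
  have nz: "C c \<noteq> 0 \<longleftrightarrow> c \<noteq> 0" for c
  proof
    assume "c \<noteq> 0"
    then have "C c p p \<noteq> 0" using p cover(2)[OF p] by (simp add: C_def)
    then show "C c \<noteq> 0" by auto
  next
    assume "C c \<noteq> 0"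
    moreover have "C 0 = 0" by (simp add: C_def fun_eq_iff)
    ultimately show "c \<noteq> 0" by auto
  qed
  have nu: "nu U Y y r (C c) = 0" if "c \<noteq> 0" for c
    using nu_const[OF that assms] unfolding Y_0 C_def by (rule conjunct2)
  have "system_power X U V 0 = range C" unfolding system_power_0 C_def ..
  then have "Nu r (system_power X U V 0) = nu U Y y r ` (range C - {0})"
    unfolding nu_set_def by simp
  also have "range C - {0} = C ` {c. c \<noteq> 0}" using nz by auto
  also have "nu U Y y r ` C ` {c. c \<noteq> 0} = (\<lambda>_. 0) ` {c :: 'k. c \<noteq> 0}"
    unfolding image_image by (intro image_cong refl) (simp add: nu)
  also have "\<dots> = {0}"
    using one_neq_zero[where 'a = 'k] unfolding image_constant_conv by (auto simp del: one_neq_zero)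
  finally show ?thesis .
qed

lemma bundle_system_power: "bundle_system V \<Longrightarrow> bundle_system (system_power X U V m)"
proof (induction m)
  case 0
  have "(\<lambda>p q. if p \<in> X \<and> q \<in> U p \<inter> X then c else 0) \<in> sections_on X U (\<lambda>_ _ _. 1)" for c :: 'k
    by (intro sections_onI regular_familiesI) (auto intro: regular_cong[OF regular_const[of _ c]])
  moreover have "regular_transitions X U (\<lambda>_ _ _. 1)"
    unfolding regular_transitions_def by (intro ballI regular_const)
  ultimately show ?case
    unfolding bundle_system_def system_power_0 by blast
next
  case (Suc m)
  then show ?case unfolding system_power_Suc by (intro bundle_system_mult)
qed

end


section \<open>Cones over finite sets of lattice points\<close>

text \<open>The point of the cone over \<open>{1} \<times> N\<close> with the coefficients \<open>u\<close>.\<close>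

definition cone_point :: "(nat \<Rightarrow> real) set \<Rightarrow> ((nat \<Rightarrow> real) \<Rightarrow> real) \<Rightarrow> real \<times> (nat \<Rightarrow> real)" where
  "cone_point N u = (\<Sum>v\<in>N. u v, \<Sum>v\<in>N. u v *\<^sub>R v)"

text \<open>By induction on \<open>N\<close>, the set is a continuous image of a product of intervals.\<close>

lemma compact_cone_points:
  assumes "finite N"
  shows "compact (cone_point N ` {u. \<forall>v. 0 \<le> u v \<and> u v \<le> c})"
  using assms
proof (induction N rule: finite_induct)
  case empty
  have "cone_point {} ` {u. \<forall>v. 0 \<le> u v \<and> u v \<le> c} \<subseteq> {(0, 0)}"
    by (auto simp: cone_point_def)
  then show ?case by (meson finite.emptyI finite.insertI finite_imp_compact finite_subset)
next
  case (insert v N)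
  let ?B = "{u :: (nat \<Rightarrow> real) \<Rightarrow> real. \<forall>v. 0 \<le> u v \<and> u v \<le> c}"
  define F where "F = (\<lambda>z. (fst (snd z) + fst z, snd (snd z) + fst z *\<^sub>R v) :: real \<times> (nat \<Rightarrow> real))"
  have pt: "cone_point (insert v N) u = F (u v, cone_point N u)" for u
    using insert.hyps by (simp add: cone_point_def F_def add.commute)
  have eq: "cone_point (insert v N) ` ?B = F ` ({0..c} \<times> cone_point N ` ?B)"
  proof (intro subset_antisym subsetI)
    fix x assume "x \<in> cone_point (insert v N) ` ?B"
    then obtain u where u: "u \<in> ?B" "x = F (u v, cone_point N u)" using pt by blast
    then show "x \<in> F ` ({0..c} \<times> cone_point N ` ?B)" by auto
  next
    fix x assume "x \<in> F ` ({0..c} \<times> cone_point N ` ?B)"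
    then obtain s u where s: "s \<in> {0..c}" "u \<in> ?B" "x = F (s, cone_point N u)" by blast
    have "cone_point N (u(v := s)) = cone_point N u"
      unfolding cone_point_def using insert.hyps(2) by (auto intro!: sum.cong)
    then have "x = cone_point (insert v N) (u(v := s))"
      using s(3) by (simp add: pt)
    moreover have "u(v := s) \<in> ?B" using s(1,2) by auto
    ultimately show "x \<in> cone_point (insert v N) ` ?B" by blast
  qed
  have "continuous_on A F" for A
    unfolding F_def scaleR_fun_def plus_fun_def
    by (intro continuous_on_Pair continuous_intros continuous_on_coordinatewise_then_product
        continuous_on_product_then_coordinatewise[of A "\<lambda>z. snd (snd z)"])
  then show ?case
    unfolding eq by (intro compact_continuous_image compact_Times insert.IH compact_Icc)
qed

lemma cone_point_add: "cone_point N u + cone_point N w = cone_point N (\<lambda>v. u v + w v)"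
  by (simp add: cone_point_def sum.distrib scaleR_add_left)

lemma cone_point_scale: "c *\<^sub>R cone_point N u = cone_point N (\<lambda>v. c * u v)"
  by (simp add: cone_point_def sum_distrib_left scaleR_sum_right)

text \<open>Below height \<open>2\<close>, the points of the cone have coefficients at most \<open>2\<close>.  These points lie in
  a compact subset of the cone, so taking closures does not add points of height \<open>1\<close>.\<close>

lemma slice_of_lattice_cone:
  fixes N :: "(nat \<Rightarrow> nat) set"
  assumes N: "finite N" "\<And>a j. a \<in> N \<Longrightarrow> j \<notin> {1..d} \<Longrightarrow> a j = 0"
  shows "({1} \<times> coord_space d) \<inter>
      closure (convex hull ((\<lambda>(m, a). (real m, real_point a)) ` generated_semigroup ({1} \<times> N))) =
    {1} \<times> (convex hull (real_point ` N))"
proof -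
  define P where "P = real_point ` N"
  define G where "G = (\<lambda>(m, a). (real m, real_point a)) ` generated_semigroup ({1} \<times> N)"
  define K where "K = cone_point P ` {u. \<forall>v. 0 \<le> u v}"
  have finP: "finite P" unfolding P_def using N by simp
  have "convex K"
  proof (rule convexI)
    fix x z and a b :: real assume "x \<in> K" "z \<in> K" and ab: "0 \<le> a" "0 \<le> b" "a + b = 1"
    then obtain u w where u: "\<forall>v. 0 \<le> u v" "x = cone_point P u" and w: "\<forall>v. 0 \<le> w v" "z = cone_point P w"
      unfolding K_def by blast
    have "a *\<^sub>R x + b *\<^sub>R z = cone_point P (\<lambda>v. a * u v + b * w v)"
      unfolding u(2) w(2) cone_point_scale cone_point_add ..
    moreover have "\<forall>v. 0 \<le> a * u v + b * w v" using u w ab by simp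
    ultimately show "a *\<^sub>R x + b *\<^sub>R z \<in> K" unfolding K_def by blast
  qed
  have gen: "(\<lambda>(m, a). (real m, real_point a)) z \<in> K" if "z \<in> generated_semigroup ({1} \<times> N)" for z
    using that
  proof induction
    case zero
    have "(\<lambda>(m, a). (real m, real_point a)) 0 = cone_point P (\<lambda>_. 0)"
    proof -
      have "real_point 0 = 0" by (simp add: real_point_def fun_eq_iff)
      then show ?thesis by (simp add: cone_point_def zero_prod_def)
    qed
    then show ?case unfolding K_def by blast
  next
    case (add x z)
    obtain a where a: "x = (1, a)" "a \<in> N" using add.hyps(1) by blast
    obtain u where u: "\<forall>v. 0 \<le> u v" "(\<lambda>(m, a). (real m, real_point a)) z = cone_point P u"
      using add.IH unfolding K_def by blast
    have aP: "real_point a \<in> P" unfolding P_def using a by blast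
    let ?e = "\<lambda>v. if v = real_point a then 1 else 0 :: real"
    have "cone_point P ?e = (1, real_point a)"
      unfolding cone_point_def using finP aP by (simp add: if_distrib[of "\<lambda>c. c *\<^sub>R _"] cong: if_cong)
    moreover have "(\<lambda>(m, a). (real m, real_point a)) (x + z) =
        (1, real_point a) + (\<lambda>(m, a). (real m, real_point a)) z"
      unfolding a by (cases z) (simp add: real_point_def plus_fun_def)
    ultimately have "(\<lambda>(m, a). (real m, real_point a)) (x + z) = cone_point P (\<lambda>v. ?e v + u v)"
      unfolding u(2) cone_point_add[symmetric] by simp
    moreover have "\<forall>v. 0 \<le> ?e v + u v" using u(1) by simp
    ultimately show ?case unfolding K_def by blast
  qed
  have "G \<subseteq> K" unfolding G_def using gen by blast
  then have hull: "convex hull G \<subseteq> K"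
    by (rule hull_minimal) (rule \<open>convex K\<close>)
  have "x \<in> convex hull P" if x: "(1, x) \<in> closure (convex hull G)" for x
  proof -
    let ?H = "{z :: real \<times> (nat \<Rightarrow> real). fst z < 2}"
    let ?C = "cone_point P ` {u. \<forall>v. 0 \<le> u v \<and> u v \<le> 2}"
    have "open ?H" by (intro open_Collect_less continuous_intros)
    have "?H \<inter> K \<subseteq> ?C"
    proof
      fix z assume z: "z \<in> ?H \<inter> K"
      then obtain u where u: "\<forall>v. 0 \<le> u v" "z = cone_point P u" unfolding K_def by blast
      have "u v \<le> 2" if "v \<in> P" for v
      proof -
        have "u v \<le> (\<Sum>v\<in>P. u v)" using u(1) finP that by (intro member_le_sum) auto
        also have "\<dots> < 2" using z u(2) by (simp add: cone_point_def)
        finally show ?thesis by simp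
      qed
      \<comment> \<open>Setting the coefficients outside \<open>P\<close> to zero bounds them and preserves the point.\<close>
      then have "(\<lambda>v. if v \<in> P then u v else 0) \<in> {u. \<forall>v. 0 \<le> u v \<and> u v \<le> 2}"
        using u(1) by simp
      moreover have "z = cone_point P (\<lambda>v. if v \<in> P then u v else 0)"
        unfolding u(2) cone_point_def by (auto intro!: sum.cong)
      ultimately show "z \<in> ?C" by blast
    qed
    moreover have "closed ?C"
      by (intro compact_imp_closed compact_cone_points finP)
    ultimately have "closure (?H \<inter> K) \<subseteq> ?C" by (rule closure_minimal)
    moreover have "(1, x) \<in> ?H \<inter> closure K"
      using x closure_mono[OF hull] by auto
    ultimately have "(1, x) \<in> ?C"
      using open_Int_closure_subset[OF \<open>open ?H\<close>, of K] by blast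
    then obtain u where "\<forall>v. 0 \<le> u v" "(1, x) = cone_point P u" by auto
    then show ?thesis
      unfolding convex_hull_finite[OF finP] by (auto simp: cone_point_def)
  qed
  moreover have "(1, x) \<in> closure (convex hull G) \<and> x \<in> coord_space d" if x: "x \<in> convex hull P" for x
  proof
    obtain u where u: "\<forall>v\<in>P. 0 \<le> u v" "sum u P = 1" "x = (\<Sum>v\<in>P. u v *\<^sub>R v)"
      using x unfolding convex_hull_finite[OF finP] by blast
    have "(1, v) \<in> G" if v: "v \<in> P" for v
    proof -
      obtain a where a: "a \<in> N" "v = real_point a" using v unfolding P_def by blast
      have "(1, a) + 0 \<in> generated_semigroup ({1 :: nat} \<times> N)"
        by (rule generated_semigroup.add[OF _ generated_semigroup.zero]) (use a in simp)
      then have "(\<lambda>(m, a). (real m, real_point a)) (1, a) \<in> G"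
        unfolding G_def by (intro imageI) simp
      then show ?thesis using a by simp
    qed
    then have "(\<Sum>v\<in>P. u v *\<^sub>R (1 :: real, v)) \<in> convex hull G"
      by (intro convex_sum finP convex_convex_hull u(2) hull_inc) (use u(1) in auto)
    moreover have "(\<Sum>v\<in>P. u v *\<^sub>R (1 :: real, v)) = (1, x)"
      by (simp add: prod_eq_iff fst_sum snd_sum u)
    ultimately show "(1, x) \<in> closure (convex hull G)"
      using closure_subset by auto
    show "x \<in> coord_space d"
    proof -
      have zero: "v j = 0" if "v \<in> P" "j \<notin> {1..d}" for v j
        using that N(2) unfolding P_def real_point_def by auto
      have "(\<Sum>v\<in>A. u v *\<^sub>R v) j = 0" if A: "finite A" "A \<subseteq> P" and j: "j \<notin> {1..d}" for A j
        using A by (induction A rule: finite_induct) (use zero j in \<open>auto simp: scaleR_fun_def\<close>)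
      then show ?thesis
        unfolding coord_space_def u(3) using finP by blast
    qed
  qed
  ultimately have "({1} \<times> coord_space d) \<inter> closure (convex hull G) = {1} \<times> (convex hull P)"
    by auto
  then show ?thesis unfolding G_def P_def .
qed

lemma linear_system_bundle_system:
  assumes "projective_variety X" and "line_bundle X U g" "flag X d U Y y" "linear_system X U g V"
  shows "flagged X d U Y y" "flagged.bundle_system X U V" "V \<subseteq> regular_families X U"
proof -
  show F: "flagged X d U Y y"
    using assms unfolding flagged_def line_bundle_def by blast
  interpret flagged X d U Y y by (rule F)
  have V: "V \<subseteq> sections X U g" using assms(4) unfolding linear_system_def by blast
  then show "V \<subseteq> regular_families X U" unfolding sections_def by blast
  have "regular (U p \<inter> U q \<inter> X) (g p q)" if "p \<in> X" "q \<in> X" for p q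
  proof -
    have "regular (U p \<inter> U q) (g p q)"
      using assms(2) that unfolding line_bundle_def by blast
    then show ?thesis by (rule regular_subset) blast
  qed
  moreover have "V \<subseteq> sections_on X U g"
    using V unfolding sections_def sections_on_def by blast
  ultimately show "bundle_system V"
    unfolding bundle_system_def regular_transitions_def by blast
qed

theorem corollary4p11:
  fixes X :: "('k::alg_closed_field, 'n::finite) pspace set"
    and U :: "('k, 'n) pspace \<Rightarrow> ('k, 'n) pspace set"
    and g :: "('k, 'n) pspace \<Rightarrow> ('k, 'n) pspace \<Rightarrow> ('k, 'n) pspace \<Rightarrow> 'k"
    and Y :: "nat \<Rightarrow> ('k, 'n) pspace set"
    and y :: "nat \<Rightarrow> ('k, 'n) family"
    and V :: "('k, 'n) family set"
    and d r :: nat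
  assumes "projective_variety X" and "has_dim X d"
    and "line_bundle X U g"
    and "flag X d U Y y"
    and "linear_system X U g V"
    and "1 \<le> r" and "r \<le> d"
    and "\<And>m. 1 \<le> m \<Longrightarrow> D_condition d U Y y V (system_power X U V m) r"
  shows "Gamma_nu U Y y r V = generated_semigroup ({1} \<times> nu_set U Y y r V) \<and>
    (r = d \<longrightarrow>
       finite (nu_set U Y y d V) \<and>
       okounkov_body U Y y d V = {1} \<times> (convex hull (real_point ` nu_set U Y y d V)))"
proof -
  note sys = linear_system_bundle_system[OF assms(1,3,4,5)]
  interpret flagged X d U Y y by (rule sys)
  note V = sys(2)
  let ?N = "Nu r V"
  have pow_1: "system_power X U V 1 = V"
    using system_power_1[OF sys(3)] assms(5) unfolding linear_system_def by blast
  have pow_0: "Nu r (system_power X U V 0) = {0}"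
    by (rule nu_set_system_power_0[OF assms(7)])
  have pow_Suc: "Nu r (system_power X U V (Suc m)) =
      {a + b | a b. a \<in> ?N \<and> b \<in> Nu r (system_power X U V m)}" for m
  proof (cases m)
    case 0
    then show ?thesis using pow_1 pow_0 by simp
  next
    case (Suc k)
    then show ?thesis
      unfolding system_power_Suc[of X U V m]
      using nu_set_system_mult[OF V bundle_system_power[OF V] assms(7) assms(8), of m] by simp
  qed
  have "(m, a) \<in> generated_semigroup ({1} \<times> ?N)" if "a \<in> Nu r (system_power X U V m)" for m a
    using that
  proof (induction m arbitrary: a)
    case 0
    then have "(0, a) = 0" using pow_0 by (simp add: zero_prod_def)
    then show ?case using generated_semigroup.zero by metis
  next
    case (Suc m)
    then obtain b c where bc: "a = b + c" "b \<in> ?N" "c \<in> Nu r (system_power X U V m)"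
      unfolding pow_Suc by blast
    have "(1, b) + (m, c) \<in> generated_semigroup ({1} \<times> ?N)"
      by (rule generated_semigroup.add) (use bc Suc.IH in auto)
    moreover have "(1, b) + (m, c) = (Suc m, a)"
      unfolding bc(1) plus_prod_def by simp
    ultimately show ?case by metis
  qed
  moreover have "snd z \<in> Nu r (system_power X U V (fst z))" if "z \<in> generated_semigroup ({1} \<times> ?N)" for z
    using that
  proof induction
    case zero
    show ?case unfolding fst_zero snd_zero pow_0 by blast
  next
    case (add x z)
    then have x: "fst x = 1" "snd x \<in> ?N" by auto
    then have f: "fst (x + z) = Suc (fst z)" by simp
    show ?case
      unfolding f snd_add pow_Suc using x(2) add.IH by blast
  qed
  moreover have "Gamma_nu U Y y r V = {(m, a). a \<in> Nu r (system_power X U V m)}"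
    unfolding Gamma_nu_def nu_set_def Y_0 by blast
  ultimately have Gamma: "Gamma_nu U Y y r V = generated_semigroup ({1} \<times> ?N)"
    by force
  have "orders_bounded V r"
    using nu_set_system_mult[OF V bundle_system_power[OF V] assms(7) assms(8), of 1] by simp
  then have fin: "finite ?N"
    by (rule finite_nu_set[OF V _ assms(7)])
  have "okounkov_body U Y y r V = {1} \<times> (convex hull (real_point ` ?N))"
    unfolding okounkov_body_def Gamma
    by (rule slice_of_lattice_cone[OF fin]) (simp add: nu_set_support)
  with Gamma fin show ?thesis by blast
qed

end
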